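(* Let $G$ be a finite group generated by two elements $g_r,g_u$, and let $M$ be the regular origami associated to $(G,g_r,g_u)$, so that $\mathrm{Aut}(M)$ is identified with $G$. Let $\rho_\alpha: G\to \mathrm{Aut}(V_\alpha)$ be an irreducible complex representation of $G$. Then the multiplicity of $\rho_\alpha$ in the $G$-module $H_1^{(0)}(M,\mathbf{C})$ is equal to the codimension in $V_\alpha$ of the fixed space $\{v\in V_\alpha : \rho_\alpha([g_r,g_u])v=v\}$, where $[g_r,g_u]=g_rg_ug_r^{-1}g_u^{-1}$.
   Context: An origami is a ramified covering $\pi:M\to \mathbf{T}^2=\mathbf{R}^2/\mathbf{Z}^2$ from a compact connected surface, unramified outside the point $0\in\mathbf{T}^2$. Its squares are the connected components of $\pi^{-1}((0,1)^2)$. $\mathrm{Aut}(M)$ is the group of homeomorphisms $f$ of $M$ with $\pi\circ f=\pi$. Given a finite group $G$ and generators $g_r,g_u$ of $G$, the regular origami associated to $(G,g_r,g_u)$ is the origami whose squares are the elements of $G$, the square to the right of $g$ being $gg_r$ and the square above $g$ being $gg_u$. Its automorphism group is canonically identified with $G$, acting on the set of squares by left multiplication. $H_1^{(0)}(M,\mathbf{C})$ denotes the kernel of the map $\pi_*:H_1(M,\mathbf{C})\to H_1(\mathbf{T}^2,\mathbf{C})$; it is an $\mathrm{Aut}(M)$-submodule of $H_1(M,\mathbf{C})$. *)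

theory Defs
  imports
    "HOL-Homology.Homology"
    "HOL-Algebra.Generated_Groups"
    "HOL-Algebra.Group_Action"
    "HOL-Algebra.Algebraic_Closure_Type"
    "Jordan_Normal_Form.Missing_VectorSpace"
begin

section \<open>Linear representations\<close>

abbreviation complex_ring :: "complex ring" where
  "complex_ring \<equiv> ring_of_type_algebra"

text \<open>A homomorphism from \<open>G\<close> to the linear automorphisms of \<open>V\<close>: \<^const>\<open>group_action\<close> says that
  \<open>\<rho>\<close> is a group homomorphism into the permutations of \<open>carrier V\<close> (extended by \<open>undefined\<close> outside
  the carrier). No finiteness of the dimension is imposed; for irreducible \<open>\<rho>\<close> and finite \<open>G\<close> it is
  automatic.\<close>

definition representation ::
  "('k, 'a) ring_scheme \<Rightarrow> ('g, 'b) monoid_scheme \<Rightarrow> ('k, 'v, 'c) module_scheme \<Rightarrow> ('g \<Rightarrow> 'v \<Rightarrow> 'v) \<Rightarrow> bool"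
where
  "representation K G V \<rho> \<longleftrightarrow>
     vectorspace K V \<and> group_action G (carrier V) \<rho> \<and>
     (\<forall>g\<in>carrier G. \<rho> g \<in> module_hom K V V)"

definition subrepresentation ::
  "('k, 'a) ring_scheme \<Rightarrow> ('g, 'b) monoid_scheme \<Rightarrow> ('k, 'v, 'c) module_scheme \<Rightarrow> ('g \<Rightarrow> 'v \<Rightarrow> 'v) \<Rightarrow> 'v set \<Rightarrow> bool"
where
  "subrepresentation K G V \<rho> W \<longleftrightarrow>
     VectorSpace.subspace K W V \<and> (\<forall>g\<in>carrier G. \<rho> g ` W \<subseteq> W)"

definition irreducible_representation ::
  "('k, 'a) ring_scheme \<Rightarrow> ('g, 'b) monoid_scheme \<Rightarrow> ('k, 'v, 'c) module_scheme \<Rightarrow> ('g \<Rightarrow> 'v \<Rightarrow> 'v) \<Rightarrow> bool"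
where
  "irreducible_representation K G V \<rho> \<longleftrightarrow>
     representation K G V \<rho> \<and> carrier V \<noteq> {\<zero>\<^bsub>V\<^esub>} \<and>
     (\<forall>W. subrepresentation K G V \<rho> W \<longrightarrow> W = {\<zero>\<^bsub>V\<^esub>} \<or> W = carrier V)"

definition isomorphic_representations ::
  "('k, 'a) ring_scheme \<Rightarrow> ('g, 'b) monoid_scheme \<Rightarrow>
   ('k, 'v, 'c) module_scheme \<Rightarrow> ('g \<Rightarrow> 'v \<Rightarrow> 'v) \<Rightarrow>
   ('k, 'w, 'd) module_scheme \<Rightarrow> ('g \<Rightarrow> 'w \<Rightarrow> 'w) \<Rightarrow> bool"
where
  "isomorphic_representations K G V \<rho> W \<sigma> \<longleftrightarrow>
     (\<exists>f \<in> module_hom K V W. bij_betw f (carrier V) (carrier W) \<and>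
        (\<forall>g\<in>carrier G. \<forall>v\<in>carrier V. f (\<rho> g v) = \<sigma> g (f v)))"

definition restrict_representation :: "('g \<Rightarrow> 'v \<Rightarrow> 'v) \<Rightarrow> 'v set \<Rightarrow> 'g \<Rightarrow> 'v \<Rightarrow> 'v" where
  "restrict_representation \<rho> W g = restrict (\<rho> g) W"

text \<open>\<open>V\<close> is the internal direct sum of the irreducible subrepresentations \<open>W 0, \<dots>, W (n - 1)\<close>.\<close>

definition irreducible_decomposition ::
  "('k, 'a) ring_scheme \<Rightarrow> ('g, 'b) monoid_scheme \<Rightarrow> ('k, 'v, 'c) module_scheme \<Rightarrow> ('g \<Rightarrow> 'v \<Rightarrow> 'v) \<Rightarrow>
   nat \<Rightarrow> (nat \<Rightarrow> 'v set) \<Rightarrow> bool"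
where
  "irreducible_decomposition K G V \<rho> n W \<longleftrightarrow>
     representation K G V \<rho> \<and>
     (\<forall>i<n. subrepresentation K G V \<rho> (W i) \<and>
            irreducible_representation K G (V\<lparr>carrier := W i\<rparr>) (restrict_representation \<rho> (W i))) \<and>
     (\<forall>v\<in>carrier V. \<exists>!w. w \<in> (\<Pi>\<^sub>E i\<in>{..<n}. W i) \<and> finsum V w {..<n} = v)"

text \<open>The multiplicity of the irreducible \<open>(V, \<rho>)\<close> in \<open>(U, \<sigma>)\<close> is \<open>m\<close>: the representation \<open>(U, \<sigma>)\<close>
  is a finite direct sum of irreducibles, and every such decomposition has exactly \<open>m\<close> summands
  isomorphic to \<open>(V, \<rho>)\<close>.\<close>

definition has_multiplicity ::
  "('k, 'a) ring_scheme \<Rightarrow> ('g, 'b) monoid_scheme \<Rightarrow>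
   ('k, 'v, 'c) module_scheme \<Rightarrow> ('g \<Rightarrow> 'v \<Rightarrow> 'v) \<Rightarrow>
   ('k, 'u, 'd) module_scheme \<Rightarrow> ('g \<Rightarrow> 'u \<Rightarrow> 'u) \<Rightarrow> nat \<Rightarrow> bool"
where
  "has_multiplicity K G V \<rho> U \<sigma> m \<longleftrightarrow>
     (\<exists>n W. irreducible_decomposition K G U \<sigma> n W) \<and>
     (\<forall>n W. irreducible_decomposition K G U \<sigma> n W \<longrightarrow>
        card {i. i < n \<and> isomorphic_representations K G V \<rho>
                           (U\<lparr>carrier := W i\<rparr>) (restrict_representation \<sigma> (W i))} = m)"

text \<open>Only meaningful for finite-dimensional \<open>V\<close>, where \<open>dim W \<le> dim V\<close> and the subtraction on
  \<^typ>\<open>nat\<close> is harmless.\<close>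

definition codimension ::
  "('k, 'a) ring_scheme \<Rightarrow> ('k, 'v, 'c) module_scheme \<Rightarrow> 'v set \<Rightarrow> nat"
where
  "codimension K V W = vectorspace.dim K V - vectorspace.dim K (V\<lparr>carrier := W\<rparr>)"


section \<open>Singular homology with complex coefficients\<close>

text \<open>The library's singular chains have integer coefficients. Here singular chains have complex
  coefficients, with the boundary and chain maps extended linearly from singular simplices.\<close>

type_synonym 'a complex_chain = "((nat \<Rightarrow> real) \<Rightarrow> 'a) \<Rightarrow>\<^sub>0 complex"

definition cscale :: "complex \<Rightarrow> ('s \<Rightarrow>\<^sub>0 complex) \<Rightarrow> ('s \<Rightarrow>\<^sub>0 complex)" where
  "cscale a c = Poly_Mapping.map (\<lambda>x. a * x) c"

definition clinear_extend :: "('s \<Rightarrow> ('t \<Rightarrow>\<^sub>0 complex)) \<Rightarrow> ('s \<Rightarrow>\<^sub>0 complex) \<Rightarrow> ('t \<Rightarrow>\<^sub>0 complex)" where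
  "clinear_extend b c = (\<Sum>s\<in>Poly_Mapping.keys c. cscale (Poly_Mapping.lookup c s) (b s))"

definition complex_boundary :: "nat \<Rightarrow> 'a complex_chain \<Rightarrow> 'a complex_chain" where
  "complex_boundary p =
     clinear_extend (\<lambda>s. Poly_Mapping.map of_int (chain_boundary p (frag_of s)))"

definition complex_chain_map :: "nat \<Rightarrow> ('a \<Rightarrow> 'b) \<Rightarrow> 'a complex_chain \<Rightarrow> 'b complex_chain" where
  "complex_chain_map p f = clinear_extend (\<lambda>s. Poly_Mapping.single (simplex_map p f s) 1)"

text \<open>In the next two records the fields \<open>mult\<close> and \<open>one\<close>, which every module record inherits from
  the ring record, carry no information.\<close>

definition complex_chain_module :: "nat \<Rightarrow> 'a topology \<Rightarrow> (complex, 'a complex_chain) module" where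
  "complex_chain_module p S =
     \<lparr>carrier = {c. Poly_Mapping.keys c \<subseteq> singular_simplex_set p S},
      monoid.mult = (\<lambda>_ _. 0), one = 0, zero = 0, add = (+), module.smult = cscale\<rparr>"

definition quotient_module :: "('k, 'v, 'c) module_scheme \<Rightarrow> 'v set \<Rightarrow> ('k, 'v set) module" where
  "quotient_module M N =
     \<lparr>carrier = A_RCOSETS M N, monoid.mult = (\<lambda>_ _. N), one = N, zero = N,
      add = set_add M,
      module.smult = (\<lambda>a C. \<Union>x\<in>C. a_r_coset M N (a \<odot>\<^bsub>M\<^esub> x))\<rparr>"

definition complex_cycle_module :: "nat \<Rightarrow> 'a topology \<Rightarrow> (complex, 'a complex_chain) module" where
  "complex_cycle_module p S =
     (complex_chain_module p S)
       \<lparr>carrier := {c \<in> carrier (complex_chain_module p S). complex_boundary p c = 0}\<rparr>"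

definition complex_boundaries :: "nat \<Rightarrow> 'a topology \<Rightarrow> 'a complex_chain set" where
  "complex_boundaries p S =
     complex_boundary (Suc p) ` carrier (complex_chain_module (Suc p) S)"

definition complex_homology :: "nat \<Rightarrow> 'a topology \<Rightarrow> (complex, 'a complex_chain set) module" where
  "complex_homology p S = quotient_module (complex_cycle_module p S) (complex_boundaries p S)"

definition complex_hom_induced ::
  "nat \<Rightarrow> 'a topology \<Rightarrow> 'b topology \<Rightarrow> ('a \<Rightarrow> 'b) \<Rightarrow> 'a complex_chain set \<Rightarrow> 'b complex_chain set"
where
  "complex_hom_induced p S T f =
     (\<lambda>C\<in>carrier (complex_homology p S).
        \<Union>c\<in>C. a_r_coset (complex_cycle_module p T) (complex_boundaries p T) (complex_chain_map p f c))"


section \<open>The regular origami\<close>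

definition quotient_topology :: "'a topology \<Rightarrow> ('a \<Rightarrow> 'b) \<Rightarrow> 'b topology" where
  "quotient_topology S q =
     topology (\<lambda>U. U \<subseteq> q ` topspace S \<and> openin S {x \<in> topspace S. q x \<in> U})"

lemma openin_quotient_topology:
  "openin (quotient_topology S q) U \<longleftrightarrow>
     U \<subseteq> q ` topspace S \<and> openin S {x \<in> topspace S. q x \<in> U}"
proof -
  have "istopology (\<lambda>U. U \<subseteq> q ` topspace S \<and> openin S {x \<in> topspace S. q x \<in> U})"
  proof -
    have "openin S {x \<in> topspace S. q x \<in> U \<inter> V}"
      if "openin S {x \<in> topspace S. q x \<in> U}" "openin S {x \<in> topspace S. q x \<in> V}" for U V
    proof -
      have "{x \<in> topspace S. q x \<in> U \<inter> V} =
              {x \<in> topspace S. q x \<in> U} \<inter> {x \<in> topspace S. q x \<in> V}"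
        by auto
      then show ?thesis
        using that by (simp add: openin_Int)
    qed
    moreover have "openin S {x \<in> topspace S. q x \<in> \<Union>\<K>}"
      if "\<And>U. U \<in> \<K> \<Longrightarrow> openin S {x \<in> topspace S. q x \<in> U}" for \<K>
    proof -
      have "{x \<in> topspace S. q x \<in> \<Union>\<K>} = (\<Union>U\<in>\<K>. {x \<in> topspace S. q x \<in> U})"
        by auto
      then show ?thesis
        using that by auto
    qed
    ultimately show ?thesis
      unfolding istopology_def by blast
  qed
  then show ?thesis
    by (simp add: quotient_topology_def)
qed

lemma topspace_quotient_topology: "topspace (quotient_topology S q) = q ` topspace S"
proof
  show "topspace (quotient_topology S q) \<subseteq> q ` topspace S"
    using openin_topspace[of "quotient_topology S q"] by (simp only: openin_quotient_topology)
  have "{x \<in> topspace S. q x \<in> q ` topspace S} = topspace S"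
    by auto
  then have "openin (quotient_topology S q) (q ` topspace S)"
    by (simp add: openin_quotient_topology)
  then show "q ` topspace S \<subseteq> topspace (quotient_topology S q)"
    by (rule openin_subset)
qed

lemma quotient_map_quotient_topology: "quotient_map S (quotient_topology S q) q"
  by (simp add: quotient_map_def topspace_quotient_topology openin_quotient_topology)

definition torus_class :: "real \<times> real \<Rightarrow> (real \<times> real) set" where
  "torus_class p = {q. fst q - fst p \<in> \<int> \<and> snd q - snd p \<in> \<int>}"

definition torus :: "(real \<times> real) set topology" where
  "torus = quotient_topology euclidean torus_class"

text \<open>One closed unit square for every element of \<open>G\<close>. The right side of the square \<open>g\<close> is glued to
  the left side of \<open>g \<otimes> r\<close>, and its top side to the bottom side of \<open>g \<otimes> u\<close>.\<close>

definition origami_squares :: "('g, 'b) monoid_scheme \<Rightarrow> ('g \<times> (real \<times> real)) topology" where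
  "origami_squares G =
     prod_topology (discrete_topology (carrier G)) (top_of_set ({0..1} \<times> {0..1}))"

definition origami_gluing ::
  "('g, 'b) monoid_scheme \<Rightarrow> 'g \<Rightarrow> 'g \<Rightarrow> (('g \<times> (real \<times> real)) \<times> ('g \<times> (real \<times> real))) set"
where
  "origami_gluing G r u =
     {((g, (1, y)), (g \<otimes>\<^bsub>G\<^esub> r, (0, y))) | g y. g \<in> carrier G \<and> y \<in> {0..1}} \<union>
     {((g, (x, 1)), (g \<otimes>\<^bsub>G\<^esub> u, (x, 0))) | g x. g \<in> carrier G \<and> x \<in> {0..1}}"

definition origami_class ::
  "('g, 'b) monoid_scheme \<Rightarrow> 'g \<Rightarrow> 'g \<Rightarrow> 'g \<times> (real \<times> real) \<Rightarrow> ('g \<times> (real \<times> real)) set"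
where
  "origami_class G r u p = (origami_gluing G r u \<union> (origami_gluing G r u)\<inverse>)\<^sup>* `` {p}"

definition regular_origami ::
  "('g, 'b) monoid_scheme \<Rightarrow> 'g \<Rightarrow> 'g \<Rightarrow> ('g \<times> (real \<times> real)) set topology"
where
  "regular_origami G r u = quotient_topology (origami_squares G) (origami_class G r u)"

text \<open>The covering of the torus sends the class of \<open>(g, p)\<close> to the class of \<open>p\<close>. All members of a
  point of the origami have the same torus class, so that the union is this common class.\<close>

definition origami_covering :: "('g \<times> (real \<times> real)) set \<Rightarrow> (real \<times> real) set" where
  "origami_covering c = (\<Union>z\<in>c. torus_class (snd z))"

text \<open>The automorphism of the origami identified with \<open>h\<close>: the square \<open>g\<close> is carried to \<open>h \<otimes> g\<close> by the
  identity of the unit square.\<close>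

definition origami_aut ::
  "('g, 'b) monoid_scheme \<Rightarrow> 'g \<Rightarrow> ('g \<times> (real \<times> real)) set \<Rightarrow> ('g \<times> (real \<times> real)) set"
where
  "origami_aut G h c = (\<lambda>(g, p). (h \<otimes>\<^bsub>G\<^esub> g, p)) ` c"

lemma origami_covering_origami_aut: "origami_covering (origami_aut G h c) = origami_covering c"
  by (auto simp: origami_covering_def origami_aut_def)

text \<open>The module \<open>H\<^sub>1\<^sup>(\<^sup>0\<^sup>)(M, C)\<close> with its \<open>G\<close>-action.\<close>

definition origami_H10 ::
  "('g, 'b) monoid_scheme \<Rightarrow> 'g \<Rightarrow> 'g \<Rightarrow>
   (complex, ('g \<times> (real \<times> real)) set complex_chain set) module"
where
  "origami_H10 G r u =
     (complex_homology 1 (regular_origami G r u))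
       \<lparr>carrier := {x \<in> carrier (complex_homology 1 (regular_origami G r u)).
          complex_hom_induced 1 (regular_origami G r u) torus origami_covering x
            = \<zero>\<^bsub>complex_homology 1 torus\<^esub>}\<rparr>"

definition origami_H10_action ::
  "('g, 'b) monoid_scheme \<Rightarrow> 'g \<Rightarrow> 'g \<Rightarrow> 'g \<Rightarrow>
   ('g \<times> (real \<times> real)) set complex_chain set \<Rightarrow> ('g \<times> (real \<times> real)) set complex_chain set"
where
  "origami_H10_action G r u h =
     restrict
       (complex_hom_induced 1 (regular_origami G r u) (regular_origami G r u) (origami_aut G h))
       (carrier (origami_H10 G r u))"

end

theory Submission
  imports
    Defs
    "HOL-Analysis.Analysis"
    "HOL-Computational_Algebra.Fundamental_Theorem_Algebra"
begin

text \<open>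
  Cut the surface along the sides of its squares. The sides span a free \<open>\<complex>[G]\<close>-module of rank two, with
  basis the top and the right side of the square \<open>\<one>\<close>; the squares span a free module of rank one; and
  the vertices are the cosets of the cyclic group generated by the commutator \<open>c = [r, u]\<close>, because going
  once around a vertex leads from the square \<open>g\<close> to the square \<open>g \<otimes> c\<close>. Let \<open>Z\<close> be the space of cellular
  cycles whose coefficients on the top sides and on the right sides both sum to \<open>0\<close>, and let \<open>B \<subseteq> Z\<close> be the
  span of the boundaries of the squares. Then \<open>H\<^sub>1\<^sup>(\<^sup>0\<^sup>)(M, \<complex>)\<close> is \<open>Z / B\<close>, and the theorem is a count of the
  equivariant maps from \<open>Z / B\<close> to an irreducible \<open>V\<close>.

  \<^item> Such maps are restrictions of equivariant maps on the span of all sides that vanish on \<open>B\<close>, since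
    invariant subspaces have invariant complements. An equivariant map on the sides is a pair of vectors of
    \<open>V\<close>, and to vanish on \<open>B\<close> it has to satisfy one linear equation with values in \<open>V\<close>. If \<open>V\<close> is not
    trivial, this equation is onto (\<open>\<phi>_face_image\<close>), so that the solutions have dimension \<open>dim V\<close>.
  \<^item> Let \<open>V\<close> still be nontrivial. A solution that vanishes on \<open>Z\<close> vanishes on all cycles, so its value on a
    side is the difference of the values of an equivariant function at the two endpoints. An equivariant
    function on the cosets of the group generated by \<open>c\<close> is a vector fixed by \<open>c\<close> (\<open>\<delta>_kills_cycles\<close>,
    \<open>killing_cycles_is_\<delta>\<close>). Hence the solutions that vanish on \<open>Z\<close> have dimension \<open>dim (Fix c)\<close>, and the
    multiplicity is \<open>dim V - dim (Fix c)\<close> (\<open>count_summands\<close>).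
  \<^item> The trivial representation does not occur, because averaging an element of \<open>Z\<close> over \<open>G\<close> gives \<open>0\<close>
    (\<open>fixed_cycle0_zero\<close>); and its codimension is \<open>0\<close>.

  The identification of \<open>H\<^sub>1\<^sup>(\<^sup>0\<^sup>)(M, \<complex>)\<close> with \<open>Z / B\<close> has two halves, one for each inequality of dimensions.
  Every singular cycle is homologous to a cellular one (\<open>cycle_homologous_cellular\<close>): four open sets, each of
  which contracts onto finitely many points, cover the surface, and a cycle made of simplices that lie in
  these sets can be pushed into the sides. Conversely a cellular cycle that bounds lies in \<open>B\<close>
  (\<open>ccell_bounds_iff\<close>): otherwise a cochain vanishing on \<open>B\<close> would be nonzero on it, but an integral cochain
  of this kind is the winding number of a nowhere vanishing function on the surface, which is \<open>0\<close> on
  boundaries. Both arguments are integral by nature. They pass to complex coefficients by writing finitely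
  many complex numbers as integral combinations of numbers without integral relations (\<open>integral_basis\<close>).

  All representation theory takes place in spaces of chains. The irreducible \<open>V\<close> is realised there too, as a
  summand of the regular representation (\<open>irreducible_model_exists\<close>), and the results are carried over to
  module records at the end.
\<close>

section \<open>Complex chains and integral chains\<close>

lemma lookup_cscale [simp]: "Poly_Mapping.lookup (cscale a c) s = a * Poly_Mapping.lookup c s"
  by (simp add: cscale_def Poly_Mapping.map.rep_eq when_def)

lemma cscale_simps [simp]:
  "cscale 1 c = c" "cscale 0 c = 0" "cscale a 0 = 0" "cscale a (cscale b c) = cscale (a * b) c"
  by (auto intro!: poly_mapping_eqI)

lemma cscale_add_right: "cscale a (c + d) = cscale a c + cscale a d"
  by (auto intro!: poly_mapping_eqI simp: lookup_add algebra_simps)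

lemma cscale_add_left: "cscale (a + b) c = cscale a c + cscale b c"
  by (auto intro!: poly_mapping_eqI simp: lookup_add algebra_simps)

lemma cscale_diff_right: "cscale a (c - d) = cscale a c - cscale a d"
  by (rule poly_mapping_eqI) (simp add: lookup_minus right_diff_distrib)

lemma cscale_sum_right: "cscale a (\<Sum>i\<in>I. f i) = (\<Sum>i\<in>I. cscale a (f i))"
  by (induction I rule: infinite_finite_induct) (simp_all add: cscale_add_right)

lemma cscale_sum_left: "cscale (\<Sum>i\<in>I. f i) c = (\<Sum>i\<in>I. cscale (f i) c)"
  by (induction I rule: infinite_finite_induct) (simp_all add: cscale_add_left)

lemma cscale_single [simp]: "cscale a (Poly_Mapping.single s b) = Poly_Mapping.single s (a * b)"
  by (auto intro!: poly_mapping_eqI simp: lookup_single when_def)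

lemma keys_cscale: "Poly_Mapping.keys (cscale a c) \<subseteq> Poly_Mapping.keys c"
  by (auto simp: in_keys_iff)

lemma keys_diff_subset:
  "Poly_Mapping.keys (c - d) \<subseteq> Poly_Mapping.keys c \<union> Poly_Mapping.keys (d :: 's \<Rightarrow>\<^sub>0 'r::ab_group_add)"
  by (auto simp: in_keys_iff lookup_minus)

lemma keys_sum_subset_UN: "Poly_Mapping.keys (\<Sum>i\<in>I. f i) \<subseteq> (\<Union>i\<in>I. Poly_Mapping.keys (f i))"
proof (induction I rule: infinite_finite_induct)
  case (insert x F)
  then show ?case using Poly_Mapping.keys_add[of "f x" "sum f F"] by auto
qed auto

text \<open>The evaluation of the cochain \<open>f\<close> on the chain \<open>c\<close>.\<close>

definition cpair :: "('s \<Rightarrow> complex) \<Rightarrow> ('s \<Rightarrow>\<^sub>0 complex) \<Rightarrow> complex" where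
  "cpair f c = (\<Sum>s\<in>Poly_Mapping.keys c. Poly_Mapping.lookup c s * f s)"

lemma cpair_superset:
  assumes "finite A" "Poly_Mapping.keys c \<subseteq> A"
  shows "cpair f c = (\<Sum>s\<in>A. Poly_Mapping.lookup c s * f s)"
  unfolding cpair_def using assms by (intro sum.mono_neutral_left) (auto simp: in_keys_iff)

lemma clinear_extend_superset:
  assumes "finite A" "Poly_Mapping.keys c \<subseteq> A"
  shows "clinear_extend b c = (\<Sum>s\<in>A. cscale (Poly_Mapping.lookup c s) (b s))"
  unfolding clinear_extend_def using assms by (intro sum.mono_neutral_left) (auto simp: in_keys_iff)

lemma cpair_zero [simp]: "cpair f 0 = 0"
  by (simp add: cpair_def)

lemma clinear_extend_zero [simp]: "clinear_extend b 0 = 0"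
  by (simp add: clinear_extend_def)

lemma cpair_add: "cpair f (c + d) = cpair f c + cpair f d"
proof -
  let ?A = "Poly_Mapping.keys c \<union> Poly_Mapping.keys d"
  have "Poly_Mapping.keys (c + d) \<subseteq> ?A" by (rule Poly_Mapping.keys_add)
  then show ?thesis
    by (subst (1 2 3) cpair_superset[where A = ?A]) (auto simp: lookup_add algebra_simps sum.distrib)
qed

lemma clinear_extend_add: "clinear_extend b (c + d) = clinear_extend b c + clinear_extend b d"
proof -
  let ?A = "Poly_Mapping.keys c \<union> Poly_Mapping.keys d"
  have "Poly_Mapping.keys (c + d) \<subseteq> ?A" by (rule Poly_Mapping.keys_add)
  then show ?thesis
    by (subst (1 2 3) clinear_extend_superset[where A = ?A])
       (auto simp: lookup_add cscale_add_left sum.distrib)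
qed

lemma cpair_cscale [simp]: "cpair f (cscale a c) = a * cpair f c"
  by (subst cpair_superset[of "Poly_Mapping.keys c"])
     (auto simp: keys_cscale cpair_def sum_distrib_left mult.assoc)

lemma clinear_extend_cscale: "clinear_extend b (cscale a c) = cscale a (clinear_extend b c)"
  by (subst clinear_extend_superset[of "Poly_Mapping.keys c"])
     (auto simp: keys_cscale clinear_extend_def cscale_sum_right)

lemma cpair_single [simp]: "cpair f (Poly_Mapping.single s a) = a * f s"
  by (subst cpair_superset[of "{s}"]) (auto split: if_splits)

lemma clinear_extend_single [simp]: "clinear_extend b (Poly_Mapping.single s a) = cscale a (b s)"
  by (subst clinear_extend_superset[of "{s}"]) (auto split: if_splits)

lemma cpair_sum: "cpair f (\<Sum>i\<in>I. c i) = (\<Sum>i\<in>I. cpair f (c i))"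
  by (induction I rule: infinite_finite_induct) (simp_all add: cpair_add)

lemma clinear_extend_sum: "clinear_extend b (\<Sum>i\<in>I. c i) = (\<Sum>i\<in>I. clinear_extend b (c i))"
  by (induction I rule: infinite_finite_induct) (simp_all add: clinear_extend_add)

lemma clinear_extend_diff: "clinear_extend b (c - d) = clinear_extend b c - clinear_extend b d"
  using clinear_extend_add[of b "c - d" d] by simp

lemma cpair_diff: "cpair f (c - d) = cpair f c - cpair f d"
  using cpair_add[of f "c - d" d] by simp

lemma cpair_clinear_extend: "cpair f (clinear_extend b c) = cpair (\<lambda>s. cpair f (b s)) c"
  by (simp add: clinear_extend_def cpair_sum) (simp add: cpair_def)

lemma clinear_extend_clinear_extend:
  "clinear_extend b (clinear_extend b' c) = clinear_extend (\<lambda>s. clinear_extend b (b' s)) c"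
  unfolding clinear_extend_def[of b' c]
  by (simp add: clinear_extend_sum clinear_extend_cscale) (simp add: clinear_extend_def)

lemma clinear_extend_cong:
  "(\<And>s. s \<in> Poly_Mapping.keys c \<Longrightarrow> b s = b' s) \<Longrightarrow> clinear_extend b c = clinear_extend b' c"
  by (simp add: clinear_extend_def)

lemma cpair_cong: "(\<And>s. s \<in> Poly_Mapping.keys c \<Longrightarrow> f s = f' s) \<Longrightarrow> cpair f c = cpair f' c"
  by (simp add: cpair_def)

lemma clinear_extend_ident: "clinear_extend (\<lambda>s. Poly_Mapping.single s 1) c = c"
proof (rule poly_mapping_eqI)
  fix k
  show "Poly_Mapping.lookup (clinear_extend (\<lambda>s. Poly_Mapping.single s 1) c) k = Poly_Mapping.lookup c k"
    by (simp add: clinear_extend_def lookup_sum lookup_single when_def in_keys_iff)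
qed

lemma keys_clinear_extend:
  assumes "\<And>s. s \<in> Poly_Mapping.keys c \<Longrightarrow> Poly_Mapping.keys (b s) \<subseteq> A"
  shows "Poly_Mapping.keys (clinear_extend b c) \<subseteq> A"
  unfolding clinear_extend_def using keys_sum_subset_UN keys_cscale assms by fastforce

abbreviation cchain :: "('s \<Rightarrow>\<^sub>0 int) \<Rightarrow> ('s \<Rightarrow>\<^sub>0 complex)" where
  "cchain \<equiv> Poly_Mapping.map of_int"

lemma lookup_cchain [simp]: "Poly_Mapping.lookup (cchain c) s = of_int (Poly_Mapping.lookup c s)"
  by (simp add: Poly_Mapping.map.rep_eq when_def)

lemma cchain_simps [simp]: "cchain 0 = 0" "cchain (c + d) = cchain c + cchain d"
  "cchain (c - d) = cchain c - cchain d" "cchain (- c) = - cchain c"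
  "cchain (frag_of s) = Poly_Mapping.single s 1" "cchain (frag_cmul a c) = cscale (of_int a) (cchain c)"
  by (auto intro!: poly_mapping_eqI simp: lookup_add lookup_minus lookup_single when_def)

lemma cchain_sum: "cchain (\<Sum>i\<in>I. c i) = (\<Sum>i\<in>I. cchain (c i))"
  by (induction I rule: infinite_finite_induct) simp_all

lemma keys_cchain [simp]: "Poly_Mapping.keys (cchain c) = Poly_Mapping.keys c"
  by (auto simp: in_keys_iff)

lemma cchain_frag_extend: "cchain (frag_extend b c) = clinear_extend (\<lambda>s. cchain (b s)) (cchain c)"
  by (simp add: frag_extend_def clinear_extend_def cchain_sum)

lemma complex_boundary_cchain: "complex_boundary p (cchain c) = cchain (chain_boundary p c)"
proof -
  have "chain_boundary p c = frag_extend (\<lambda>s. chain_boundary p (frag_of s)) c"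
    by (simp add: chain_boundary_def frag_extend_def)
  then show ?thesis
    by (simp add: complex_boundary_def cchain_frag_extend)
qed

lemma complex_chain_map_cchain: "complex_chain_map p f (cchain c) = cchain (chain_map p f c)"
  by (simp add: complex_chain_map_def chain_map_def cchain_frag_extend o_def)

lemma complex_chain_map_compose_boundary:
  assumes "Poly_Mapping.keys c \<subseteq> singular_simplex_set p S"
  shows "complex_boundary p (complex_chain_map p f c) = complex_chain_map (p - 1) f (complex_boundary p c)"
proof -
  have "complex_boundary p (Poly_Mapping.single (simplex_map p f s) 1)
          = complex_chain_map (p - 1) f (cchain (chain_boundary p (frag_of s)))"
    if "s \<in> Poly_Mapping.keys c" for s
  proof -
    have "singular_chain p S (frag_of s)"
      using that assms by (auto simp: singular_chain_of)
    then have "chain_boundary p (chain_map p f (frag_of s)) = chain_map (p - 1) f (chain_boundary p (frag_of s))"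
      using chain_boundary_chain_map by force
    then show ?thesis
      using complex_boundary_cchain[of p "frag_of (simplex_map p f s)"]
        by (simp add: complex_chain_map_cchain)
  qed
  then show ?thesis
    by (simp add: complex_boundary_def complex_chain_map_def clinear_extend_clinear_extend
        cong: clinear_extend_cong)
qed

text \<open>The numbers of \<open>A\<close> span a finite-dimensional rational vector space. The basis \<open>e\<close> is a rational basis divided
  by a common denominator of all coordinates.\<close>

lemma integral_basis:
  fixes A :: "complex set"
  assumes "finite A"
  obtains n :: nat and e :: "nat \<Rightarrow> complex" and m :: "complex \<Rightarrow> nat \<Rightarrow> int"
  where "\<And>a. a \<in> A \<Longrightarrow> a = (\<Sum>i<n. of_int (m a i) * e i)"
    and "\<And>k :: nat \<Rightarrow> int. (\<Sum>i<n. of_int (k i) * e i) = 0 \<Longrightarrow> \<forall>i<n. k i = 0"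
proof -
  define sc where "sc q z = of_rat q * z" for q :: rat and z :: complex
  have vs: "vector_space sc"
    unfolding sc_def
    by (rule vector_space.intro)
       (simp_all only: distrib_left distrib_right of_rat_add of_rat_mult mult.assoc of_rat_1 mult_1_left)
  interpret Q: vector_space sc by (rule vs)
  obtain B where B: "B \<subseteq> A" "Q.independent B" "A \<subseteq> Q.span B"
    using Q.maximal_independent_subset by blast
  have fB: "finite B" using B(1) assms finite_subset by blast
  have "\<exists>u. (\<Sum>v\<in>B. of_rat (u v) * v) = a" if "a \<in> A" for a
    using that B(3) Q.span_finite[OF fB] by (auto simp: image_iff sc_def)
  then obtain u where u: "\<And>a. a \<in> A \<Longrightarrow> (\<Sum>v\<in>B. of_rat (u a v) * v) = a"
    by metis
  define S where "S = (\<lambda>(a, v). snd (quotient_of (u a v))) ` (A \<times> B)"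
  define N where "N = (\<Prod>s\<in>S. s)"
  have fS: "finite S" unfolding S_def using assms fB by auto
  have Npos: "N > 0" unfolding N_def S_def by (rule prod_pos) (auto simp: quotient_of_denom_pos')
  have "\<exists>k::int. of_int k = of_int N * u a v" if "a \<in> A" "v \<in> B" for a v
  proof -
    obtain p q where pq: "quotient_of (u a v) = (p, q)" by fastforce
    have "q \<in> S" unfolding S_def using that pq by (force simp: image_iff)
    then have "q dvd N" unfolding N_def using fS dvd_prodI[of S q "\<lambda>x. x"] by simp
    then obtain t where t: "N = q * t" by auto
    have "q > 0" using pq quotient_of_denom_pos by blast
    moreover have "u a v = of_int p / of_int q" using pq quotient_of_div by blast
    ultimately have "of_int N * u a v = of_int (p * t)" by (simp add: t)
    then show ?thesis by metis
  qed
  then obtain k where k: "\<And>a v. a \<in> A \<Longrightarrow> v \<in> B \<Longrightarrow> of_int (k a v) = of_int N * u a v"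
    by metis
  obtain b where b: "bij_betw b {..<card B} B"
    using ex_bij_betw_nat_finite[OF fB] by (auto simp: atLeast0LessThan)
  define e where "e i = b i / of_int N" for i
  have N0: "(of_int N :: complex) \<noteq> 0" using Npos by simp
  show ?thesis
  proof (rule that[where n = "card B" and e = e and m = "\<lambda>a i. k a (b i)"])
    fix a assume a: "a \<in> A"
    have "(\<Sum>i<card B. of_int (k a (b i)) * e i) = (\<Sum>i<card B. (\<lambda>v. of_int (k a v) * (v / of_int N)) (b i))"
      by (simp add: e_def)
    also have "\<dots> = (\<Sum>v\<in>B. of_int (k a v) * (v / of_int N))"
      by (rule sum.reindex_bij_betw[OF b])
    also have "\<dots> = (\<Sum>v\<in>B. of_rat (u a v) * v)"
    proof (rule sum.cong)
      fix v assume v: "v \<in> B"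
      have "(of_int (k a v) :: complex) = of_rat (of_int N * u a v)"
        by (metis k[OF a v] of_rat_of_int_eq)
      then have "(of_int (k a v) :: complex) = of_int N * of_rat (u a v)"
        by (simp add: of_rat_mult)
      then show "of_int (k a v) * (v / of_int N) = of_rat (u a v) * v"
        using N0 by simp
    qed simp
    finally show "a = (\<Sum>i<card B. of_int (k a (b i)) * e i)" using u[OF a] by simp
  next
    fix l :: "nat \<Rightarrow> int" assume z: "(\<Sum>i<card B. of_int (l i) * e i) = 0"
    define c where "c v = (of_int (l (the_inv_into {..<card B} b v)) :: rat)" for v
    have inv: "the_inv_into {..<card B} b (b i) = i" if "i < card B" for i
      using b that by (auto simp: bij_betw_def intro!: the_inv_into_f_f)
    have "(\<Sum>v\<in>B. of_rat (c v) * v) = (\<Sum>i<card B. of_rat (c (b i)) * b i)"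
      using sum.reindex_bij_betw[OF b, of "\<lambda>v. of_rat (c v) * v"] by simp
    also have "\<dots> = (\<Sum>i<card B. of_int N * (of_int (l i) * e i))"
      by (rule sum.cong) (use N0 in \<open>auto simp: c_def inv e_def\<close>)
    also have "\<dots> = 0" using z by (simp flip: sum_distrib_left)
    finally have "(\<Sum>v\<in>B. sc (c v) v) = 0" by (simp add: sc_def)
    then have "\<forall>v\<in>B. c v = 0"
      using B(2) Q.independent_explicit_finite_subsets fB by blast
    then have "c (b i) = 0" if "i < card B" for i
      using b that by (auto simp: bij_betw_def)
    then show "\<forall>i<card B. l i = 0"
      using inv by (simp add: c_def)
  qed
qed

lemma chain_integral_basis:
  fixes c :: "'s \<Rightarrow>\<^sub>0 complex"
  obtains n :: nat and e :: "nat \<Rightarrow> complex" and C :: "nat \<Rightarrow> 's \<Rightarrow>\<^sub>0 int"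
  where "c = (\<Sum>i<n. cscale (e i) (cchain (C i)))"
    and "\<And>i. Poly_Mapping.keys (C i) \<subseteq> Poly_Mapping.keys c"
    and "\<And>k :: nat \<Rightarrow> int. (\<Sum>i<n. of_int (k i) * e i) = 0 \<Longrightarrow> \<forall>i<n. k i = 0"
proof -
  let ?A = "Poly_Mapping.lookup c ` Poly_Mapping.keys c"
  obtain n e m where em: "\<And>a. a \<in> ?A \<Longrightarrow> a = (\<Sum>i<n. of_int (m a i) * e i)"
    and ind: "\<And>k :: nat \<Rightarrow> int. (\<Sum>i<n. of_int (k i) * e i) = 0 \<Longrightarrow> \<forall>i<n. k i = 0"
    by (rule integral_basis[OF finite_imageI[OF finite_keys]]) (rule that)
  define C where "C i = (\<Sum>s\<in>Poly_Mapping.keys c. Poly_Mapping.single s (m (Poly_Mapping.lookup c s) i))" for i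
  have lC: "Poly_Mapping.lookup (C i) s = (if s \<in> Poly_Mapping.keys c then m (Poly_Mapping.lookup c s) i else 0)" for i s
    by (auto simp: C_def lookup_sum lookup_single when_def)
  show ?thesis
  proof (rule that[OF _ _ ind])
    show "c = (\<Sum>i<n. cscale (e i) (cchain (C i)))"
    proof (rule poly_mapping_eqI)
      fix s
      show "Poly_Mapping.lookup c s = Poly_Mapping.lookup (\<Sum>i<n. cscale (e i) (cchain (C i))) s"
        using em[of "Poly_Mapping.lookup c s"]
        by (cases "s \<in> Poly_Mapping.keys c")
           (auto simp: lookup_sum lC mult.commute in_keys_iff)
    qed
    show "Poly_Mapping.keys (C i) \<subseteq> Poly_Mapping.keys c" for i
      by (auto simp: in_keys_iff lC split: if_splits)
  qed
qed

text \<open>A relation between integral chains with coefficients that have no integral relations is trivial, since it is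
  an integral relation on every singular simplex. This is why the summands of \<open>chain_integral_basis\<close> are
  cycles when the chain is one.\<close>

lemma integral_independent_chains:
  assumes "(\<Sum>i<n. cscale (e i) (cchain (C i))) = 0"
    and "\<And>k :: nat \<Rightarrow> int. (\<Sum>i<n. of_int (k i) * e i) = 0 \<Longrightarrow> \<forall>i<n. k i = 0"
    and "i < n"
  shows "C i = 0"
proof (rule poly_mapping_eqI)
  fix s
  have "(\<Sum>i<n. of_int (Poly_Mapping.lookup (C i) s) * e i) = Poly_Mapping.lookup (\<Sum>i<n. cscale (e i) (cchain (C i))) s"
    by (simp add: lookup_sum mult.commute)
  then have "(\<Sum>i<n. of_int (Poly_Mapping.lookup (C i) s) * e i) = 0"
    using assms(1) by simp
  then show "Poly_Mapping.lookup (C i) s = Poly_Mapping.lookup 0 s"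
    using assms(2)[of "\<lambda>i. Poly_Mapping.lookup (C i) s"] assms(3) by simp
qed

section \<open>Winding numbers along singular simplices\<close>

text \<open>Chains of degree \<open>1\<close> occur throughout, and the rule would replace their degree by \<open>Suc 0\<close>.\<close>

declare One_nat_def [simp del]

lemma atMost_1_2: "{..1::nat} = {0, 1}" "{..2::nat} = {0, 1, 2}"
  by auto

definition vertex :: "nat \<Rightarrow> nat \<Rightarrow> real" where
  "vertex i = (\<lambda>j. if j = i then 1 else 0)"

lemma vertex_in_standard_simplex [simp]: "vertex i \<in> standard_simplex p \<longleftrightarrow> i \<le> p"
  by (simp add: vertex_def)

text \<open>\<open>H\<close> is a lift of \<open>E \<circ> \<sigma>\<close> through the covering \<open>z \<mapsto> exp (2 \<pi> \<i> z)\<close> of the punctured plane.\<close>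

definition log_lift :: "nat \<Rightarrow> ('a \<Rightarrow> complex) \<Rightarrow> ((nat \<Rightarrow> real) \<Rightarrow> 'a) \<Rightarrow> ((nat \<Rightarrow> real) \<Rightarrow> complex) \<Rightarrow> bool" where
  "log_lift p E \<sigma> H \<longleftrightarrow>
     continuous_map (subtopology (powertop_real UNIV) (standard_simplex p)) euclidean H \<and>
     (\<forall>t\<in>standard_simplex p. E (\<sigma> t) = exp (2 * of_real pi * \<i> * H t))"

text \<open>The simplex is homeomorphic to a convex subset of the plane, on which a nowhere vanishing function has a
  continuous logarithm.\<close>

lemma log_lift_exists:
  assumes \<sigma>: "singular_simplex p S \<sigma>" and p: "p \<le> 2"
    and E: "continuous_map S euclidean E" and nz: "\<And>x. x \<in> topspace S \<Longrightarrow> E x \<noteq> 0"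
  obtains H where "log_lift p E \<sigma> H"
proof -
  \<comment> \<open>for \<open>p < 2\<close> the remaining coordinates are \<open>0\<close>, so that one pair of charts serves all three dimensions\<close>
  define J where "J x = (x 1, x 2)" for x :: "nat \<Rightarrow> real"
  define K where "K z = (\<lambda>i::nat. if i = 0 then 1 - fst z - snd z else if i = 1 then fst z else if i = 2 then snd z else 0)"
    for z :: "real \<times> real"
  let ?\<Delta> = "subtopology (powertop_real UNIV) (standard_simplex p)"
  define D where "D = J ` standard_simplex p"
  have p3: "p = 0 \<or> p = 1 \<or> p = 2" using p by auto
  have KJ: "K (J x) = x" if "x \<in> standard_simplex p" for x
  proof
    fix i
    have "\<forall>i>p. x i = 0" "(\<Sum>i\<le>p. x i) = 1" using that by (auto simp: standard_simplex_def)
    then show "K (J x) i = x i"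
      using p3 by (auto simp: K_def J_def atMost_1_2)
  qed
  have KD: "K z \<in> standard_simplex p" if "z \<in> D" for z
    using that KJ by (auto simp: D_def)
  have convD: "convex D"
  proof (rule convexI)
    fix z w u v assume z: "z \<in> D" and w: "w \<in> D" and uv: "(0::real) \<le> u" "0 \<le> v" "u + v = 1"
    obtain x y where x: "x \<in> standard_simplex p" "z = J x" and y: "y \<in> standard_simplex p" "w = J y"
      using z w by (auto simp: D_def)
    have "(\<lambda>i. (1 - v) * x i + v * y i) \<in> standard_simplex p"
      by (rule convex_standard_simplex) (use x y uv in auto)
    moreover have "J (\<lambda>i. (1 - v) * x i + v * y i) = u *\<^sub>R z + v *\<^sub>R w"
      using uv by (simp add: J_def x(2) y(2) algebra_simps flip: eq_diff_eq)
    ultimately show "u *\<^sub>R z + v *\<^sub>R w \<in> D" by (metis D_def imageI)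
  qed
  have contK: "continuous_map (top_of_set D) ?\<Delta> K"
  proof (rule continuous_map_into_subtopology)
    show "continuous_map (top_of_set D) (powertop_real UNIV) K"
    proof (rule continuous_map_componentwise_UNIV[THEN iffD2], rule allI)
      fix i
      have "continuous_on D (\<lambda>z. K z i)"
        by (cases "i = 0"; cases "i = 1"; cases "i = 2") (auto simp: K_def intro!: continuous_intros)
      then show "continuous_map (top_of_set D) euclideanreal (\<lambda>z. K z i)" by simp
    qed
  qed (use KD in auto)
  have contJ: "continuous_map ?\<Delta> (top_of_set D) J"
  proof (rule continuous_map_into_subtopology)
    have "continuous_map ?\<Delta> euclideanreal (\<lambda>x. x i)" for i
      by (intro continuous_map_from_subtopology continuous_map_product_projection) auto
    then have "continuous_map ?\<Delta> (prod_topology euclideanreal euclideanreal) J"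
      unfolding J_def by (intro continuous_map_pairedI)
    then show "continuous_map ?\<Delta> euclidean J" by simp
  qed (auto simp: D_def)
  have cs: "continuous_map ?\<Delta> S \<sigma>" using \<sigma> by (simp add: singular_simplex_def)
  have "continuous_map (top_of_set D) euclidean (E \<circ> \<sigma> \<circ> K)"
    using continuous_map_compose[OF contK continuous_map_compose[OF cs E]] by (simp add: o_assoc)
  then have contf: "continuous_on D (E \<circ> \<sigma> \<circ> K)" by simp
  have nzf: "(E \<circ> \<sigma> \<circ> K) z \<noteq> 0" if "z \<in> D" for z
    using nz KD[OF that] cs by (auto simp: continuous_map_def)
  obtain g where g: "continuous_on D g" "\<And>z. z \<in> D \<Longrightarrow> (E \<circ> \<sigma> \<circ> K) z = exp (g z)"
    using continuous_logarithm_on_contractible[OF contf convex_imp_contractible[OF convD] nzf] by metis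
  define H where "H t = g (J t) / (2 * of_real pi * \<i>)" for t
  have "continuous_map (top_of_set D) euclidean (\<lambda>z. g z / (2 * of_real pi * \<i>))"
    using g(1) by (auto intro!: continuous_intros)
  from continuous_map_compose[OF contJ this]
  have "continuous_map ?\<Delta> euclidean H"
    unfolding H_def o_def .
  moreover have "E (\<sigma> t) = exp (2 * of_real pi * \<i> * H t)" if "t \<in> standard_simplex p" for t
    using g(2)[of "J t"] that KJ by (simp add: H_def D_def)
  ultimately show ?thesis
    using that by (auto simp: log_lift_def)
qed

text \<open>Two lifts differ by a continuous function with integer values on a connected set.\<close>

lemma log_lift_diff_constant:
  assumes H: "log_lift p E \<sigma> H" and H': "log_lift p E \<sigma> H'"
    and a: "a \<in> standard_simplex p" and b: "b \<in> standard_simplex p"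
  shows "H a - H' a = H b - H' b"
proof -
  let ?\<Delta> = "subtopology (powertop_real UNIV) (standard_simplex p)"
  have "continuous_map ?\<Delta> euclidean (\<lambda>t. H t - H' t)"
    using H H' by (intro continuous_map_diff) (auto simp: log_lift_def)
  moreover have "connectedin ?\<Delta> (standard_simplex p)"
    using connectedin_standard_simplex by (simp add: connectedin_subtopology)
  ultimately have "connected ((\<lambda>t. H t - H' t) ` standard_simplex p)"
    using connectedin_continuous_map_image by (fastforce simp flip: connectedin_iff_connected)
  moreover have "(\<lambda>t. H t - H' t) ` standard_simplex p \<subseteq> \<int>"
  proof clarify
    fix t assume "t \<in> standard_simplex p"
    then have "exp (2 * of_real pi * \<i> * H t) = exp (2 * of_real pi * \<i> * H' t)"
      using H H' by (simp add: log_lift_def)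
    then obtain n :: int where "2 * of_real pi * \<i> * H t = 2 * of_real pi * \<i> * H' t + (of_int (2 * n) * pi) * \<i>"
      by (auto simp: exp_eq)
    then have "2 * of_real pi * \<i> * (H t - H' t - of_int n) = 0"
      by (simp add: algebra_simps)
    then have "H t - H' t = of_int n" by simp
    then show "H t - H' t \<in> \<int>" by simp
  qed
  moreover have "countable (\<int> :: complex set)"
    by (simp add: Ints_def)
  ultimately show ?thesis
    using connected_uncountable[of _ "H a - H' a" "H b - H' b"] a b countable_subset
    by (metis (mono_tags, lifting) imageI)
qed

text \<open>The lift is unique up to a constant, so that the choice does not matter (\<open>winding_increment_eq\<close>).\<close>

definition winding_increment :: "('a \<Rightarrow> complex) \<Rightarrow> ((nat \<Rightarrow> real) \<Rightarrow> 'a) \<Rightarrow> complex" where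
  "winding_increment E \<sigma> = (let H = SOME H. log_lift 1 E \<sigma> H in H (vertex 1) - H (vertex 0))"

lemma winding_increment_eq:
  assumes "log_lift 1 E \<sigma> H"
  shows "winding_increment E \<sigma> = H (vertex 1) - H (vertex 0)"
proof -
  define H' where "H' = (SOME H. log_lift 1 E \<sigma> H)"
  have "log_lift 1 E \<sigma> H'" unfolding H'_def by (rule someI[of "log_lift 1 E \<sigma>", OF assms])
  from log_lift_diff_constant[OF this assms, of "vertex 1" "vertex 0"]
  show ?thesis
    unfolding winding_increment_def Let_def H'_def[symmetric] by (simp add: algebra_simps)
qed

lemma simplical_face_vertex: "simplical_face k (vertex i) = vertex (if i < k then i else Suc i)"
  by (auto simp: simplical_face_def vertex_def fun_eq_iff)

text \<open>A lift on the triangle restricts to lifts on its three faces, so the increments along the faces telescope.\<close>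

lemma winding_increment_chain_boundary:
  assumes \<tau>: "singular_simplex 2 S \<tau>"
    and E: "continuous_map S euclidean E" and nz: "\<And>x. x \<in> topspace S \<Longrightarrow> E x \<noteq> 0"
  shows "cpair (winding_increment E) (cchain (chain_boundary 2 (frag_of \<tau>))) = 0"
proof -
  obtain H where H: "log_lift 2 E \<tau> H"
    using log_lift_exists[OF \<tau> _ E nz] by auto
  have face: "winding_increment E (singular_face 2 k \<tau>)
      = H (simplical_face k (vertex 1)) - H (simplical_face k (vertex 0))" if k: "k \<le> 2" for k
  proof -
    have sub: "simplical_face k t \<in> standard_simplex 2" if "t \<in> standard_simplex 1" for t
      using simplical_face_in_standard_simplex[of 2 k t] k that by (simp add: One_nat_def)
    have "continuous_map (subtopology (powertop_real UNIV) (standard_simplex 1))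
            (subtopology (powertop_real UNIV) (standard_simplex 2)) (simplical_face k)"
    proof (rule continuous_map_into_subtopology)
      show "continuous_map (subtopology (powertop_real UNIV) (standard_simplex 1)) (powertop_real UNIV) (simplical_face k)"
      proof (rule continuous_map_componentwise_UNIV[THEN iffD2], rule allI)
        fix i
        have "continuous_map (subtopology (powertop_real UNIV) (standard_simplex 1)) euclideanreal (\<lambda>x. x j)" for j
          by (intro continuous_map_from_subtopology continuous_map_product_projection) auto
        then show "continuous_map (subtopology (powertop_real UNIV) (standard_simplex 1)) euclideanreal (\<lambda>x. simplical_face k x i)"
          by (cases "i < k"; cases "i = k") (simp_all add: simplical_face_def)
      qed
    qed (use sub in auto)
    then have "continuous_map (subtopology (powertop_real UNIV) (standard_simplex 1)) euclidean (H \<circ> simplical_face k)"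
      by (rule continuous_map_compose) (use H in \<open>simp add: log_lift_def\<close>)
    then have "log_lift 1 E (singular_face 2 k \<tau>) (H \<circ> simplical_face k)"
      using H sub by (auto simp: log_lift_def singular_face_def)
    then show ?thesis by (simp only: winding_increment_eq o_apply)
  qed
  have "chain_boundary 2 (frag_of \<tau>) = frag_of (singular_face 2 0 \<tau>) - frag_of (singular_face 2 1 \<tau>) + frag_of (singular_face 2 2 \<tau>)"
  proof -
    show ?thesis by (simp add: chain_boundary_of atMost_1_2)
  qed
  moreover have "vertex (Suc 1) = vertex 2" by (simp add: numeral_2_eq_2 One_nat_def)
  ultimately show ?thesis
    by (simp add: cpair_add cpair_diff face simplical_face_vertex flip: One_nat_def)
qed

lemma winding_increment_complex_boundary:
  assumes d: "Poly_Mapping.keys d \<subseteq> singular_simplex_set 2 S"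
    and E: "continuous_map S euclidean E" and nz: "\<And>x. x \<in> topspace S \<Longrightarrow> E x \<noteq> 0"
  shows "cpair (winding_increment E) (complex_boundary 2 d) = 0"
proof -
  have "cpair (winding_increment E) (cchain (chain_boundary 2 (frag_of \<tau>))) = 0" if "\<tau> \<in> Poly_Mapping.keys d" for \<tau>
    using winding_increment_chain_boundary[OF _ E nz] that d by blast
  then have "cpair (winding_increment E) (complex_boundary 2 d) = cpair (\<lambda>\<tau>. 0) d"
    unfolding complex_boundary_def cpair_clinear_extend by (rule cpair_cong)
  then show ?thesis by (simp add: cpair_def)
qed

section \<open>Spaces that contract onto finitely many points\<close>

lemma continuous_map_discrete_prod:
  assumes "\<And>g. g \<in> A \<Longrightarrow> continuous_map Z Y (\<lambda>z. f (g, z))"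
  shows "continuous_map (prod_topology (discrete_topology A) Z) Y f"
  unfolding continuous_map_def
proof (intro conjI allI impI)
  show "f \<in> topspace (prod_topology (discrete_topology A) Z) \<rightarrow> topspace Y"
    using assms by (auto simp: continuous_map_def)
  fix U assume U: "openin Y U"
  have eq: "{x \<in> topspace (prod_topology (discrete_topology A) Z). f x \<in> U}
      = (\<Union>g\<in>A. {g} \<times> {z \<in> topspace Z. f (g, z) \<in> U})" by auto
  have "openin Z {z \<in> topspace Z. f (g, z) \<in> U}" if "g \<in> A" for g
    using assms[OF that] U by (simp add: continuous_map_def)
  then show "openin (prod_topology (discrete_topology A) Z) {x \<in> topspace (prod_topology (discrete_topology A) Z). f x \<in> U}"
    unfolding eq by (intro openin_Union) (auto simp: openin_prod_Times_iff)
qed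

text \<open>A simplex is connected, and a finite subset of a \<open>T\<^sub>1\<close> space is discrete.\<close>

lemma finite_image_constant_on_simplex:
  assumes c\<kappa>: "continuous_map W W \<kappa>" and fin: "finite (\<kappa> ` topspace W)" and t1: "t1_space W"
    and f: "singular_simplex p W f"
  obtains a where "a \<in> topspace W" "\<And>t. t \<in> standard_simplex p \<Longrightarrow> \<kappa> (f t) = a"
proof -
  have cf: "continuous_map (subtopology (powertop_real UNIV) (standard_simplex p)) W f"
    using f by (simp add: singular_simplex_def)
  let ?N = "\<kappa> ` topspace W"
  have sub: "\<kappa> ` topspace W \<subseteq> topspace W" using c\<kappa> by (auto simp: continuous_map_def)
  have disc: "subtopology W ?N = discrete_topology ?N"
    using sub fin t1 by (intro finite_t1_space_imp_discrete_topology t1_space_subtopology) (auto simp: Int_absorb1)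
  have "connectedin W ((\<kappa> \<circ> f) ` standard_simplex p)"
    using connectedin_continuous_map_image[OF continuous_map_compose[OF cf c\<kappa>]] connectedin_standard_simplex
    by (simp add: connectedin_subtopology)
  moreover have sub2: "(\<kappa> \<circ> f) ` standard_simplex p \<subseteq> ?N"
    using cf by (auto simp: continuous_map_def)
  ultimately have "connectedin (discrete_topology ?N) ((\<kappa> \<circ> f) ` standard_simplex p)"
    unfolding disc[symmetric] by (simp add: connectedin_subtopology)
  then obtain a where a: "(\<kappa> \<circ> f) ` standard_simplex p \<subseteq> {a}"
    by (auto simp: connectedin_discrete_topology)
  have "a \<in> topspace W" using a sub sub2 nonempty_standard_simplex[of p] by blast
  moreover have "\<kappa> (f t) = a" if "t \<in> standard_simplex p" for t
    using a that by (simp add: image_subset_iff)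
  ultimately show ?thesis by (rule that)
qed

text \<open>A cycle is homologous to its image under the final map \<open>\<kappa>\<close> of the contraction, and this image consists of
  constant paths. A constant path is the boundary of a constant triangle.\<close>

lemma cycle_bounds_if_contracts:
  assumes hom: "homotopic_with (\<lambda>_. True) W W id \<kappa>"
    and fin: "finite (\<kappa> ` topspace W)" and t1: "t1_space W"
    and z: "singular_relcycle 1 W {} z"
  shows "singular_relboundary 1 W {} z"
proof -
  have c\<kappa>: "continuous_map W W \<kappa>" using hom homotopic_with_imp_continuous_maps by blast
  have zc: "singular_chain 1 W z" using z by (simp add: singular_cycle)
  have "homotopic_with (\<lambda>h. h \<in> {} \<rightarrow> {}) W W id \<kappa>"
    using hom by (rule homotopic_with_mono) auto
  from homotopic_imp_homologous_rel_chain_maps[OF this z]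
  have "homologous_rel 1 W {} z (chain_map 1 \<kappa> z)"
    using chain_map_ident[OF zc] by simp
  moreover have "singular_relboundary 1 W {} (chain_map 1 \<kappa> z)"
    using zc unfolding singular_chain_def
  proof (induction z rule: frag_induction)
    case (one f)
    then have f: "singular_simplex 1 W f" by simp
    obtain a where aW: "a \<in> topspace W" and a: "\<And>t. t \<in> standard_simplex 1 \<Longrightarrow> \<kappa> (f t) = a"
      using finite_image_constant_on_simplex[OF c\<kappa> fin t1 f] by blast
    have fa: "simplex_map 1 \<kappa> f = restrict (\<lambda>x. a) (standard_simplex 1)"
      using a by (auto simp: simplex_map_def restrict_def fun_eq_iff)
    \<comment> \<open>of its three faces, which are equal, two cancel\<close>
    let ?d = "restrict (\<lambda>x. a) (standard_simplex 2)"
    have "singular_chain 2 W (frag_of ?d)"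
      using aW by (simp add: singular_chain_of singular_simplex_def continuous_map_eq[OF continuous_map_const[THEN iffD2]])
    moreover have "chain_boundary 2 (frag_of ?d) = frag_of (restrict (\<lambda>x. a) (standard_simplex 1))"
    proof -
      have "singular_face 2 k ?d = restrict (\<lambda>x. a) (standard_simplex 1)" if "k \<le> 2" for k
        using that simplical_face_in_standard_simplex[of 2 k]
        by (auto simp: singular_face_def restrict_def fun_eq_iff One_nat_def)
      then show ?thesis by (simp add: chain_boundary_of atMost_1_2)
    qed
    ultimately show ?case
      unfolding singular_boundary chain_map_of fa by (metis Suc_1 One_nat_def)
  qed (auto simp: chain_map_diff singular_relboundary_diff)
  ultimately show ?thesis
    unfolding homologous_rel_def using singular_relboundary_add by fastforce
qed

text \<open>The closed interval without its midpoint contracts onto its ends, and the open interval onto its midpoint.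
  A zone contains both ends of the interval or neither, and the ends stay in place, so that
  products of zones fit together along the glued sides.\<close>

definition zone :: "bool \<Rightarrow> real set" where
  "zone b = (if b then {0..1} - {1/2} else {0<..<1})"

definition target :: "bool \<Rightarrow> real \<Rightarrow> real" where
  "target b x = (if b then (if x < 1/2 then 0 else 1) else 1/2)"

definition pull :: "bool \<Rightarrow> real \<Rightarrow> real \<Rightarrow> real" where
  "pull b t x = (1 - t) * x + t * target b x"

lemma zone_subset: "zone b \<subseteq> {0..1}"
  by (auto simp: zone_def)

lemma pull_in_zone:
  assumes x: "x \<in> zone b" and t: "t \<in> {0..1}"
  shows "pull b t x \<in> zone b" "target b (pull b t x) = target b x"
proof -
  have "pull b t x \<in> zone b \<and> target b (pull b t x) = target b x"
  proof (cases b)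
    case True
    show ?thesis
    proof (cases "x < 1/2")
      case 1: True
      then have p: "pull b t x = (1 - t) * x" using True by (simp add: pull_def target_def)
      have "0 \<le> (1 - t) * x" "(1 - t) * x \<le> x"
        using x t True by (auto simp: zone_def intro: mult_left_le_one_le)
      then show ?thesis using 1 True p by (auto simp: zone_def target_def)
    next
      case 2: False
      then have p: "1 - pull b t x = (1 - t) * (1 - x)" using True by (simp add: pull_def target_def algebra_simps)
      have "0 \<le> (1 - t) * (1 - x)" "(1 - t) * (1 - x) \<le> 1 - x"
        using x t True by (auto simp: zone_def intro: mult_left_le_one_le)
      then show ?thesis using 2 x True p by (auto simp: zone_def target_def)
    qed
  next
    case False
    have "convex {0<..<1::real}" by simp
    then have "(1 - t) *\<^sub>R x + t *\<^sub>R (1/2) \<in> {0<..<1::real}"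
      using x t False by (intro convexD) (auto simp: zone_def)
    then show ?thesis using False by (simp add: pull_def target_def zone_def)
  qed
  then show "pull b t x \<in> zone b" "target b (pull b t x) = target b x" by auto
qed

lemma continuous_on_target: "continuous_on (zone b) (target b)"
proof (cases b)
  case True
  have 1: "continuous_on {..<1/2} (target b)"
    by (rule continuous_on_eq[of _ "\<lambda>_. 0"]) (auto simp: target_def True)
  have 2: "continuous_on {1/2<..} (target b)"
    by (rule continuous_on_eq[of _ "\<lambda>_. 1"]) (auto simp: target_def True)
  have "continuous_on ({..<1/2} \<union> {1/2<..}) (target b)"
    using 1 2 by (intro continuous_on_open_Un) auto
  then show ?thesis
    by (rule continuous_on_subset) (auto simp: zone_def True)
next
  case False
  then show ?thesis by (simp add: target_def zone_def)
qed

section \<open>The surface as a quotient of the squares\<close>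

locale origami = group G for G :: "('g, 'b) monoid_scheme" (structure) +
  fixes r u :: 'g
  assumes finite_G: "finite (carrier G)" and r_in [simp, intro]: "r \<in> carrier G" and u_in [simp, intro]: "u \<in> carrier G"
begin

abbreviation "q \<equiv> origami_class G r u"
abbreviation "M \<equiv> regular_origami G r u"
abbreviation "Sq \<equiv> origami_squares G"

lemma topspace_squares: "topspace Sq = carrier G \<times> ({0..1} \<times> {0..1})"
  by (simp add: origami_squares_def)

lemma topspace_origami: "topspace M = q ` (carrier G \<times> ({0..1} \<times> {0..1}))"
  by (simp add: regular_origami_def topspace_quotient_topology topspace_squares)

lemma quotient_map_q: "quotient_map Sq M q"
  unfolding regular_origami_def by (rule quotient_map_quotient_topology)

lemma mem_q_self [simp]: "p \<in> q p"
  by (simp add: origami_class_def)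

lemma q_eqI: "p' \<in> q p \<Longrightarrow> q p' = q p"
proof -
  let ?R = "origami_gluing G r u \<union> (origami_gluing G r u)\<inverse>"
  assume "p' \<in> q p"
  then have 1: "(p, p') \<in> ?R\<^sup>*" by (simp add: origami_class_def)
  have "sym (?R\<^sup>*)" by (intro sym_rtrancl) (auto simp: sym_def)
  then have 2: "(p', p) \<in> ?R\<^sup>*" using 1 by (rule symD)
  show "q p' = q p"
    using 1 2 by (auto simp: origami_class_def intro: rtrancl_trans)
qed

lemma q_invariant:
  assumes "\<And>a b. (a, b) \<in> origami_gluing G r u \<Longrightarrow> F a = F b" and "p' \<in> q p"
  shows "F p' = F p"
proof -
  have "(p, p') \<in> (origami_gluing G r u \<union> (origami_gluing G r u)\<inverse>)\<^sup>*"
    using assms(2) by (simp add: origami_class_def)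
  then show ?thesis
    by (induction rule: rtrancl_induct) (use assms(1) in auto)
qed

lemma q_eq_invariant:
  assumes "\<And>a b. (a, b) \<in> origami_gluing G r u \<Longrightarrow> F a = F b" and "q p' = q p"
  shows "F p' = F p"
proof -
  have "p' \<in> q p" using assms(2) mem_q_self[of p'] by simp
  with assms(1) show ?thesis by (rule q_invariant)
qed

lemma q_glue:
  assumes "g \<in> carrier G" "y \<in> {0..1}"
  shows "q (g, (1, y)) = q (g \<otimes> r, (0, y))" "q (g, (y, 1)) = q (g \<otimes> u, (y, 0))"
proof -
  have "(g, (1, y)) \<in> q (g \<otimes> r, (0, y))" "(g, (y, 1)) \<in> q (g \<otimes> u, (y, 0))"
    using assms by (auto simp: origami_class_def origami_gluing_def intro!: r_into_rtrancl)
  then show "q (g, (1, y)) = q (g \<otimes> r, (0, y))" "q (g, (y, 1)) = q (g \<otimes> u, (y, 0))"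
    by (simp_all only: q_eqI)
qed

lemma gluing_cases:
  assumes "(a, b) \<in> origami_gluing G r u"
  obtains (right) g y where "g \<in> carrier G" "y \<in> {0..1}" "a = (g, (1, y))" "b = (g \<otimes> r, (0, y))"
  | (top) g x where "g \<in> carrier G" "x \<in> {0..1}" "a = (g, (x, 1))" "b = (g \<otimes> u, (x, 0))"
  using assms by (auto simp: origami_gluing_def)

lemma q_subset_squares:
  assumes "p \<in> topspace Sq" "p' \<in> q p"
  shows "p' \<in> topspace Sq"
proof -
  have "(p' \<in> topspace Sq) = (p \<in> topspace Sq)"
    by (rule q_invariant[OF _ assms(2)]) (auto simp: topspace_squares elim!: gluing_cases)
  with assms(1) show ?thesis by simp
qed

text \<open>The function on the surface induced by \<open>F\<close>. It is meaningful if \<open>F\<close> respects the gluing, so that the choice of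
  a representative does not matter.\<close>

definition descend :: "('g \<times> real \<times> real \<Rightarrow> 'c) \<Rightarrow> ('g \<times> real \<times> real) set \<Rightarrow> 'c" where
  "descend F c = F (SOME p. p \<in> c)"

lemma descend_q:
  assumes "\<And>a b. (a, b) \<in> origami_gluing G r u \<Longrightarrow> F a = F b"
  shows "descend F (q p) = F p"
proof -
  have "(SOME p'. p' \<in> q p) \<in> q p" by (rule someI[of _ p]) simp
  with assms show ?thesis unfolding descend_def by (rule q_invariant)
qed

lemma continuous_map_descend:
  assumes "\<And>a b. (a, b) \<in> origami_gluing G r u \<Longrightarrow> F a = F b"
    and "\<And>g. g \<in> carrier G \<Longrightarrow> continuous_map (top_of_set ({0..1} \<times> {0..1})) Y (\<lambda>p. F (g, p))"
  shows "continuous_map M Y (descend F)"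
proof (rule continuous_compose_quotient_map[OF quotient_map_q])
  have "descend F \<circ> q = F" using descend_q[OF assms(1)] by auto
  then show "continuous_map Sq Y (descend F \<circ> q)"
    unfolding origami_squares_def using assms(2) by (auto intro!: continuous_map_discrete_prod)
qed

lemma continuous_map_square:
  assumes "g \<in> carrier G"
  shows "continuous_map (top_of_set ({0..1} \<times> {0..1})) M (\<lambda>p. q (g, p))"
proof -
  have "continuous_map (top_of_set ({0..1} \<times> {0..1})) Sq (\<lambda>p. (g, p))"
    unfolding origami_squares_def using assms by (intro continuous_map_pairedI) auto
  from continuous_map_compose[OF this quotient_imp_continuous_map[OF quotient_map_q]]
  show ?thesis by (simp add: o_def)
qed

text \<open>A gluing class is finite, because gluing changes a coordinate of the point only between \<open>0\<close> and \<open>1\<close>.\<close>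

lemma t1_origami: "t1_space M"
proof (unfold t1_space_closedin_singleton, intro ballI)
  fix c assume "c \<in> topspace M"
  then obtain p where p: "p \<in> topspace Sq" and c: "c = q p"
    by (auto simp: topspace_origami topspace_squares)
  obtain g x y where gxy: "p = (g, (x, y))" by (metis prod.collapse)
  let ?near = "\<lambda>x. insert x {0, 1 :: real}"
  have "(snd p' \<in> ?near x \<times> ?near y) = (snd p \<in> ?near x \<times> ?near y)" if "p' \<in> q p" for p'
    by (rule q_invariant[OF _ that]) (auto elim!: gluing_cases)
  then have "q p \<subseteq> carrier G \<times> (?near x \<times> ?near y)"
    using q_subset_squares[OF p] by (force simp: gxy topspace_squares)
  then have fin: "finite (q p)"
    by (rule finite_subset) (simp add: finite_G)
  have "t1_space (discrete_topology (carrier G))" "t1_space (top_of_set ({0..1::real} \<times> {0..1::real}))"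
    by (simp_all add: Hausdorff_imp_t1_space Hausdorff_space_subtopology)
  then have "t1_space Sq"
    unfolding origami_squares_def by (simp add: t1_space_prod_topology)
  then have "closedin Sq (q p)"
    using fin q_subset_squares[OF p] unfolding t1_space_closedin_finite by blast
  moreover have "{p' \<in> topspace Sq. q p' \<in> {c}} = q p"
    using c q_eqI[of _ p] mem_q_self q_subset_squares[OF p] by blast
  moreover have "closedin Sq {p' \<in> topspace Sq. q p' \<in> {c}} \<longleftrightarrow> closedin M {c}"
    using quotient_map_q \<open>c \<in> topspace M\<close> unfolding quotient_map_closedin by blast
  ultimately show "closedin M {c}" by simp
qed

end

section \<open>A cover by four open sets that contract onto points\<close>

definition unit_square :: "(real \<times> real) set" where
  "unit_square = {0..1} \<times> {0..1}"

lemma convex_unit_square: "convex unit_square"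
  by (simp add: unit_square_def convex_Times)

abbreviation point_simplex :: "'a \<Rightarrow> (nat \<Rightarrow> real) \<Rightarrow> 'a" where
  "point_simplex x \<equiv> restrict (\<lambda>_. x) (standard_simplex 0)"

lemma singular_face_1:
  "singular_face 1 0 \<sigma> = point_simplex (\<sigma> (vertex 1))"
  "singular_face 1 1 \<sigma> = point_simplex (\<sigma> (vertex 0))"
proof -
  have "standard_simplex (1 - Suc 0) = {vertex 0}" by (simp add: One_nat_def standard_simplex_0 vertex_def)
  moreover have "standard_simplex 0 = {vertex 0}" by (simp add: standard_simplex_0 vertex_def)
  ultimately show "singular_face 1 0 \<sigma> = point_simplex (\<sigma> (vertex 1))" "singular_face 1 1 \<sigma> = point_simplex (\<sigma> (vertex 0))"
    unfolding singular_face_def by (auto intro!: restrict_ext simp: simplical_face_vertex One_nat_def)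
qed

lemma chain_boundary_1:
  "chain_boundary 1 (frag_of \<sigma>) = frag_of (point_simplex (\<sigma> (vertex 1))) - frag_of (point_simplex (\<sigma> (vertex 0)))"
  by (simp add: chain_boundary_of atMost_1_2 singular_face_1)

context origami
begin

text \<open>The four choices of \<open>a\<close> and \<open>b\<close> give neighbourhoods of the vertices (\<open>True, True\<close>), of the open sides (two cases)
  and of the centres of the squares (\<open>False, False\<close>).\<close>

definition zone_set :: "bool \<Rightarrow> bool \<Rightarrow> ('g \<times> real \<times> real) set set" where
  "zone_set a b = q ` (carrier G \<times> zone a \<times> zone b)"

lemma zone_saturated:
  assumes "p \<in> topspace Sq"
  shows "q p \<in> zone_set a b \<longleftrightarrow> snd p \<in> zone a \<times> zone b"
proof
  assume "snd p \<in> zone a \<times> zone b"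
  then show "q p \<in> zone_set a b" using assms by (auto simp: zone_set_def topspace_squares)
next
  assume "q p \<in> zone_set a b"
  then obtain p' where p': "snd p' \<in> zone a \<times> zone b" "q p = q p'"
    by (auto simp: zone_set_def)
  have "(snd p \<in> zone a \<times> zone b) = (snd p' \<in> zone a \<times> zone b)"
    by (rule q_eq_invariant[OF _ p'(2)]) (auto elim!: gluing_cases simp: zone_def)
  then show "snd p \<in> zone a \<times> zone b" using p' by simp
qed

lemma zone_product_subset: "carrier G \<times> zone a \<times> zone b \<subseteq> topspace Sq"
  unfolding topspace_squares by (intro Sigma_mono zone_subset order_refl)

lemma zone_preimage: "{p \<in> topspace Sq. q p \<in> zone_set a b} = carrier G \<times> zone a \<times> zone b"
proof (intro equalityI subsetI)
  fix p assume "p \<in> {p \<in> topspace Sq. q p \<in> zone_set a b}"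
  then show "p \<in> carrier G \<times> zone a \<times> zone b"
    using zone_saturated[of p a b] by (cases p) (simp add: topspace_squares)
next
  fix p assume "p \<in> carrier G \<times> zone a \<times> zone b"
  then show "p \<in> {p \<in> topspace Sq. q p \<in> zone_set a b}"
    using zone_product_subset[of a b] by (auto simp: zone_set_def)
qed

lemma openin_zone_set: "openin M (zone_set a b)"
proof -
  have "\<exists>T. open T \<and> zone a = {0..1} \<inter> T" for a
    by (rule exI[of _ "if a then - {1/2} else {0<..<1}"]) (auto simp: zone_def)
  then have "openin (top_of_set {0..1}) (zone a)" for a
    by (auto simp: openin_open)
  then have "openin (prod_topology (top_of_set {0..1}) (top_of_set {0..1})) (zone a \<times> zone b)"
    by (simp only: openin_prod_Times_iff) simp
  then have "openin Sq (carrier G \<times> zone a \<times> zone b)"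
    by (simp add: origami_squares_def openin_prod_Times_iff)
  moreover have "zone_set a b \<subseteq> q ` topspace Sq"
    unfolding zone_set_def by (intro image_mono zone_product_subset)
  ultimately show ?thesis
    unfolding regular_origami_def openin_quotient_topology zone_preimage by blast
qed

lemma topspace_zone: "topspace (subtopology M (zone_set a b)) = zone_set a b"
  using openin_subset[OF openin_zone_set] by (simp add: Int_absorb1)

lemma zones_cover: "topspace M \<subseteq> \<Union> (range (\<lambda>(a, b). zone_set a b))"
proof
  fix c assume "c \<in> topspace M"
  then obtain g x y where c: "c = q (g, (x, y))" "g \<in> carrier G" "x \<in> {0..1}" "y \<in> {0..1}"
    by (auto simp: topspace_origami)
  have z: "\<exists>a. x \<in> zone a" if "x \<in> {0..1}" for x
    using that by (cases "x = 1/2") (auto simp: zone_def intro: exI[of _ True] exI[of _ False])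
  obtain a b where "x \<in> zone a" "y \<in> zone b" using z c by meson
  then have "c \<in> zone_set a b" using c by (auto simp: zone_set_def)
  then show "c \<in> \<Union> (range (\<lambda>(a, b). zone_set a b))" by auto
qed

text \<open>The case distinction makes the function under \<open>descend\<close> respect the gluing on all squares: the points of a
  gluing class lie in the zone all together or not at all.\<close>

definition contraction :: "bool \<Rightarrow> bool \<Rightarrow> real \<Rightarrow> ('g \<times> real \<times> real) set \<Rightarrow> ('g \<times> real \<times> real) set" where
  "contraction a b t = descend (\<lambda>(g, (x, y)). if (x, y) \<in> zone a \<times> zone b then q (g, (pull a t x, pull b t y)) else undefined)"

lemma contraction_q:
  assumes "(x, y) \<in> zone a \<times> zone b" "t \<in> {0..1}"
  shows "contraction a b t (q (g, (x, y))) = q (g, (pull a t x, pull b t y))"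
proof -
  let ?F = "\<lambda>(g, (x, y)). if (x, y) \<in> zone a \<times> zone b then q (g, (pull a t x, pull b t y)) else undefined"
  have "?F p = ?F p'" if "(p, p') \<in> origami_gluing G r u" for p p'
    using that
  proof (cases rule: gluing_cases)
    case (right g y)
    have "q (g, (1, pull b t y)) = q (g \<otimes> r, (0, pull b t y))" if "y \<in> zone b"
      using right that pull_in_zone[OF that assms(2)] zone_subset[of b] by (intro q_glue) auto
    then show ?thesis using right
      by (cases a) (auto simp: zone_def[of True] zone_def[of False] pull_def[of True] target_def[of True])
  next
    case (top g x)
    have "q (g, (pull a t x, 1)) = q (g \<otimes> u, (pull a t x, 0))" if "x \<in> zone a"
      using top that pull_in_zone[OF that assms(2)] zone_subset[of a] by (intro q_glue) auto
    then show ?thesis using top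
      by (cases b) (auto simp: zone_def[of True] zone_def[of False] pull_def[of True] target_def[of True])
  qed
  from descend_q[of ?F, OF this] show ?thesis
    using assms(1) by (simp add: contraction_def)
qed

lemma zone_contracts:
  "homotopic_with (\<lambda>_. True) (subtopology M (zone_set a b)) (subtopology M (zone_set a b)) id (contraction a b 1)"
proof -
  let ?W = "subtopology M (zone_set a b)" and ?I = "top_of_set {0..1::real}"
  let ?U = "prod_topology (discrete_topology (carrier G)) (top_of_set (zone a \<times> zone b))"
  have "zone a \<times> zone b \<subseteq> {0..1} \<times> {0..1}" using zone_subset by blast
  then have U: "subtopology Sq (carrier G \<times> zone a \<times> zone b) = ?U"
    by (simp add: origami_squares_def subtopology_Times subtopology_subtopology Int_absorb1)
  have "quotient_map (subtopology Sq (carrier G \<times> zone a \<times> zone b)) ?W q"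
    using quotient_map_restriction[OF quotient_map_q zone_preimage] openin_zone_set by blast
  then have qU: "quotient_map ?U ?W q" by (simp only: U)
  have qm: "quotient_map (prod_topology ?I ?U) (prod_topology ?I ?W) (\<lambda>(t, p). (t, q p))"
  proof (rule quotient_map_prod_right[OF _ _ qU])
    show "locally_compact_space ?I"
      by (simp add: compact_imp_locally_compact_space compact_space_subtopology)
    show "Hausdorff_space ?I \<or> regular_space ?I"
      by (simp add: Hausdorff_space_subtopology)
  qed
  have cp: "continuous_on ({0..1} \<times> zone a \<times> zone b) (\<lambda>(t, x, y). (pull a t x, pull b t y))"
  proof -
    have "continuous_on ({0..1::real} \<times> zone a \<times> zone b) (\<lambda>z. target a (fst (snd z)))"
      by (rule continuous_on_compose2[OF continuous_on_target]) (auto intro!: continuous_intros)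
    moreover have "continuous_on ({0..1::real} \<times> zone a \<times> zone b) (\<lambda>z. target b (snd (snd z)))"
      by (rule continuous_on_compose2[OF continuous_on_target]) (auto intro!: continuous_intros)
    ultimately show ?thesis
      unfolding case_prod_unfold pull_def by (intro continuous_intros)
  qed
  let ?h = "\<lambda>(t, g, x, y). (g, (pull a t x, pull b t y))"
  have "continuous_map (prod_topology ?I ?U) (prod_topology (discrete_topology (carrier G)) (top_of_set (zone a \<times> zone b))) ?h"
  proof -
    have 1: "continuous_map (prod_topology ?I ?U) (discrete_topology (carrier G)) (\<lambda>z. fst (snd z))"
      using continuous_map_compose[OF continuous_map_snd continuous_map_fst] by (simp add: o_def)
    have "continuous_map (prod_topology ?I ?U) (prod_topology ?I (top_of_set (zone a \<times> zone b))) (\<lambda>z. (fst z, snd (snd z)))"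
      using continuous_map_compose[OF continuous_map_snd continuous_map_snd]
      by (intro continuous_map_pairedI continuous_map_fst) (simp add: o_def)
    then have 2: "continuous_map (prod_topology ?I ?U) (top_of_set ({0..1} \<times> zone a \<times> zone b)) (\<lambda>z. (fst z, snd (snd z)))"
      by simp
    have 3: "continuous_map (top_of_set ({0..1} \<times> zone a \<times> zone b)) (top_of_set (zone a \<times> zone b)) (\<lambda>(t, x, y). (pull a t x, pull b t y))"
      using cp pull_in_zone(1) by (auto simp: continuous_map_in_subtopology)
    show ?thesis
      using continuous_map_pairedI[OF 1 continuous_map_compose[OF 2 3]] by (simp add: o_def case_prod_unfold)
  qed
  from continuous_map_compose[OF this quotient_imp_continuous_map[OF qU]]
  have c1: "continuous_map (prod_topology ?I ?U) ?W (q \<circ> ?h)" .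
  have "continuous_map (prod_topology ?I ?W) ?W (\<lambda>(t, c). contraction a b t c)"
  proof (rule continuous_compose_quotient_map[OF qm])
    show "continuous_map (prod_topology ?I ?U) ?W ((\<lambda>(t, c). contraction a b t c) \<circ> (\<lambda>(t, p). (t, q p)))"
      by (rule continuous_map_eq[OF c1]) (auto simp: contraction_q)
  qed
  moreover have "contraction a b 0 c = c" if "c \<in> zone_set a b" for c
    using that by (auto simp: zone_set_def contraction_q pull_def)
  ultimately show ?thesis
    unfolding homotopic_with
    by (subst homotopic_with) (auto simp: topspace_zone intro!: exI[of _ "\<lambda>(t, c). contraction a b t c"])
qed

lemma zone_cycle_bounds:
  assumes "singular_relcycle 1 (subtopology M (zone_set a b)) {} z"
  shows "singular_relboundary 1 (subtopology M (zone_set a b)) {} z"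
proof (rule cycle_bounds_if_contracts[OF zone_contracts _ _ assms])
  show "t1_space (subtopology M (zone_set a b))" using t1_origami by (rule t1_space_subtopology)
  have "contraction a b 1 ` zone_set a b \<subseteq> q ` (carrier G \<times> {0, 1/2, 1} \<times> {0, 1/2, 1})"
    by (auto simp: zone_set_def contraction_q pull_def target_def)
  then show "finite (contraction a b 1 ` topspace (subtopology M (zone_set a b)))"
    unfolding topspace_zone by (rule finite_subset) (simp add: finite_G)
qed

end

section \<open>Pushing cycles into the sides of the squares\<close>

context origami
begin

text \<open>The affine singular simplex in the square \<open>g\<close> with vertices \<open>P 0, \<dots>, P n\<close>.\<close>

definition flat :: "nat \<Rightarrow> 'g \<Rightarrow> (nat \<Rightarrow> real \<times> real) \<Rightarrow> (nat \<Rightarrow> real) \<Rightarrow> ('g \<times> real \<times> real) set" where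
  "flat n g P = restrict (\<lambda>t. q (g, \<Sum>i\<le>n. t i *\<^sub>R P i)) (standard_simplex n)"

abbreviation seg :: "'g \<Rightarrow> real \<times> real \<Rightarrow> real \<times> real \<Rightarrow> (nat \<Rightarrow> real) \<Rightarrow> ('g \<times> real \<times> real) set" where
  "seg g a b \<equiv> flat 1 g (\<lambda>i. if i = 0 then a else b)"

lemma flat_point_in_square:
  assumes "\<And>i. i \<le> n \<Longrightarrow> P i \<in> unit_square" "t \<in> standard_simplex n"
  shows "(\<Sum>i\<le>n. t i *\<^sub>R P i) \<in> unit_square"
  using assms by (intro convex_sum convex_unit_square) (auto simp: standard_simplex_def)

lemma singular_simplex_flat:
  assumes g: "g \<in> carrier G" and P: "\<And>i. i \<le> n \<Longrightarrow> P i \<in> unit_square"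
  shows "singular_simplex n M (flat n g P)"
proof -
  let ?\<Delta> = "subtopology (powertop_real UNIV) (standard_simplex n)"
  have "continuous_map ?\<Delta> euclideanreal (\<lambda>x. x i)" for i
    by (intro continuous_map_from_subtopology continuous_map_product_projection) auto
  then have "continuous_map ?\<Delta> (prod_topology euclideanreal euclideanreal)
      (\<lambda>t. (\<Sum>i\<le>n. t i * fst (P i), \<Sum>i\<le>n. t i * snd (P i)))"
    by (intro continuous_map_pairedI continuous_map_sum continuous_map_real_mult) auto
  moreover have "(\<Sum>i\<le>n. t i *\<^sub>R P i) = (\<Sum>i\<le>n. t i * fst (P i), \<Sum>i\<le>n. t i * snd (P i))" for t
    by (simp add: prod_eq_iff fst_sum snd_sum)
  ultimately have "continuous_map ?\<Delta> euclidean (\<lambda>t. \<Sum>i\<le>n. t i *\<^sub>R P i)"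
    by simp
  then have "continuous_map ?\<Delta> (top_of_set ({0..1} \<times> {0..1})) (\<lambda>t. \<Sum>i\<le>n. t i *\<^sub>R P i)"
    using flat_point_in_square[OF P] by (auto simp: continuous_map_in_subtopology unit_square_def)
  from continuous_map_compose[OF this continuous_map_square[OF g]]
  have "continuous_map ?\<Delta> M (\<lambda>t. q (g, \<Sum>i\<le>n. t i *\<^sub>R P i))"
    by (simp add: o_def)
  then have "continuous_map ?\<Delta> M (flat n g P)"
    by (rule continuous_map_eq) (simp add: flat_def)
  then show ?thesis by (simp add: singular_simplex_def flat_def)
qed

lemma seg_apply:
  assumes "t \<in> standard_simplex 1"
  shows "seg g a b t = q (g, t 0 *\<^sub>R a + t 1 *\<^sub>R b)"
  using assms by (simp add: flat_def atMost_1_2)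

lemma seg_vertex [simp]: "seg g a b (vertex 0) = q (g, a)" "seg g a b (vertex 1) = q (g, b)"
  by (simp_all add: seg_apply) (simp_all add: vertex_def)

lemma singular_simplex_seg:
  "g \<in> carrier G \<Longrightarrow> a \<in> unit_square \<Longrightarrow> b \<in> unit_square \<Longrightarrow> singular_simplex 1 M (seg g a b)"
  by (rule singular_simplex_flat) auto

lemma singular_face_flat_2:
  "singular_face 2 0 (flat 2 g P) = seg g (P 1) (P 2)"
  "singular_face 2 1 (flat 2 g P) = seg g (P 0) (P 2)"
  "singular_face 2 2 (flat 2 g P) = seg g (P 0) (P 1)"
proof -
  have sf: "simplical_face k t \<in> standard_simplex 2" if "t \<in> standard_simplex 1" "k \<le> 2" for k t
    using simplical_face_in_standard_simplex[of 2 k t] that by (simp add: One_nat_def)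
  have [simp]: "2 - Suc 0 = 1" by simp
  have vals: "simplical_face 0 t 0 = 0" "simplical_face 0 t 1 = t 0" "simplical_face 0 t 2 = t 1"
    "simplical_face 1 t 0 = t 0" "simplical_face 1 t 1 = 0" "simplical_face 1 t 2 = t 1"
    "simplical_face 2 t 0 = t 0" "simplical_face 2 t 1 = t 1" "simplical_face 2 t 2 = 0" for t :: "nat \<Rightarrow> real"
    by (simp_all add: simplical_face_def One_nat_def)
  show "singular_face 2 0 (flat 2 g P) = seg g (P 1) (P 2)"
       "singular_face 2 1 (flat 2 g P) = seg g (P 0) (P 2)"
       "singular_face 2 2 (flat 2 g P) = seg g (P 0) (P 1)"
    by (rule ext, simp add: singular_face_def flat_def restrict_def sf atMost_1_2 vals)+
qed

abbreviation homologous_chains (infix "\<approx>" 50) where "c \<approx> d \<equiv> homologous_rel 1 M {} c d"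

lemma triangle:
  assumes "g \<in> carrier G" "a \<in> unit_square" "b \<in> unit_square" "c \<in> unit_square"
  shows "frag_of (seg g a c) \<approx> frag_of (seg g a b) + frag_of (seg g b c)"
proof -
  let ?P = "\<lambda>i::nat. if i = 0 then a else if i = 1 then b else c"
  have s: "singular_chain 2 M (frag_of (flat 2 g ?P))"
    unfolding singular_chain_of by (rule singular_simplex_flat) (use assms in auto)
  have "chain_boundary 2 (frag_of (flat 2 g ?P)) = frag_of (seg g b c) - frag_of (seg g a c) + frag_of (seg g a b)"
    by (simp add: chain_boundary_of atMost_1_2 singular_face_flat_2)
  then have "singular_relboundary 1 M {} (frag_of (seg g b c) - frag_of (seg g a c) + frag_of (seg g a b))"
    unfolding singular_boundary using s by (intro exI[of _ "frag_of (flat 2 g ?P)"]) (simp add: Suc_1)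
  then have "singular_relboundary 1 M {} (- (frag_of (seg g b c) - frag_of (seg g a c) + frag_of (seg g a b)))"
    by (simp only: singular_relboundary_minus)
  then show ?thesis by (simp add: homologous_rel_def algebra_simps)
qed

lemma seg_refl:
  assumes "g \<in> carrier G" "a \<in> unit_square"
  shows "frag_of (seg g a a) \<approx> 0"
proof -
  have "frag_of (seg g a a) - (frag_of (seg g a a) + frag_of (seg g a a)) = - frag_of (seg g a a)" by simp
  then have "singular_relboundary 1 M {} (- frag_of (seg g a a))"
    using triangle[of g a a a] assms by (simp add: homologous_rel_def)
  then show ?thesis by (simp add: homologous_rel_def singular_relboundary_minus)
qed

lemma seg_reverse:
  assumes "g \<in> carrier G" "a \<in> unit_square" "b \<in> unit_square"
  shows "frag_of (seg g b a) \<approx> - frag_of (seg g a b)"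
proof -
  have "0 \<approx> frag_of (seg g a b) + frag_of (seg g b a)"
    using homologous_rel_trans[OF triangle[of g a b a] seg_refl[of g a, unfolded homologous_rel_sym[of _ _ _ _ 0]]] assms by simp
  then have "frag_of (seg g a b) + frag_of (seg g b a) \<approx> 0" by (simp add: homologous_rel_sym)
  then show ?thesis by (simp add: homologous_rel_def algebra_simps)
qed

text \<open>The cell \<open>(g, True)\<close> is the top side of the square \<open>g\<close>, oriented to the right, and \<open>(g, False)\<close> is its right side,
  oriented upwards. The gluing makes every side of a square one of these.\<close>

definition edge :: "'g \<times> bool \<Rightarrow> (nat \<Rightarrow> real) \<Rightarrow> ('g \<times> real \<times> real) set" where
  "edge e = (if snd e then seg (fst e) (0, 1) (1, 1) else seg (fst e) (1, 0) (1, 1))"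

definition icell :: "('g \<times> bool \<Rightarrow>\<^sub>0 int) \<Rightarrow> ((nat \<Rightarrow> real) \<Rightarrow> ('g \<times> real \<times> real) set) \<Rightarrow>\<^sub>0 int" where
  "icell = frag_extend (frag_of \<circ> edge)"

lemma icell_simps: "icell (frag_of e) = frag_of (edge e)" "icell (c + d) = icell c + icell d"
  "icell (c - d) = icell c - icell d" "icell (- c) = - icell c" "icell 0 = 0"
  by (simp_all add: icell_def frag_extend_add frag_extend_diff frag_extend_minus)

lemma left_side: "g \<in> carrier G \<Longrightarrow> seg g (0, 0) (0, 1) = edge (g \<otimes> inv r, False)"
proof -
  assume g: "g \<in> carrier G"
  have "q (g, (0, y)) = q (g \<otimes> inv r, (1, y))" if "y \<in> {0..1}" for y
    using q_glue(1)[of "g \<otimes> inv r" y] g that by (simp add: m_assoc)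
  then show ?thesis
    by (auto simp: edge_def flat_def atMost_1_2 standard_simplex_def intro!: restrict_ext)
qed

lemma bottom_side: "g \<in> carrier G \<Longrightarrow> seg g (0, 0) (1, 0) = edge (g \<otimes> inv u, True)"
proof -
  assume g: "g \<in> carrier G"
  have "q (g, (y, 0)) = q (g \<otimes> inv u, (y, 1))" if "y \<in> {0..1}" for y
    using q_glue(2)[of "g \<otimes> inv u" y] g that by (simp add: m_assoc)
  then show ?thesis
    by (auto simp: edge_def flat_def atMost_1_2 standard_simplex_def intro!: restrict_ext)
qed

lemma corner_path_cellular:
  assumes g: "g \<in> carrier G" and c: "c \<in> {0, 1} \<times> {0, 1}"
  obtains w where "Poly_Mapping.keys w \<subseteq> carrier G \<times> UNIV" "frag_of (seg g (1, 1) c) \<approx> icell w"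
proof -
  have sq: "(0, 0) \<in> unit_square" "(0, 1) \<in> unit_square" "(1, 0) \<in> unit_square" "(1, 1) \<in> unit_square"
    by (auto simp: unit_square_def)
  have top: "frag_of (seg g (1, 1) (0, 1)) \<approx> icell (- frag_of (g, True))"
    using seg_reverse[OF g sq(2) sq(4)] by (simp add: icell_simps edge_def)
  have right: "frag_of (seg g (1, 1) (1, 0)) \<approx> icell (- frag_of (g, False))"
    using seg_reverse[OF g sq(3) sq(4)] by (simp add: icell_simps edge_def)
  have left: "frag_of (seg g (0, 1) (0, 0)) \<approx> icell (- frag_of (g \<otimes> inv r, False))"
    using seg_reverse[OF g sq(1) sq(2)] g by (simp add: icell_simps left_side)
  have diag: "frag_of (seg g (1, 1) (0, 0)) \<approx> icell (- frag_of (g, True) + - frag_of (g \<otimes> inv r, False))"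
    using homologous_rel_trans[OF homologous_rel_add[OF top left] triangle[OF g sq(4) sq(2) sq(1)]]
    by (simp only: icell_simps)
  consider "c = (1, 1)" | "c = (0, 1)" | "c = (1, 0)" | "c = (0, 0)" using c by auto
  then show ?thesis
  proof cases
    case 1
    have "frag_of (seg g (1, 1) c) \<approx> icell 0"
      unfolding 1 icell_simps(5) by (rule seg_refl[OF g sq(4)])
    then show ?thesis by (rule that[rotated]) simp
  next
    case 2
    show ?thesis by (rule that[of "- frag_of (g, True)"]) (use g in simp, unfold 2, rule top)
  next
    case 3
    show ?thesis by (rule that[of "- frag_of (g, False)"]) (use g in simp, unfold 3, rule right)
  next
    case 4
    have "Poly_Mapping.keys (- frag_of (g, True) + - frag_of (g \<otimes> inv r, False)) \<subseteq> carrier G \<times> UNIV"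
      using Poly_Mapping.keys_add[of "- frag_of (g, True)" "- frag_of (g \<otimes> inv r, False)"] g by auto
    then show ?thesis by (rule that) (unfold 4, rule diag)
  qed
qed

text \<open>The point of the square to which the endpoint of a small path is moved: in a direction where the zone excludes
  the midpoint it is the nearest end, and in the other direction it is always the lower end.\<close>

definition corner :: "bool \<Rightarrow> real \<Rightarrow> real" where
  "corner b x = (if b then target True x else 0)"

text \<open>Join both endpoints of the path \<open>\<sigma>\<close> to the points \<open>T0\<close>, \<open>T1\<close> onto which the zone contracts. These are the same
  point of the surface since \<open>\<sigma>\<close> is connected, so the three paths form a cycle in the zone, and it bounds there.
  Then go on from \<open>T0\<close> and \<open>T1\<close> to corners; these last paths coincide and cancel.\<close>

lemma small_simplex_homologous:
  assumes \<sigma>: "singular_simplex 1 M \<sigma>" and small: "\<sigma> \<in> standard_simplex 1 \<rightarrow> zone_set a b"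
    and p0: "g0 \<in> carrier G" "(x0, y0) \<in> unit_square" "\<sigma> (vertex 0) = q (g0, (x0, y0))"
    and p1: "g1 \<in> carrier G" "(x1, y1) \<in> unit_square" "\<sigma> (vertex 1) = q (g1, (x1, y1))"
  shows "frag_of \<sigma> \<approx> frag_of (seg g0 (x0, y0) (corner a x0, corner b y0)) - frag_of (seg g1 (x1, y1) (corner a x1, corner b y1))"
proof -
  let ?W = "subtopology M (zone_set a b)"
  have \<sigma>W: "singular_simplex 1 ?W \<sigma>"
    using \<sigma> small by (auto simp: singular_simplex_subtopology)
  have z: "x0 \<in> zone a" "y0 \<in> zone b" "x1 \<in> zone a" "y1 \<in> zone b"
  proof -
    have "q (g0, (x0, y0)) \<in> zone_set a b" "q (g1, (x1, y1)) \<in> zone_set a b"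
      using funcset_mem[OF small, of "vertex 0"] funcset_mem[OF small, of "vertex 1"] p0(3) p1(3) by simp_all
    moreover have "(g0, (x0, y0)) \<in> topspace Sq" "(g1, (x1, y1)) \<in> topspace Sq"
      using p0 p1 by (simp_all add: topspace_squares unit_square_def)
    ultimately show "x0 \<in> zone a" "y0 \<in> zone b" "x1 \<in> zone a" "y1 \<in> zone b"
      by (simp_all add: zone_saturated)
  qed
  have fin: "finite (contraction a b 1 ` topspace ?W)"
  proof -
    have "contraction a b 1 ` zone_set a b \<subseteq> q ` (carrier G \<times> {0, 1/2, 1} \<times> {0, 1/2, 1})"
      by (auto simp: zone_set_def contraction_q pull_def target_def)
    then show ?thesis
      unfolding topspace_zone by (rule finite_subset) (simp add: finite_G)
  qed
  have ck: "continuous_map ?W ?W (contraction a b 1)"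
    using zone_contracts homotopic_with_imp_continuous_maps by blast
  obtain m where m: "\<And>t. t \<in> standard_simplex 1 \<Longrightarrow> contraction a b 1 (\<sigma> t) = m"
    by (rule finite_image_constant_on_simplex[OF ck fin t1_space_subtopology[OF t1_origami] \<sigma>W]) (rule that)
  define T0 T1 where "T0 = (target a x0, target b y0)" and "T1 = (target a x1, target b y1)"
  define K0 K1 where "K0 = (corner a x0, corner b y0)" and "K1 = (corner a x1, corner b y1)"
  have T01: "q (g0, T0) = q (g1, T1)"
    using m[of "vertex 0"] m[of "vertex 1"] z by (simp add: p0(3) p1(3) contraction_q pull_def T0_def T1_def)
  have sq: "(x, y) \<in> unit_square" "(target a x, target b y) \<in> unit_square" "(corner a x, corner b y) \<in> unit_square"
    if "x \<in> zone a" "y \<in> zone b" for x y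
    using that zone_subset[of a] zone_subset[of b] by (auto simp: unit_square_def target_def corner_def)
  have segW: "singular_simplex 1 ?W (seg g (x, y) (target a x, target b y))"
    if g: "g \<in> carrier G" and xy: "x \<in> zone a" "y \<in> zone b" for g x y
    unfolding singular_simplex_subtopology
  proof (intro conjI subsetI)
    show "singular_simplex 1 M (seg g (x, y) (target a x, target b y))"
      using g sq[OF xy] by (intro singular_simplex_seg)
    fix w assume "w \<in> seg g (x, y) (target a x, target b y) ` standard_simplex 1"
    then obtain t where t: "t \<in> standard_simplex 1" and w: "w = seg g (x, y) (target a x, target b y) t" by auto
    have t01: "t 0 = 1 - t 1" "t 1 \<in> {0..1}" using t by (auto simp: standard_simplex_def atMost_1_2)
    then have "w = q (g, (pull a (t 1) x, pull b (t 1) y))"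
      using t by (simp add: w seg_apply pull_def)
    then show "w \<in> zone_set a b"
      using g pull_in_zone(1)[OF xy(1) t01(2)] pull_in_zone(1)[OF xy(2) t01(2)] by (auto simp: zone_set_def)
  qed
  let ?z = "frag_of \<sigma> - frag_of (seg g0 (x0, y0) T0) + frag_of (seg g1 (x1, y1) T1)"
  have "chain_boundary 1 ?z = 0"
    by (simp add: chain_boundary_add chain_boundary_diff chain_boundary_1 p0(3) p1(3) T01)
  moreover have "singular_chain 1 ?W ?z"
    unfolding T0_def T1_def
    by (intro singular_chain_add singular_chain_diff) (auto simp: singular_chain_of \<sigma>W intro!: segW p0 p1 z)
  ultimately have "singular_relboundary 1 ?W {} ?z"
    by (intro zone_cycle_bounds) (simp add: singular_cycle)
  then have "singular_relboundary 1 (subtopology M (topspace M)) {} ?z"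
    by (rule singular_boundary_mono[rotated]) (use openin_zone_set openin_subset in blast)
  then have 1: "frag_of \<sigma> \<approx> frag_of (seg g0 (x0, y0) T0) - frag_of (seg g1 (x1, y1) T1)"
    by (simp add: homologous_rel_def algebra_simps)
  \<comment> \<open>The map \<open>?D\<close> moves the midpoint to \<open>s\<close> and leaves an end in place. It respects the gluing on the points onto
    which the zone contracts, so the path to the corner depends only on the image of its start in the surface.\<close>
  have tail: "seg g0 T0 K0 = seg g1 T1 K1"
  proof -
    let ?D = "\<lambda>b s x::real. if b then x else s"
    have D: "q (g0, (?D a s (target a x0), ?D b s (target b y0))) = q (g1, (?D a s (target a x1), ?D b s (target b y1)))"
      if s: "s \<in> {0..1}" for s
    proof -
      let ?F = "\<lambda>(g, (x, y)). if (x, y) \<in> zone a \<times> zone b then q (g, (?D a s x, ?D b s y)) else undefined"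
      have "?F (g0, T0) = ?F (g1, T1)"
      proof (rule q_eq_invariant[OF _ T01])
        fix p p' assume "(p, p') \<in> origami_gluing G r u"
        then show "?F p = ?F p'"
        proof (cases rule: gluing_cases)
          case (right g y)
          have "q (g, (1, ?D b s y)) = q (g \<otimes> r, (0, ?D b s y))"
            using right s by (intro q_glue) auto
          then show ?thesis using right by (cases a) (auto simp: zone_def[of True] zone_def[of False])
        next
          case (top g x)
          have "q (g, (?D a s x, 1)) = q (g \<otimes> u, (?D a s x, 0))"
            using top s by (intro q_glue) auto
          then show ?thesis using top by (cases b) (auto simp: zone_def[of True] zone_def[of False])
        qed
      qed
      moreover have "(target a x, target b y) \<in> zone a \<times> zone b" for x y
        by (auto simp: zone_def target_def)
      ultimately show ?thesis by (simp add: T0_def T1_def)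
    qed
    show ?thesis
    proof (rule ext)
      fix t show "seg g0 T0 K0 t = seg g1 T1 K1 t"
      proof (cases "t \<in> standard_simplex 1")
        case True
        then have t01: "t 0 = 1 - t 1" "t 1 \<in> {0..1}" by (auto simp: standard_simplex_def atMost_1_2)
        have "t 0 *\<^sub>R (target a x, target b y) + t 1 *\<^sub>R (corner a x, corner b y) = (?D a (t 0 / 2) (target a x), ?D b (t 0 / 2) (target b y))" for x y
          using t01 by (auto simp: target_def corner_def)
        then show ?thesis
          using D[of "t 0 / 2"] t01 True by (simp add: seg_apply T0_def T1_def K0_def K1_def)
      qed (simp add: flat_def)
    qed
  qed
  have 2: "frag_of (seg g0 (x0, y0) K0) \<approx> frag_of (seg g0 (x0, y0) T0) + frag_of (seg g0 T0 K0)"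
    unfolding T0_def K0_def by (intro triangle p0 sq z)
  have 3: "frag_of (seg g1 (x1, y1) K1) \<approx> frag_of (seg g1 (x1, y1) T1) + frag_of (seg g1 T1 K1)"
    unfolding T1_def K1_def by (intro triangle p1 sq z)
  have "frag_of (seg g0 (x0, y0) K0) - frag_of (seg g1 (x1, y1) K1) \<approx> frag_of (seg g0 (x0, y0) T0) - frag_of (seg g1 (x1, y1) T1)"
    using homologous_rel_diff[OF 2 3] by (simp add: tail)
  then have "frag_of (seg g0 (x0, y0) T0) - frag_of (seg g1 (x1, y1) T1) \<approx> frag_of (seg g0 (x0, y0) K0) - frag_of (seg g1 (x1, y1) K1)"
    by (simp only: homologous_rel_sym)
  from homologous_rel_trans[OF this 1] show ?thesis
    by (simp only: K0_def K1_def)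
qed

text \<open>After subdivision all simplices of the cycle are small. Fix for every point of the surface a square that
  contains it and the path \<open>\<Gamma>\<close> from the point to the upper right corner of that square. A small simplex is
  homologous to a cellular chain minus \<open>\<Gamma>\<close> of its boundary, and the boundary of the whole cycle is \<open>0\<close>.\<close>

lemma integral_cycle_cellular:
  assumes z: "singular_relcycle 1 M {} z"
  obtains w where "Poly_Mapping.keys w \<subseteq> carrier G \<times> UNIV" "z \<approx> icell w"
proof -
  let ?C = "range (\<lambda>(a, b). zone_set a b)"
  obtain z' where z': "singular_relcycle 1 M {} z'" "z \<approx> z'"
    and small: "\<And>f. f \<in> Poly_Mapping.keys z' \<Longrightarrow> \<exists>V\<in>?C. f \<in> standard_simplex 1 \<rightarrow> V"
    by (rule small_homologous_rel_relcycle_exists[OF _ zones_cover z]) (auto intro: openin_zone_set)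
  have "\<forall>c\<in>topspace M. \<exists>g p. g \<in> carrier G \<and> p \<in> unit_square \<and> c = q (g, p)"
    unfolding topspace_origami unit_square_def by blast
  then obtain rg rp where rep: "\<And>c. c \<in> topspace M \<Longrightarrow> rg c \<in> carrier G \<and> rp c \<in> unit_square \<and> c = q (rg c, rp c)"
    by metis
  have corner_in: "(1, 1) \<in> unit_square" by (simp add: unit_square_def)
  define \<Gamma> where "\<Gamma> s = frag_of (seg (rg (s (vertex 0))) (rp (s (vertex 0))) (1, 1))" for s :: "(nat \<Rightarrow> real) \<Rightarrow> ('g \<times> real \<times> real) set"
  have "\<exists>w. Poly_Mapping.keys w \<subseteq> carrier G \<times> UNIV \<and> z' \<approx> icell w - frag_extend \<Gamma> (chain_boundary 1 z')"
  proof -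
    have "Poly_Mapping.keys z' \<subseteq> {f. singular_simplex 1 M f \<and> (\<exists>a b. f \<in> standard_simplex 1 \<rightarrow> zone_set a b)}"
      using small z'(1) by (fastforce simp: singular_cycle singular_chain_def)
    then show ?thesis
    proof (induction z' rule: frag_induction)
      case zero
      then show ?case by (intro exI[of _ 0]) (simp add: icell_simps)
    next
      case (one \<sigma>)
      then obtain a b where \<sigma>: "singular_simplex 1 M \<sigma>" and ab: "\<sigma> \<in> standard_simplex 1 \<rightarrow> zone_set a b" by auto
      let ?c0 = "\<sigma> (vertex 0)" and ?c1 = "\<sigma> (vertex 1)"
      have "?c0 \<in> topspace M" "?c1 \<in> topspace M"
        using \<sigma> by (auto simp: singular_simplex_def continuous_map_def)
      note R0 = rep[OF this(1)] and R1 = rep[OF this(2)]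
      obtain x0 y0 where xy0: "rp ?c0 = (x0, y0)" by (rule prod.exhaust)
      obtain x1 y1 where xy1: "rp ?c1 = (x1, y1)" by (rule prod.exhaust)
      let ?K0 = "(corner a x0, corner b y0)" and ?K1 = "(corner a x1, corner b y1)"
      have K: "?K0 \<in> {0, 1} \<times> {0, 1}" "?K1 \<in> {0, 1} \<times> {0, 1}" by (auto simp: corner_def target_def)
      then have Ks: "?K0 \<in> unit_square" "?K1 \<in> unit_square" by (auto simp: unit_square_def)
      have s: "frag_of \<sigma> \<approx> frag_of (seg (rg ?c0) (x0, y0) ?K0) - frag_of (seg (rg ?c1) (x1, y1) ?K1)"
        by (rule small_simplex_homologous[OF \<sigma> ab]) (use R0 R1 xy0 xy1 in auto)
      obtain w0 where w0: "Poly_Mapping.keys w0 \<subseteq> carrier G \<times> UNIV" "frag_of (seg (rg ?c0) (1, 1) ?K0) \<approx> icell w0"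
        by (rule corner_path_cellular[OF conjunct1[OF R0] K(1)])
      obtain w1 where w1: "Poly_Mapping.keys w1 \<subseteq> carrier G \<times> UNIV" "frag_of (seg (rg ?c1) (1, 1) ?K1) \<approx> icell w1"
        by (rule corner_path_cellular[OF conjunct1[OF R1] K(2)])
      have ps: "point_simplex c (vertex 0) = c" for c :: "('g \<times> real \<times> real) set" by simp
      have G0: "\<Gamma> (point_simplex ?c0) = frag_of (seg (rg ?c0) (x0, y0) (1, 1))"
        unfolding \<Gamma>_def ps xy0 ..
      have t0: "frag_of (seg (rg ?c0) (x0, y0) ?K0) \<approx> \<Gamma> (point_simplex ?c0) + icell w0"
        unfolding G0
        by (rule homologous_rel_trans[OF homologous_rel_add[OF homologous_rel_refl w0(2)] triangle])
           (use R0 xy0 corner_in Ks in simp_all)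
      have G1: "\<Gamma> (point_simplex ?c1) = frag_of (seg (rg ?c1) (x1, y1) (1, 1))"
        unfolding \<Gamma>_def ps xy1 ..
      have t1: "frag_of (seg (rg ?c1) (x1, y1) ?K1) \<approx> \<Gamma> (point_simplex ?c1) + icell w1"
        unfolding G1
        by (rule homologous_rel_trans[OF homologous_rel_add[OF homologous_rel_refl w1(2)] triangle])
           (use R1 xy1 corner_in Ks in simp_all)
      have "frag_of \<sigma> \<approx> (\<Gamma> (point_simplex ?c0) + icell w0) - (\<Gamma> (point_simplex ?c1) + icell w1)"
        by (rule homologous_rel_trans[OF homologous_rel_diff[OF t0 t1] s])
      also have "(\<Gamma> (point_simplex ?c0) + icell w0) - (\<Gamma> (point_simplex ?c1) + icell w1)
          = icell (w0 - w1) - frag_extend \<Gamma> (chain_boundary 1 (frag_of \<sigma>))"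
        by (simp add: icell_simps chain_boundary_1 frag_extend_diff)
      finally show ?case
        using keys_diff_subset[of w0 w1] w0(1) w1(1) by blast
    next
      case (diff c d)
      then obtain w v where w: "Poly_Mapping.keys w \<subseteq> carrier G \<times> UNIV" "c \<approx> icell w - frag_extend \<Gamma> (chain_boundary 1 c)"
        and v: "Poly_Mapping.keys v \<subseteq> carrier G \<times> UNIV" "d \<approx> icell v - frag_extend \<Gamma> (chain_boundary 1 d)"
        by blast
      have "(icell w - frag_extend \<Gamma> (chain_boundary 1 c)) - (icell v - frag_extend \<Gamma> (chain_boundary 1 d))
          = icell (w - v) - frag_extend \<Gamma> (chain_boundary 1 (c - d))"
        by (simp add: icell_simps chain_boundary_diff frag_extend_diff)
      then have "c - d \<approx> icell (w - v) - frag_extend \<Gamma> (chain_boundary 1 (c - d))"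
        using homologous_rel_diff[OF w(2) v(2)] by simp
      moreover have "Poly_Mapping.keys (w - v) \<subseteq> carrier G \<times> UNIV"
        using keys_diff_subset[of w v] w(1) v(1) by blast
      ultimately show ?case by blast
    qed
  qed
  then obtain w where w: "Poly_Mapping.keys w \<subseteq> carrier G \<times> UNIV" "z' \<approx> icell w"
    using z'(1) by (auto simp: singular_cycle)
  show ?thesis by (rule that[OF w(1) homologous_rel_trans[OF w(2) z'(2)]])
qed

end

section \<open>Cellular cycles that bound\<close>

text \<open>Extend the vector by a basis of the span to a linearly independent set, and take the functional that is \<open>1\<close> on
  the vector and \<open>0\<close> on this basis.\<close>

lemma functional_separates:
  fixes b :: "'s \<Rightarrow> 't \<Rightarrow>\<^sub>0 complex"
  assumes x: "\<And>y. Poly_Mapping.keys y \<subseteq> A \<Longrightarrow> x \<noteq> clinear_extend b y"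
  shows "\<exists>f. (\<forall>s\<in>A. cpair f (b s) = 0) \<and> cpair f x \<noteq> 0"
proof -
  define sc where "sc a z = a * z" for a z :: complex
  have v1: "vector_space (cscale :: complex \<Rightarrow> ('t \<Rightarrow>\<^sub>0 complex) \<Rightarrow> _)"
    by (rule vector_space.intro) (simp_all add: cscale_add_right cscale_add_left)
  have v2: "vector_space sc"
    unfolding sc_def by (rule vector_space.intro) (simp_all add: algebra_simps)
  interpret V: vector_space "cscale :: complex \<Rightarrow> ('t \<Rightarrow>\<^sub>0 complex) \<Rightarrow> _" by (rule v1)
  interpret P: vector_space_pair "cscale :: complex \<Rightarrow> ('t \<Rightarrow>\<^sub>0 complex) \<Rightarrow> _" sc
    by (rule vector_space_pair.intro[OF v1 v2])
  have "V.span (b ` A) \<subseteq> clinear_extend b ` {y. Poly_Mapping.keys y \<subseteq> A}"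
  proof (rule V.span_minimal)
    show "b ` A \<subseteq> clinear_extend b ` {y. Poly_Mapping.keys y \<subseteq> A}"
      by (auto intro!: image_eqI[of _ _ "Poly_Mapping.single _ 1"])
    show "V.subspace (clinear_extend b ` {y. Poly_Mapping.keys y \<subseteq> A})"
    proof (rule V.subspaceI)
      show "0 \<in> clinear_extend b ` {y. Poly_Mapping.keys y \<subseteq> A}"
        by (rule image_eqI[of _ _ 0]) auto
    next
      fix v w assume "v \<in> clinear_extend b ` {y. Poly_Mapping.keys y \<subseteq> A}" "w \<in> clinear_extend b ` {y. Poly_Mapping.keys y \<subseteq> A}"
      then obtain y z where "Poly_Mapping.keys y \<subseteq> A" "v = clinear_extend b y" "Poly_Mapping.keys z \<subseteq> A" "w = clinear_extend b z"
        by auto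
      then show "v + w \<in> clinear_extend b ` {y. Poly_Mapping.keys y \<subseteq> A}"
        using Poly_Mapping.keys_add[of y z] by (intro image_eqI[of _ _ "y + z"]) (auto simp: clinear_extend_add)
    next
      fix c v assume "v \<in> clinear_extend b ` {y. Poly_Mapping.keys y \<subseteq> A}"
      then obtain y where "Poly_Mapping.keys y \<subseteq> A" "v = clinear_extend b y" by auto
      then show "cscale c v \<in> clinear_extend b ` {y. Poly_Mapping.keys y \<subseteq> A}"
        using keys_cscale[of c y] by (intro image_eqI[of _ _ "cscale c y"]) (auto simp: clinear_extend_cscale)
    qed
  qed
  then have xs: "x \<notin> V.span (b ` A)" using x by auto
  obtain B where B: "B \<subseteq> b ` A" "V.independent B" "b ` A \<subseteq> V.span B"
    using V.maximal_independent_subset by blast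
  have "x \<notin> V.span B" using xs V.span_mono[OF B(1)] by blast
  then have "V.independent (insert x B)" using B(2) V.independent_insertI by blast
  from P.linear_independent_extend[OF this, of "\<lambda>z. if z = x then 1 else 0"]
  obtain g where g: "Vector_Spaces.linear cscale sc g" "\<And>z. z \<in> insert x B \<Longrightarrow> g z = (if z = x then 1 else 0)"
    by blast
  have gadd: "g (y + z) = g y + g z" and gsc: "g (cscale c y) = c * g y" for y z c
    using g(1) by (auto simp: Vector_Spaces.linear_iff sc_def)
  have g0: "g 0 = 0" using gsc[of 0 0] by simp
  have gsum: "g (\<Sum>i\<in>I. h i) = (\<Sum>i\<in>I. g (h i))" for I and h :: "'t \<Rightarrow> 't \<Rightarrow>\<^sub>0 complex"
    by (induction I rule: infinite_finite_induct) (simp_all add: g0 gadd)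
  define f where "f s = g (Poly_Mapping.single s 1)" for s
  have gf: "g z = cpair f z" for z
  proof -
    have "g z = g (clinear_extend (\<lambda>s. Poly_Mapping.single s 1) z)" by (simp only: clinear_extend_ident)
    also have "\<dots> = cpair f z" by (simp only: clinear_extend_def gsum gsc cpair_def f_def)
    finally show ?thesis .
  qed
  have "g z = 0" if "z \<in> V.span B" for z
    using that
  proof (induction rule: V.span_induct_alt)
    case base then show ?case by (rule g0)
  next
    case (step c y z)
    have "y \<noteq> x" using step \<open>x \<notin> V.span B\<close> V.span_base by blast
    then show ?case using step g(2)[of y] by (simp add: gadd gsc)
  qed
  then have "cpair f (b s) = 0" if "s \<in> A" for s using that B(3) gf by (metis imageI subsetD)
  moreover have "cpair f x \<noteq> 0" using g(2)[of x] gf by simp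
  ultimately show ?thesis by blast
qed

definition is_boundary :: "'a topology \<Rightarrow> 'a complex_chain \<Rightarrow> bool" where
  "is_boundary S c \<longleftrightarrow> (\<exists>d. Poly_Mapping.keys d \<subseteq> singular_simplex_set 2 S \<and> c = complex_boundary 2 d)"

lemma complex_boundary_linear: "complex_boundary p (c + d) = complex_boundary p c + complex_boundary p d"
  "complex_boundary p (c - d) = complex_boundary p c - complex_boundary p d"
  "complex_boundary p (cscale a c) = cscale a (complex_boundary p c)" "complex_boundary p 0 = 0"
  "complex_boundary p (\<Sum>i\<in>I. f i) = (\<Sum>i\<in>I. complex_boundary p (f i))"
  by (simp_all add: complex_boundary_def clinear_extend_add clinear_extend_diff clinear_extend_cscale clinear_extend_sum)

lemma is_boundary_add:
  assumes "is_boundary S c" "is_boundary S d"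
  shows "is_boundary S (c + d)"
proof -
  obtain a b where "Poly_Mapping.keys a \<subseteq> singular_simplex_set 2 S" "c = complex_boundary 2 a"
    "Poly_Mapping.keys b \<subseteq> singular_simplex_set 2 S" "d = complex_boundary 2 b"
    using assms by (auto simp: is_boundary_def)
  then show ?thesis
    unfolding is_boundary_def using Poly_Mapping.keys_add[of a b]
    by (intro exI[of _ "a + b"]) (auto simp: complex_boundary_linear)
qed

lemma is_boundary_cscale:
  assumes "is_boundary S c"
  shows "is_boundary S (cscale a c)"
proof -
  obtain d where "Poly_Mapping.keys d \<subseteq> singular_simplex_set 2 S" "c = complex_boundary 2 d"
    using assms by (auto simp: is_boundary_def)
  then show ?thesis
    unfolding is_boundary_def using keys_cscale[of a d]
    by (intro exI[of _ "cscale a d"]) (auto simp: complex_boundary_linear)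
qed

lemma is_boundary_0: "is_boundary S 0"
  unfolding is_boundary_def by (rule exI[of _ 0]) (simp add: complex_boundary_linear)

lemma is_boundary_sum: "(\<And>i. i \<in> I \<Longrightarrow> is_boundary S (f i)) \<Longrightarrow> is_boundary S (\<Sum>i\<in>I. f i)"
  by (induction I rule: infinite_finite_induct) (simp_all add: is_boundary_add is_boundary_0)

context origami
begin

definition vtx :: "'g \<Rightarrow> ('g \<times> real \<times> real) set" where "vtx g = q (g, (1, 1))"

definition ccell :: "('g \<times> bool \<Rightarrow>\<^sub>0 complex) \<Rightarrow> ((nat \<Rightarrow> real) \<Rightarrow> ('g \<times> real \<times> real) set) \<Rightarrow>\<^sub>0 complex" where
  "ccell = clinear_extend (\<lambda>e. Poly_Mapping.single (edge e) 1)"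

lemma cchain_icell: "cchain (icell w) = ccell (cchain w)"
  by (simp add: icell_def ccell_def cchain_frag_extend)

lemma ccell_linear: "ccell (x + y) = ccell x + ccell y" "ccell (x - y) = ccell x - ccell y"
  "ccell (cscale a x) = cscale a (ccell x)" "ccell (\<Sum>i\<in>I. f i) = (\<Sum>i\<in>I. ccell (f i))" "ccell 0 = 0"
  by (simp_all add: ccell_def clinear_extend_add clinear_extend_diff clinear_extend_cscale clinear_extend_sum)

definition step :: "bool \<Rightarrow> 'g" where "step b = (if b then r else u)"

lemma step_in [simp]: "step b \<in> carrier G" by (simp add: step_def)

lemma edge_ends:
  assumes "g \<in> carrier G"
  shows "edge (g, b) (vertex 1) = vtx g" "edge (g, b) (vertex 0) = vtx (g \<otimes> inv (step b))"
  using q_glue(1)[of "g \<otimes> inv r" 1] q_glue(2)[of "g \<otimes> inv u" 1] assms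
  by (auto simp: edge_def vtx_def step_def m_assoc)

text \<open>The boundary of a cellular chain, as a combination of points of the surface. Points that are equal because of
  the gluing are identified here.\<close>

definition cell_boundary :: "('g \<times> bool \<Rightarrow>\<^sub>0 complex) \<Rightarrow> (('g \<times> real \<times> real) set \<Rightarrow>\<^sub>0 complex)" where
  "cell_boundary = clinear_extend (\<lambda>(g, b). Poly_Mapping.single (vtx g) 1 - Poly_Mapping.single (vtx (g \<otimes> inv (step b))) 1)"

definition cell_chains :: "('g \<times> bool \<Rightarrow>\<^sub>0 complex) set" where
  "cell_chains = {x. Poly_Mapping.keys x \<subseteq> carrier G \<times> UNIV}"

lemma complex_boundary_single: "complex_boundary 1 (Poly_Mapping.single \<sigma> 1)
   = Poly_Mapping.single (point_simplex (\<sigma> (vertex 1))) 1 - Poly_Mapping.single (point_simplex (\<sigma> (vertex 0))) 1"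
  using complex_boundary_cchain[of 1 "frag_of \<sigma>"] by (simp add: chain_boundary_1)

lemma complex_boundary_ccell:
  assumes "x \<in> cell_chains"
  shows "complex_boundary 1 (ccell x) = clinear_extend (\<lambda>v. Poly_Mapping.single (point_simplex v) 1) (cell_boundary x)"
proof -
  have "complex_boundary 1 (ccell x) = clinear_extend (\<lambda>e. complex_boundary 1 (Poly_Mapping.single (edge e) 1)) x"
    by (simp add: ccell_def complex_boundary_def clinear_extend_clinear_extend)
  also have "\<dots> = clinear_extend (\<lambda>v. Poly_Mapping.single (point_simplex v) 1) (cell_boundary x)"
    unfolding cell_boundary_def clinear_extend_clinear_extend complex_boundary_single
    by (rule clinear_extend_cong) (use assms in \<open>auto simp: cell_chains_def edge_ends clinear_extend_diff\<close>)
  finally show ?thesis .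
qed

lemma complex_boundary_ccell_eq_0_iff:
  assumes "x \<in> cell_chains"
  shows "complex_boundary 1 (ccell x) = 0 \<longleftrightarrow> cell_boundary x = 0"
proof
  assume 0: "complex_boundary 1 (ccell x) = 0"
  have "clinear_extend (\<lambda>s. Poly_Mapping.single (s (vertex 0)) 1)
      (clinear_extend (\<lambda>v. Poly_Mapping.single (point_simplex v) 1) (cell_boundary x)) = cell_boundary x"
    by (simp add: clinear_extend_clinear_extend clinear_extend_ident)
  then show "cell_boundary x = 0"
    using 0 by (simp add: complex_boundary_ccell[OF assms])
qed (simp add: complex_boundary_ccell[OF assms])

lemma singular_simplex_edge: "e \<in> carrier G \<times> UNIV \<Longrightarrow> singular_simplex 1 M (edge e)"
  by (auto simp: edge_def unit_square_def intro!: singular_simplex_seg)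

lemma ccell_in_chains:
  assumes "x \<in> cell_chains"
  shows "Poly_Mapping.keys (ccell x) \<subseteq> singular_simplex_set 1 M"
  unfolding ccell_def
  by (rule keys_clinear_extend) (use assms in \<open>auto simp: cell_chains_def singular_simplex_edge\<close>)

text \<open>The boundary of the square \<open>g\<close>: bottom, right, top and left side, in this order. The bottom and left side are the
  top and right side of neighbouring squares.\<close>

definition face :: "'g \<Rightarrow> ('g \<times> bool \<Rightarrow>\<^sub>0 int)" where
  "face g = frag_of (g \<otimes> inv u, True) + frag_of (g, False) - frag_of (g, True) - frag_of (g \<otimes> inv r, False)"

definition face_chains :: "('g \<times> bool \<Rightarrow>\<^sub>0 complex) set" where
  "face_chains = clinear_extend (\<lambda>g. cchain (face g)) ` {y. Poly_Mapping.keys y \<subseteq> carrier G}"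

lemma face_bounds:
  assumes g: "g \<in> carrier G"
  shows "icell (face g) \<approx> 0"
proof -
  have sq: "(0, 0) \<in> unit_square" "(0, 1) \<in> unit_square" "(1, 0) \<in> unit_square" "(1, 1) \<in> unit_square"
    by (auto simp: unit_square_def)
  have "frag_of (seg g (0, 0) (1, 1)) - frag_of (seg g (0, 0) (1, 1)) \<approx>
      (frag_of (seg g (0, 0) (1, 0)) + frag_of (seg g (1, 0) (1, 1))) - (frag_of (seg g (0, 0) (0, 1)) + frag_of (seg g (0, 1) (1, 1)))"
    by (rule homologous_rel_diff[OF triangle[OF g sq(1,3,4)] triangle[OF g sq(1,2,4)]])
  also have "(frag_of (seg g (0, 0) (1, 0)) + frag_of (seg g (1, 0) (1, 1))) - (frag_of (seg g (0, 0) (0, 1)) + frag_of (seg g (0, 1) (1, 1)))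
     = icell (face g)"
    by (simp add: face_def icell_simps left_side[OF g] bottom_side[OF g]) (simp add: edge_def)
  finally show ?thesis by (simp add: homologous_rel_sym)
qed

lemma is_boundary_cchain: "c \<approx> d \<Longrightarrow> is_boundary M (cchain c - cchain d)"
proof -
  assume "c \<approx> d"
  then obtain e where "singular_chain (Suc 1) M e" "chain_boundary (Suc 1) e = c - d"
    by (auto simp: homologous_rel_def singular_boundary)
  then have "Poly_Mapping.keys (cchain e) \<subseteq> singular_simplex_set 2 M" "complex_boundary 2 (cchain e) = cchain c - cchain d"
    by (simp_all add: singular_chain_def Suc_1 complex_boundary_cchain)
  then show ?thesis unfolding is_boundary_def by (intro exI[of _ "cchain e"]) simp
qed

lemma face_chain_bounds:
  assumes "x \<in> face_chains"
  shows "is_boundary M (ccell x)"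
proof -
  obtain y where y: "Poly_Mapping.keys y \<subseteq> carrier G" "x = clinear_extend (\<lambda>g. cchain (face g)) y"
    using assms by (auto simp: face_chains_def)
  have "is_boundary M (ccell (cchain (face g)))" if "g \<in> carrier G" for g
    using is_boundary_cchain[OF face_bounds[OF that]] by (simp add: cchain_icell)
  then show ?thesis
    unfolding y(2) clinear_extend_def ccell_linear using y(1) by (intro is_boundary_sum is_boundary_cscale) auto
qed

text \<open>On every square, the bilinear function that is \<open>0\<close> at the upper right corner and increases by \<open>f\<close> along the top
  and the right side and, because of the cocycle condition, along the bottom and the left side. On a common
  side of two squares the two functions differ by an integer.\<close>

definition primitive :: "('g \<times> bool \<Rightarrow> int) \<Rightarrow> 'g \<times> real \<times> real \<Rightarrow> real" where
  "primitive f = (\<lambda>(g, (x, y)). - (1 - x) * y * of_int (f (g, True)) - x * (1 - y) * of_int (f (g, False))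
       - (1 - x) * (1 - y) * of_int (f (g, True) + f (g \<otimes> inv r, False)))"

text \<open>The exponential \<open>E\<close> of the \<open>primitive\<close> is a well-defined nowhere vanishing function on the surface, and its
  increment along every side is the value of \<open>f\<close>. Increments vanish on boundaries.\<close>

lemma integral_cocycle_kills_boundaries:
  assumes cocycle: "\<And>g. g \<in> carrier G \<Longrightarrow> f (g \<otimes> inv u, True) + f (g, False) = f (g, True) + f (g \<otimes> inv r, False)"
    and x: "x \<in> cell_chains" and bd: "is_boundary M (ccell x)"
  shows "cpair (\<lambda>e. of_int (f e)) x = 0"
proof -
  define E where "E = descend (\<lambda>p. exp (2 * of_real pi * \<i> * of_real (primitive f p)))"
  have per: "exp (2 * of_real pi * \<i> * of_real s) = exp (2 * of_real pi * \<i> * of_real t)" if "s = t + of_int n" for s t :: real and n :: int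
    unfolding exp_eq using that by (intro exI[of _ n]) (simp add: algebra_simps)
  have glue: "exp (2 * of_real pi * \<i> * of_real (primitive f a)) = exp (2 * of_real pi * \<i> * of_real (primitive f b))"
    if "(a, b) \<in> origami_gluing G r u" for a b
    using that
  proof (cases rule: gluing_cases)
    case (right g y)
    then have "primitive f a = primitive f b + of_int (f (g \<otimes> r, True))"
      by (simp add: primitive_def m_assoc algebra_simps)
    then show ?thesis by (rule per)
  next
    case (top g x)
    have "f (g, True) + f (g \<otimes> u, False) = f (g \<otimes> u, True) + f (g \<otimes> u \<otimes> inv r, False)"
      using cocycle[of "g \<otimes> u"] top by (simp add: m_assoc)
    then have "primitive f b = - x * of_int (f (g \<otimes> u, False)) - (1 - x) * of_int (f (g, True) + f (g \<otimes> u, False))"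
      using top by (simp add: primitive_def)
    then have "primitive f a = primitive f b + of_int (f (g \<otimes> u, False))"
      using top by (simp add: primitive_def algebra_simps)
    then show ?thesis by (rule per)
  qed
  have E: "E (q p) = exp (2 * of_real pi * \<i> * of_real (primitive f p))" for p
    unfolding E_def by (rule descend_q[OF glue])
  have contE: "continuous_map M euclidean E"
    unfolding E_def
  proof (rule continuous_map_descend[OF glue])
    fix g
    show "continuous_map (top_of_set ({0..1} \<times> {0..1})) euclidean (\<lambda>p. exp (2 * of_real pi * \<i> * complex_of_real (primitive f (g, p))))"
      unfolding primitive_def case_prod_unfold by (auto intro!: continuous_intros)
  qed
  have nz: "E c \<noteq> 0" if "c \<in> topspace M" for c
    using that E by (auto simp: topspace_origami)
  have "winding_increment E (edge e) = of_int (f e)" for e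
  proof -
    have "continuous_map (subtopology (powertop_real UNIV) (standard_simplex 1)) euclideanreal (\<lambda>t. t 1)"
      by (intro continuous_map_from_subtopology continuous_map_product_projection) auto
    then have "continuous_map (subtopology (powertop_real UNIV) (standard_simplex 1)) euclidean
        ((\<lambda>s. complex_of_real (- (1 - s) * of_int (f e))) \<circ> (\<lambda>t. t 1))"
      by (rule continuous_map_compose) (auto intro!: continuous_intros)
    moreover have "E (edge e t) = exp (2 * of_real pi * \<i> * of_real (- (1 - t 1) * of_int (f e)))" if "t \<in> standard_simplex 1" for t
    proof -
      have "t 0 = 1 - t 1" using that by (auto simp: standard_simplex_def atMost_1_2)
      then have "edge e t = q (fst e, if snd e then (t 1, 1) else (1, t 1))"
        using that by (simp add: edge_def seg_apply)
      moreover have "primitive f (fst e, if snd e then (t 1, 1) else (1, t 1)) = - (1 - t 1) * of_int (f e)"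
        by (cases e) (auto simp: primitive_def algebra_simps)
      ultimately show ?thesis by (simp only: E)
    qed
    ultimately have "log_lift 1 E (edge e) (\<lambda>t. of_real (- (1 - t 1) * of_int (f e)))"
      by (simp add: log_lift_def o_def)
    from winding_increment_eq[OF this] show ?thesis by (simp add: vertex_def)
  qed
  moreover have "cpair (winding_increment E) (ccell x) = 0"
    using bd winding_increment_complex_boundary[OF _ contE nz] by (auto simp: is_boundary_def)
  ultimately show ?thesis
    by (simp add: ccell_def cpair_clinear_extend)
qed

text \<open>The values of \<open>f\<close> are integral combinations of numbers \<open>e i\<close> without integral relations, so every coefficient is
  an integral cocycle.\<close>

lemma cocycle_kills_boundaries:
  assumes cocycle: "\<And>g. g \<in> carrier G \<Longrightarrow> cpair f (cchain (face g)) = 0"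
    and x: "x \<in> cell_chains" and bd: "is_boundary M (ccell x)"
  shows "cpair f x = 0"
proof -
  have fin: "finite (f ` (carrier G \<times> UNIV))" using finite_G by simp
  obtain n e m where em: "\<And>a. a \<in> f ` (carrier G \<times> UNIV) \<Longrightarrow> a = (\<Sum>i<n. of_int (m a i) * e i)"
    and ind: "\<And>k :: nat \<Rightarrow> int. (\<Sum>i<n. of_int (k i) * e i) = 0 \<Longrightarrow> \<forall>i<n. k i = 0"
    by (rule integral_basis[OF fin]) (rule that)
  have f: "f c = (\<Sum>i<n. of_int (m (f c) i) * e i)" if "c \<in> carrier G \<times> UNIV" for c
    using em that by blast
  define F where "F c = (\<Sum>i<n. of_int (m (f c) i) * e i)" for c
  have fF: "F c = f c" if "c \<in> carrier G \<times> UNIV" for c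
    using f[OF that] by (simp add: F_def)
  have "cpair (\<lambda>c. of_int (m (f c) i)) x = 0" if i: "i < n" for i
  proof (rule integral_cocycle_kills_boundaries[OF _ x bd])
    fix g assume g: "g \<in> carrier G"
    let ?k = "\<lambda>i. m (f (g \<otimes> inv u, True)) i + m (f (g, False)) i - m (f (g, True)) i - m (f (g \<otimes> inv r, False)) i"
    have "(\<Sum>i<n. of_int (?k i) * e i) = F (g \<otimes> inv u, True) + F (g, False) - F (g, True) - F (g \<otimes> inv r, False)"
      by (simp add: F_def sum.distrib sum_subtractf distrib_right left_diff_distrib)
    also have "\<dots> = f (g \<otimes> inv u, True) + f (g, False) - f (g, True) - f (g \<otimes> inv r, False)"
      using g by (simp add: fF)
    also have "\<dots> = 0"
      using cocycle[OF g] by (simp add: face_def cpair_add cpair_diff)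
    finally have "?k i = 0" using ind[of ?k] i by blast
    then show "m (f (g \<otimes> inv u, True)) i + m (f (g, False)) i = m (f (g, True)) i + m (f (g \<otimes> inv r, False)) i"
      by simp
  qed
  moreover have "cpair f x = (\<Sum>i<n. e i * cpair (\<lambda>c. of_int (m (f c) i)) x)"
  proof -
    have dist: "a * (\<Sum>i<n. of_int (k i) * e i) = (\<Sum>i<n. e i * (a * of_int (k i)))" for a and k :: "nat \<Rightarrow> int"
      unfolding sum_distrib_left by (rule sum.cong) (simp_all add: mult.left_commute mult.commute)
    have "cpair f x = (\<Sum>c\<in>Poly_Mapping.keys x. \<Sum>i<n. e i * (Poly_Mapping.lookup x c * of_int (m (f c) i)))"
      unfolding cpair_def
    proof (rule sum.cong)
      fix c assume "c \<in> Poly_Mapping.keys x"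
      then have "c \<in> carrier G \<times> UNIV" using x by (auto simp: cell_chains_def)
      then show "Poly_Mapping.lookup x c * f c = (\<Sum>i<n. e i * (Poly_Mapping.lookup x c * of_int (m (f c) i)))"
        unfolding dist[symmetric] by (rule arg_cong[OF f, of _ "(*) (Poly_Mapping.lookup x c)"])
    qed simp
    then show ?thesis
      by (simp add: cpair_def sum_distrib_left sum.swap[of _ _ "{..<n}"])
  qed
  ultimately show ?thesis by simp
qed

text \<open>A cellular chain outside the span of the faces is detected by a cochain that vanishes on the faces, and such a
  cochain vanishes on chains that bound.\<close>

theorem ccell_bounds_iff:
  assumes "x \<in> cell_chains"
  shows "is_boundary M (ccell x) \<longleftrightarrow> x \<in> face_chains"
proof
  assume bd: "is_boundary M (ccell x)"
  show "x \<in> face_chains"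
  proof (rule ccontr)
    assume "x \<notin> face_chains"
    then have ex: "x \<noteq> clinear_extend (\<lambda>g. cchain (face g)) y" if "Poly_Mapping.keys y \<subseteq> carrier G" for y
      using that by (auto simp: face_chains_def)
    obtain f where "\<And>g. g \<in> carrier G \<Longrightarrow> cpair f (cchain (face g)) = 0" "cpair f x \<noteq> 0"
      using functional_separates[of "carrier G" x "\<lambda>g. cchain (face g)", OF ex] by blast
    then show False using cocycle_kills_boundaries[OF _ assms bd] by blast
  qed
qed (rule face_chain_bounds)

theorem cycle_homologous_cellular:
  assumes c: "Poly_Mapping.keys c \<subseteq> singular_simplex_set 1 M" and z: "complex_boundary 1 c = 0"
  obtains x where "x \<in> cell_chains" "cell_boundary x = 0" "is_boundary M (c - ccell x)"
proof -
  obtain n e C where c_eq: "c = (\<Sum>i<n. cscale (e i) (cchain (C i)))"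
    and keys: "\<And>i. Poly_Mapping.keys (C i) \<subseteq> Poly_Mapping.keys c"
    and ind: "\<And>k :: nat \<Rightarrow> int. (\<Sum>i<n. of_int (k i) * e i) = 0 \<Longrightarrow> \<forall>i<n. k i = 0"
    by (rule chain_integral_basis[of c]) (rule that)
  have "(\<Sum>i<n. cscale (e i) (cchain (chain_boundary 1 (C i)))) = complex_boundary 1 c"
    unfolding c_eq by (simp add: complex_boundary_linear complex_boundary_cchain)
  then have "chain_boundary 1 (C i) = 0" if "i < n" for i
    by (intro integral_independent_chains[where C = "\<lambda>i. chain_boundary 1 (C i)", OF _ ind \<open>i < n\<close>]) (simp_all add: z)
  then have cyc: "singular_relcycle 1 M {} (C i)" if "i < n" for i
    using that keys[of i] c by (auto simp: singular_cycle singular_chain_def)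
  have "\<forall>i\<in>{..<n}. \<exists>w. Poly_Mapping.keys w \<subseteq> carrier G \<times> UNIV \<and> C i \<approx> icell w"
    using cyc integral_cycle_cellular by (metis lessThan_iff)
  from bchoice[OF this] obtain w where w: "\<And>i. i < n \<Longrightarrow> Poly_Mapping.keys (w i) \<subseteq> carrier G \<times> UNIV" "\<And>i. i < n \<Longrightarrow> C i \<approx> icell (w i)"
    by auto
  define x where "x = (\<Sum>i<n. cscale (e i) (cchain (w i)))"
  have x: "x \<in> cell_chains"
    unfolding cell_chains_def x_def mem_Collect_eq
    by (intro order_trans[OF keys_sum_subset_UN] UN_least order_trans[OF keys_cscale]) (use w(1) in auto)
  have "c - ccell x = (\<Sum>i<n. cscale (e i) (cchain (C i) - cchain (icell (w i))))"
    by (simp add: c_eq x_def ccell_linear cchain_icell cscale_diff_right sum_subtractf)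
  then have bd: "is_boundary M (c - ccell x)"
    using is_boundary_cchain[OF w(2)] by (auto intro!: is_boundary_sum is_boundary_cscale)
  then obtain d where d: "Poly_Mapping.keys d \<subseteq> singular_simplex_set 2 M" "c - ccell x = complex_boundary 2 d"
    by (auto simp: is_boundary_def)
  have "complex_boundary 1 (complex_boundary 2 d) = 0"
  proof -
    have "complex_boundary 1 (cchain (chain_boundary 2 (frag_of s))) = 0" if "s \<in> Poly_Mapping.keys d" for s
    proof -
      have "singular_chain (Suc 1) M (frag_of s)" using that d(1) by (auto simp: singular_chain_of Suc_1)
      from chain_boundary_boundary_alt[OF this] show ?thesis by (simp add: complex_boundary_cchain Suc_1)
    qed
    then have "complex_boundary 1 (complex_boundary 2 d) = clinear_extend (\<lambda>s. 0) d"
      unfolding complex_boundary_def[of 2] unfolding complex_boundary_def clinear_extend_clinear_extend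
      by (intro clinear_extend_cong)
    then show ?thesis by (simp add: clinear_extend_def)
  qed
  then have "complex_boundary 1 (ccell x) = 0"
    using d(2) z complex_boundary_linear(2)[of 1 c "ccell x"] by simp
  then have "cell_boundary x = 0" using complex_boundary_ccell_eq_0_iff[OF x] by simp
  then show ?thesis using that x bd by blast
qed

end

section \<open>The covering of the torus and the group action\<close>

text \<open>The coefficient sum over the top sides (\<open>True\<close>) or the right sides (\<open>False\<close>). All top sides have the same image
  in the torus, and so have all right sides.\<close>

definition side_sum :: "bool \<Rightarrow> ('g \<times> bool \<Rightarrow>\<^sub>0 complex) \<Rightarrow> complex" where
  "side_sum b = cpair (\<lambda>e. if snd e = b then 1 else 0)"

lemma clinear_extend_two_valued:
  "clinear_extend (\<lambda>e. P (snd e)) x = cscale (side_sum True x) (P True) + cscale (side_sum False x) (P False)"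
proof -
  have "cscale (Poly_Mapping.lookup x e) (P (snd e))
      = cscale (Poly_Mapping.lookup x e * (if snd e = True then 1 else 0)) (P True)
        + cscale (Poly_Mapping.lookup x e * (if snd e = False then 1 else 0)) (P False)" for e
    by (cases "snd e") simp_all
  then show ?thesis
    by (simp only: clinear_extend_def side_sum_def cpair_def cscale_sum_left sum.distrib)
qed

subsection \<open>The torus\<close>

lemma quotient_map_torus: "quotient_map euclidean torus torus_class"
  unfolding torus_def by (rule quotient_map_quotient_topology)

lemma torus_class_eq:
  assumes "fst p - fst p' \<in> \<int>" "snd p - snd p' \<in> \<int>"
  shows "torus_class p = torus_class p'"
proof -
  have "z - fst p \<in> \<int> \<longleftrightarrow> z - fst p' \<in> \<int>" for z
    using Ints_add[OF _ assms(1), of "z - fst p"] Ints_diff[OF _ assms(1), of "z - fst p'"] by auto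
  moreover have "z - snd p \<in> \<int> \<longleftrightarrow> z - snd p' \<in> \<int>" for z
    using Ints_add[OF _ assms(2), of "z - snd p"] Ints_diff[OF _ assms(2), of "z - snd p'"] by auto
  ultimately show ?thesis by (simp add: torus_class_def)
qed

definition torus_path :: "bool \<Rightarrow> (nat \<Rightarrow> real) \<Rightarrow> (real \<times> real) set" where
  "torus_path b = restrict (\<lambda>t. torus_class (if b then (t 1, 1) else (1, t 1))) (standard_simplex 1)"

definition torus_coordinate :: "bool \<Rightarrow> (real \<times> real) set \<Rightarrow> complex" where
  "torus_coordinate b c = exp (2 * of_real pi * \<i> * of_real ((if b then fst else snd) (SOME p. p \<in> c)))"

lemma torus_coordinate_class:
  "torus_coordinate b (torus_class p) = exp (2 * of_real pi * \<i> * of_real ((if b then fst else snd) p))"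
proof -
  define p' where "p' = (SOME p'. p' \<in> torus_class p)"
  have "p' \<in> torus_class p"
    unfolding p'_def by (rule someI[of _ p]) (simp add: torus_class_def)
  then have "(if b then fst else snd) p' - (if b then fst else snd) p \<in> \<int>"
    by (simp add: torus_class_def)
  then obtain n :: int where "(if b then fst else snd) p' - (if b then fst else snd) p = of_int n"
    by (rule Ints_cases)
  then have "(if b then fst else snd) p' = (if b then fst else snd) p + of_int n" by simp
  then show ?thesis
    unfolding torus_coordinate_def exp_eq p'_def[symmetric]
    by (intro exI[of _ n]) (simp only: of_real_add of_real_of_int_eq, simp add: algebra_simps)
qed

lemma continuous_map_torus_coordinate: "continuous_map torus euclidean (torus_coordinate b)"
proof (rule continuous_compose_quotient_map[OF quotient_map_torus])
  have "continuous_on UNIV (\<lambda>p. exp (2 * of_real pi * \<i> * complex_of_real ((if b then fst else snd) p)))"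
    by (cases b) (auto intro!: continuous_intros)
  then show "continuous_map euclidean euclidean (torus_coordinate b \<circ> torus_class)"
    by (simp add: o_def torus_coordinate_class)
qed

text \<open>The two loops are distinguished by the winding numbers of the two coordinates, which is why no nontrivial
  combination of them bounds.\<close>

lemma winding_torus_path: "winding_increment (torus_coordinate b) (torus_path b') = (if b = b' then 1 else 0)"
proof -
  have "continuous_map (subtopology (powertop_real UNIV) (standard_simplex 1)) euclideanreal (\<lambda>t. t 1)"
    by (intro continuous_map_from_subtopology continuous_map_product_projection) auto
  then have 1: "continuous_map (subtopology (powertop_real UNIV) (standard_simplex 1)) euclidean
      ((\<lambda>s. complex_of_real (if b = b' then s else 1)) \<circ> (\<lambda>t. t 1))"
    by (rule continuous_map_compose) (cases "b = b'"; auto intro!: continuous_intros)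
  then have "log_lift 1 (torus_coordinate b) (torus_path b') (\<lambda>t. of_real (if b = b' then t 1 else 1))"
    by (auto simp: log_lift_def o_def torus_path_def torus_coordinate_class)
  from winding_increment_eq[OF this] show ?thesis by (simp add: vertex_def)
qed

lemma torus_cycle_bounds_iff:
  "is_boundary torus (Poly_Mapping.single (torus_path True) a + Poly_Mapping.single (torus_path False) b) \<longleftrightarrow> a = 0 \<and> b = 0"
proof
  let ?c = "Poly_Mapping.single (torus_path True) a + Poly_Mapping.single (torus_path False) b"
  assume bd: "is_boundary torus ?c"
  have "cpair (winding_increment (torus_coordinate k)) ?c = 0" for k
    using bd winding_increment_complex_boundary[OF _ continuous_map_torus_coordinate]
    by (force simp: is_boundary_def torus_coordinate_def)
  from this[of True] this[of False] show "a = 0 \<and> b = 0"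
    by (simp add: cpair_add winding_torus_path)
qed (simp add: is_boundary_0)

context origami
begin

lemma covering_q: "origami_covering (q p) = torus_class (snd p)"
proof -
  have "torus_class (snd p') = torus_class (snd p)" if "p' \<in> q p" for p'
    by (rule q_invariant[OF _ that]) (auto elim!: gluing_cases intro!: torus_class_eq)
  then show ?thesis
    unfolding origami_covering_def using mem_q_self by blast
qed

lemma continuous_map_covering: "continuous_map M torus origami_covering"
proof (rule continuous_compose_quotient_map[OF quotient_map_q])
  have "continuous_map (top_of_set ({0..1} \<times> {0..1})) torus torus_class"
    by (intro continuous_map_from_subtopology quotient_imp_continuous_map quotient_map_torus)
  then have "continuous_map Sq torus (\<lambda>p. torus_class (snd p))"
    unfolding origami_squares_def by (intro continuous_map_discrete_prod) simp
  then show "continuous_map Sq torus (origami_covering \<circ> q)"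
    by (simp add: o_def covering_q)
qed

lemma edge_apply:
  assumes "t \<in> standard_simplex 1"
  shows "edge e t = q (fst e, if snd e then (t 1, 1) else (1, t 1))"
proof -
  have "t 0 = 1 - t 1" using assms by (auto simp: standard_simplex_def atMost_1_2)
  then show ?thesis using assms by (simp add: edge_def seg_apply)
qed

lemma complex_chain_map_ccell: "complex_chain_map 1 f (ccell x) = clinear_extend (\<lambda>e. Poly_Mapping.single (simplex_map 1 f (edge e)) 1) x"
  by (simp add: complex_chain_map_def ccell_def clinear_extend_clinear_extend)

lemma covering_ccell:
  "complex_chain_map 1 origami_covering (ccell x)
     = Poly_Mapping.single (torus_path True) (side_sum True x) + Poly_Mapping.single (torus_path False) (side_sum False x)"
proof -
  have "simplex_map 1 origami_covering (edge e) = torus_path (snd e)" for e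
  proof
    fix t
    have "t 0 = 1 - t 1" if "t \<in> standard_simplex 1" using that by (auto simp: standard_simplex_def atMost_1_2)
    then show "simplex_map 1 origami_covering (edge e) t = torus_path (snd e) t"
      by (cases "snd e") (auto simp: simplex_map_def torus_path_def restrict_def edge_def seg_apply covering_q)
  qed
  then show ?thesis
    using clinear_extend_two_valued[of "\<lambda>b. Poly_Mapping.single (torus_path b) 1" x]
    by (simp add: complex_chain_map_ccell)
qed

subsection \<open>The action of the group\<close>

lemma aut_q:
  assumes h: "h \<in> carrier G" and p: "p \<in> topspace Sq"
  shows "origami_aut G h (q p) = q (h \<otimes> fst p, snd p)"
proof -
  have sub: "(h \<otimes> fst p', snd p') \<in> q (h \<otimes> fst p, snd p)"
    if h: "h \<in> carrier G" and p': "p' \<in> q p" for h p p'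
  proof -
    have "q (h \<otimes> fst p', snd p') = q (h \<otimes> fst p, snd p)"
    proof (rule q_invariant[OF _ p'])
      fix a b assume "(a, b) \<in> origami_gluing G r u"
      then show "q (h \<otimes> fst a, snd a) = q (h \<otimes> fst b, snd b)"
        by (cases rule: gluing_cases) (auto simp: h q_glue m_assoc)
    qed
    then show ?thesis using mem_q_self by metis
  qed
  show ?thesis
  proof (intro equalityI subsetI)
    fix z assume "z \<in> origami_aut G h (q p)"
    then obtain p' where p': "p' \<in> q p" "z = (h \<otimes> fst p', snd p')"
      unfolding origami_aut_def case_prod_unfold by blast
    show "z \<in> q (h \<otimes> fst p, snd p)" unfolding p'(2) by (rule sub[OF h p'(1)])
  next
    fix z assume z: "z \<in> q (h \<otimes> fst p, snd p)"
    have "(h \<otimes> fst p, snd p) \<in> topspace Sq" using p h by (auto simp: topspace_squares)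
    then have "z \<in> topspace Sq" using z q_subset_squares by blast
    then have zc: "fst z \<in> carrier G" by (auto simp: topspace_squares)
    have "(inv h \<otimes> fst z, snd z) \<in> q p"
      using sub[OF inv_closed[OF h] z] h p by (auto simp: topspace_squares m_assoc[symmetric])
    moreover have "z = (h \<otimes> (inv h \<otimes> fst z), snd z)" using h zc by (simp add: m_assoc[symmetric])
    ultimately show "z \<in> origami_aut G h (q p)"
      unfolding origami_aut_def by (metis (mono_tags, lifting) case_prod_conv image_eqI)
  qed
qed

lemma continuous_map_aut:
  assumes h: "h \<in> carrier G"
  shows "continuous_map M M (origami_aut G h)"
proof (rule continuous_compose_quotient_map[OF quotient_map_q])
  have "continuous_map Sq M (\<lambda>p. q (h \<otimes> fst p, snd p))"
    unfolding origami_squares_def using h by (intro continuous_map_discrete_prod) (simp add: continuous_map_square)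
  then show "continuous_map Sq M (origami_aut G h \<circ> q)"
    by (rule continuous_map_eq) (simp add: aut_q[OF h])
qed

text \<open>The automorphism \<open>h\<close> on cellular chains.\<close>

definition shift :: "'g \<Rightarrow> ('g \<times> bool \<Rightarrow>\<^sub>0 complex) \<Rightarrow> ('g \<times> bool \<Rightarrow>\<^sub>0 complex)" where
  "shift h = clinear_extend (\<lambda>e. Poly_Mapping.single (h \<otimes> fst e, snd e) 1)"

lemma aut_ccell:
  assumes h: "h \<in> carrier G" and x: "x \<in> cell_chains"
  shows "complex_chain_map 1 (origami_aut G h) (ccell x) = ccell (shift h x)"
proof -
  have "simplex_map 1 (origami_aut G h) (edge e) = edge (h \<otimes> fst e, snd e)" if e: "e \<in> carrier G \<times> UNIV" for e
  proof
    fix t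
    show "simplex_map 1 (origami_aut G h) (edge e) t = edge (h \<otimes> fst e, snd e) t"
    proof (cases "t \<in> standard_simplex 1")
      case True
      then have "t 1 \<in> {0..1}" by (auto simp: standard_simplex_def)
      then have "(fst e, if snd e then (t 1, 1) else (1, t 1)) \<in> topspace Sq"
        using e by (auto simp: topspace_squares)
      from aut_q[OF h this] show ?thesis using True by (simp add: simplex_map_def edge_apply)
    qed (simp add: simplex_map_def edge_def flat_def)
  qed
  then show ?thesis
    unfolding complex_chain_map_ccell unfolding ccell_def shift_def clinear_extend_clinear_extend
    using x by (intro clinear_extend_cong) (auto simp: cell_chains_def)
qed

subsection \<open>Vertices\<close>

abbreviation "commutator \<equiv> r \<otimes> u \<otimes> inv r \<otimes> inv u"

text \<open>Go around the vertex: right, up, left and down.\<close>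

lemma vtx_commutator:
  assumes g: "g \<in> carrier G"
  shows "vtx (g \<otimes> commutator) = vtx g"
proof -
  have "vtx g = q (g \<otimes> r \<otimes> u, (0, 0))"
    using q_glue(1)[of g 1] q_glue(2)[of "g \<otimes> r" 0] g by (simp add: vtx_def)
  also have "\<dots> = q (g \<otimes> r \<otimes> u \<otimes> inv r, (1, 0))"
    using q_glue(1)[of "g \<otimes> r \<otimes> u \<otimes> inv r" 0] g by (simp add: m_assoc)
  also have "\<dots> = q (g \<otimes> r \<otimes> u \<otimes> inv r \<otimes> inv u, (1, 1))"
    using q_glue(2)[of "g \<otimes> r \<otimes> u \<otimes> inv r \<otimes> inv u" 1] g by (simp add: m_assoc)
  finally show ?thesis using g by (simp add: vtx_def m_assoc)
qed

text \<open>The map from corners of squares to cosets of the group generated by the commutator that sends the upper right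
  corner of the square \<open>g\<close> to the coset of \<open>g\<close> respects the gluing. Hence corners that are glued together have the
  same coset.\<close>

lemma vtx_eq_iff:
  assumes g: "g \<in> carrier G" and g': "g' \<in> carrier G"
  shows "vtx g = vtx g' \<longleftrightarrow> (\<exists>s\<in>generate G {commutator}. g' = g \<otimes> s)"
proof
  have gen: "generate G {commutator} \<subseteq> carrier G" by (rule generate_incl) simp
  assume "\<exists>s\<in>generate G {commutator}. g' = g \<otimes> s"
  then obtain s where s: "s \<in> generate G {commutator}" and g's: "g' = g \<otimes> s" by auto
  have "\<forall>g\<in>carrier G. vtx (g \<otimes> s) = vtx g"
    using s
  proof (induction rule: generate.induct)
    case one
    then show ?case by simp
  next
    case (incl h)
    then show ?case using vtx_commutator by simp
  next
    case (inv h)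
    show ?case
    proof
      fix g assume g: "g \<in> carrier G"
      have "g \<otimes> inv d \<otimes> d = g" if "d \<in> carrier G" for d using g that by (simp add: m_assoc)
      then have "g \<otimes> inv commutator \<otimes> commutator = g" by simp
      then show "vtx (g \<otimes> inv h) = vtx g"
        using vtx_commutator[of "g \<otimes> inv commutator"] g inv by simp
    qed
  next
    case (eng a b)
    then have "a \<in> carrier G" "b \<in> carrier G" using gen by auto
    then show ?case using eng by (simp add: m_assoc[symmetric])
  qed
  then show "vtx g = vtx g'" using g g's by simp
next
  assume eq: "vtx g = vtx g'"
  define cos where "cos k = (\<lambda>s. k \<otimes> s) ` generate G {commutator}" for k
  have "generate G {commutator} \<subseteq> carrier G" by (rule generate_incl) simp
  then have gen: "s \<in> carrier G" if "s \<in> generate G {commutator}" for s using that by blast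
  have cos_c: "cos (k \<otimes> commutator) = cos k" if k: "k \<in> carrier G" for k
  proof -
    have assoc: "k \<otimes> commutator \<otimes> s = k \<otimes> (commutator \<otimes> s)" if "s \<in> generate G {commutator}" for s
      by (rule m_assoc) (use k gen[OF that] in simp_all)
    have "cos (k \<otimes> commutator) = (\<lambda>s. k \<otimes> s) ` ((\<lambda>s. commutator \<otimes> s) ` generate G {commutator})"
      unfolding cos_def image_image by (rule image_cong[OF refl assoc])
    also have "(\<lambda>s. commutator \<otimes> s) ` generate G {commutator} = generate G {commutator}"
    proof (intro equalityI subsetI)
      fix s assume s: "s \<in> generate G {commutator}"
      have "inv commutator \<otimes> s \<in> generate G {commutator}" by (intro generate.eng generate.inv s) simp
      moreover have "s = commutator \<otimes> (inv commutator \<otimes> s)" using gen[OF s] inv_solve_left'[of s commutator]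
        by (metis m_assoc m_closed inv_closed r_inv l_one r_in u_in)
      ultimately show "s \<in> (\<lambda>s. commutator \<otimes> s) ` generate G {commutator}" by blast
    next
      fix s assume "s \<in> (\<lambda>s. commutator \<otimes> s) ` generate G {commutator}"
      then obtain s' where "s' \<in> generate G {commutator}" "s = commutator \<otimes> s'" by blast
      moreover have "commutator \<in> generate G {commutator}" by (rule generate.incl) simp
      ultimately show "s \<in> generate G {commutator}" by (simp only: generate.eng)
    qed
    finally show ?thesis by (simp add: cos_def)
  qed
  \<comment> \<open>the other corners of the square \<open>g\<close> are upper right corners of its neighbours; points other than corners get the
    empty set\<close>
  let ?F = "\<lambda>(g, p). if p = (1, 1) then cos g else if p = (0, 1) then cos (g \<otimes> inv r)
     else if p = (1, 0) then cos (g \<otimes> inv u) else if p = (0 :: real, 0 :: real) then cos (g \<otimes> inv r \<otimes> inv u) else ({} :: 'g set)"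
  have "?F (g, (1, 1)) = ?F (g', (1, 1))"
  proof (rule q_eq_invariant[where F = ?F, OF _ eq[unfolded vtx_def]])
    fix a b assume "(a, b) \<in> origami_gluing G r u"
    then show "?F a = ?F b"
    proof (cases rule: gluing_cases)
      case (right g y)
      then show ?thesis by (auto simp: m_assoc)
    next
      case (top g x)
      have cancel: "g \<otimes> inv r \<otimes> commutator = g \<otimes> u \<otimes> inv r \<otimes> inv u"
        using top by (simp add: m_assoc) (simp add: m_assoc[symmetric])
      have "cos (g \<otimes> u \<otimes> inv r \<otimes> inv u) = cos (g \<otimes> inv r)"
        using cos_c[of "g \<otimes> inv r", unfolded cancel] top(1) by simp
      moreover have "g \<otimes> u \<otimes> inv u = g" using top(1) by (simp add: m_assoc)
      ultimately show ?thesis unfolding top(3,4) by simp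
    qed
  qed
  then have "cos g' = cos g" by simp
  moreover have "g' \<in> cos g'" unfolding cos_def using g' by (intro image_eqI[of _ _ \<one>] generate.one) auto
  ultimately show "\<exists>s\<in>generate G {commutator}. g' = g \<otimes> s" by (auto simp: cos_def)
qed

end

section \<open>The homology modules by representatives\<close>

lemma is_boundary_minus: "is_boundary S c \<Longrightarrow> is_boundary S (- c)"
proof -
  assume "is_boundary S c"
  then have "is_boundary S (cscale (-1) c)" by (rule is_boundary_cscale)
  moreover have "cscale (-1) c = - c" by (auto intro!: poly_mapping_eqI)
  ultimately show ?thesis by simp
qed

lemma is_boundary_diff: "is_boundary S c \<Longrightarrow> is_boundary S d \<Longrightarrow> is_boundary S (c - d)"
  using is_boundary_add[OF _ is_boundary_minus] by fastforce

definition is_cycle :: "'a topology \<Rightarrow> 'a complex_chain \<Rightarrow> bool" where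
  "is_cycle S c \<longleftrightarrow> Poly_Mapping.keys c \<subseteq> singular_simplex_set 1 S \<and> complex_boundary 1 c = 0"

definition homology_class :: "'a topology \<Rightarrow> 'a complex_chain \<Rightarrow> 'a complex_chain set" where
  "homology_class S c = {d. is_boundary S (d - c)}"

lemma complex_boundaries_eq: "complex_boundaries 1 S = Collect (is_boundary S)"
proof -
  have "complex_boundaries 1 S = complex_boundary 2 ` {c. Poly_Mapping.keys c \<subseteq> singular_simplex_set 2 S}"
    by (simp add: complex_boundaries_def complex_chain_module_def Suc_1)
  then show ?thesis unfolding is_boundary_def by blast
qed

lemma cycle_module_simps:
  "carrier (complex_cycle_module 1 S) = Collect (is_cycle S)" "add (complex_cycle_module 1 S) = (+)"
  "module.smult (complex_cycle_module 1 S) = cscale"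
  by (auto simp: complex_cycle_module_def complex_chain_module_def is_cycle_def)

lemma cycle_coset: "a_r_coset (complex_cycle_module 1 S) (complex_boundaries 1 S) c = homology_class S c"
proof -
  have "is_boundary S (d - c) \<longleftrightarrow> (\<exists>b. is_boundary S b \<and> d = b + c)" for d
    by (metis diff_add_cancel add_diff_cancel_right')
  then show ?thesis
    by (auto simp: a_r_coset_def' cycle_module_simps complex_boundaries_eq homology_class_def)
qed

lemma homology_class_eq_iff: "homology_class S c = homology_class S d \<longleftrightarrow> is_boundary S (c - d)"
proof
  assume "homology_class S c = homology_class S d"
  moreover have "c \<in> homology_class S c" by (simp add: homology_class_def is_boundary_0)
  ultimately have "c \<in> homology_class S d" by simp
  then show "is_boundary S (c - d)" by (simp add: homology_class_def)
next
  assume cd: "is_boundary S (c - d)"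
  have "is_boundary S (e - c) \<longleftrightarrow> is_boundary S (e - d)" for e
    using is_boundary_add[OF _ cd, of "e - c"] is_boundary_diff[OF _ cd, of "e - d"] by auto
  then show "homology_class S c = homology_class S d" by (simp add: homology_class_def)
qed

lemma homology_simps:
  "carrier (complex_homology 1 S) = homology_class S ` Collect (is_cycle S)"
  "\<zero>\<^bsub>complex_homology 1 S\<^esub> = homology_class S 0"
  "homology_class S c \<oplus>\<^bsub>complex_homology 1 S\<^esub> homology_class S d = homology_class S (c + d)"
  "a \<odot>\<^bsub>complex_homology 1 S\<^esub> homology_class S c = homology_class S (cscale a c)"
proof -
  show "carrier (complex_homology 1 S) = homology_class S ` Collect (is_cycle S)"
    by (auto simp: complex_homology_def quotient_module_def A_RCOSETS_def' cycle_coset cycle_module_simps)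
  show "\<zero>\<^bsub>complex_homology 1 S\<^esub> = homology_class S 0"
    by (simp add: complex_homology_def quotient_module_def homology_class_def complex_boundaries_eq)
  show "homology_class S c \<oplus>\<^bsub>complex_homology 1 S\<^esub> homology_class S d = homology_class S (c + d)"
  proof -
    have "homology_class S c \<oplus>\<^bsub>complex_homology 1 S\<^esub> homology_class S d
        = {v + w | v w. v \<in> homology_class S c \<and> w \<in> homology_class S d}"
      by (auto simp: complex_homology_def quotient_module_def set_add_def' cycle_module_simps)
    also have "\<dots> = homology_class S (c + d)"
    proof (intro equalityI subsetI)
      fix e assume "e \<in> {v + w | v w. v \<in> homology_class S c \<and> w \<in> homology_class S d}"
      then obtain v w where "is_boundary S (v - c)" "is_boundary S (w - d)" "e = v + w"
        by (auto simp: homology_class_def)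
      moreover have "v + w - (c + d) = (v - c) + (w - d)" by simp
      ultimately show "e \<in> homology_class S (c + d)"
        unfolding homology_class_def mem_Collect_eq by (simp only: is_boundary_add)
    next
      fix e assume "e \<in> homology_class S (c + d)"
      then have "is_boundary S ((e - d) - c)" by (simp add: homology_class_def algebra_simps)
      moreover have "e = (e - d) + d" by simp
      ultimately show "e \<in> {v + w | v w. v \<in> homology_class S c \<and> w \<in> homology_class S d}"
        unfolding homology_class_def mem_Collect_eq using is_boundary_0[of S] by (metis diff_self)
    qed
    finally show ?thesis .
  qed
  show "a \<odot>\<^bsub>complex_homology 1 S\<^esub> homology_class S c = homology_class S (cscale a c)"
  proof -
    have "homology_class S (cscale a d) = homology_class S (cscale a c)" if "d \<in> homology_class S c" for d
    proof -
      have "is_boundary S (cscale a (d - c))"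
        using that by (intro is_boundary_cscale) (simp add: homology_class_def)
      then show ?thesis unfolding homology_class_eq_iff by (simp add: cscale_diff_right)
    qed
    moreover have "c \<in> homology_class S c" by (simp add: homology_class_def is_boundary_0)
    ultimately have "(\<Union>d\<in>homology_class S c. homology_class S (cscale a d)) = homology_class S (cscale a c)"
      by blast
    then show ?thesis
      by (simp add: complex_homology_def quotient_module_def cycle_coset cycle_module_simps)
  qed
qed

lemma complex_chain_map_linear:
  "complex_chain_map p f (c + d) = complex_chain_map p f c + complex_chain_map p f d"
  "complex_chain_map p f (c - d) = complex_chain_map p f c - complex_chain_map p f d"
  by (simp_all add: complex_chain_map_def clinear_extend_add clinear_extend_diff)

lemma is_boundary_chain_map:
  assumes f: "continuous_map S T f" and c: "is_boundary S c"
  shows "is_boundary T (complex_chain_map 1 f c)"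
proof -
  obtain d where d: "Poly_Mapping.keys d \<subseteq> singular_simplex_set 2 S" "c = complex_boundary 2 d"
    using c by (auto simp: is_boundary_def)
  have "complex_chain_map (2 - 1) f (complex_boundary 2 d) = complex_boundary 2 (complex_chain_map 2 f d)"
    by (rule complex_chain_map_compose_boundary[OF d(1), symmetric])
  then have "complex_chain_map 1 f (complex_boundary 2 d) = complex_boundary 2 (complex_chain_map 2 f d)"
    by (metis Suc_1 diff_Suc_1)
  moreover have "Poly_Mapping.keys (complex_chain_map 2 f d) \<subseteq> singular_simplex_set 2 T"
    unfolding complex_chain_map_def
    by (rule keys_clinear_extend) (use d(1) singular_simplex_simplex_map[OF _ f] in auto)
  ultimately show ?thesis
    unfolding is_boundary_def d(2) by (intro exI[of _ "complex_chain_map 2 f d"]) simp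
qed

lemma hom_induced_class:
  assumes f: "continuous_map S T f" and c: "is_cycle S c"
  shows "complex_hom_induced 1 S T f (homology_class S c) = homology_class T (complex_chain_map 1 f c)"
proof -
  have "homology_class T (complex_chain_map 1 f d) = homology_class T (complex_chain_map 1 f c)"
    if "d \<in> homology_class S c" for d
    using is_boundary_chain_map[OF f, of "d - c"] that
    unfolding homology_class_eq_iff by (simp add: homology_class_def complex_chain_map_linear)
  moreover have "c \<in> homology_class S c" by (simp add: homology_class_def is_boundary_0)
  ultimately have "(\<Union>d\<in>homology_class S c. homology_class T (complex_chain_map 1 f d)) = homology_class T (complex_chain_map 1 f c)"
    by blast
  then show ?thesis
    using c by (simp add: complex_hom_induced_def homology_simps cycle_coset)
qed

context origami
begin

abbreviation "U \<equiv> origami_H10 G r u"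

text \<open>The cellular cycles whose image in the homology of the torus is \<open>0\<close>.\<close>

definition cycles0 :: "('g \<times> bool \<Rightarrow>\<^sub>0 complex) set" where
  "cycles0 = {x \<in> cell_chains. cell_boundary x = 0 \<and> side_sum True x = 0 \<and> side_sum False x = 0}"

definition \<Psi> :: "('g \<times> bool \<Rightarrow>\<^sub>0 complex) \<Rightarrow> ('g \<times> real \<times> real) set complex_chain set" where
  "\<Psi> x = homology_class M (ccell x)"

lemma is_cycle_ccell: "x \<in> cell_chains \<Longrightarrow> is_cycle M (ccell x) \<longleftrightarrow> cell_boundary x = 0"
  using ccell_in_chains complex_boundary_ccell_eq_0_iff by (simp add: is_cycle_def)

lemma covering_class_zero_iff:
  assumes "x \<in> cell_chains" "cell_boundary x = 0"
  shows "complex_hom_induced 1 M torus origami_covering (\<Psi> x) = \<zero>\<^bsub>complex_homology 1 torus\<^esub> \<longleftrightarrow> side_sum True x = 0 \<and> side_sum False x = 0"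
  unfolding \<Psi>_def hom_induced_class[OF continuous_map_covering is_cycle_ccell[OF assms(1), THEN iffD2, OF assms(2)]]
    homology_simps homology_class_eq_iff covering_ccell diff_zero by (rule torus_cycle_bounds_iff)

lemma carrier_U: "carrier U = \<Psi> ` cycles0"
proof (intro equalityI subsetI)
  fix y assume "y \<in> carrier U"
  then have y: "y \<in> carrier (complex_homology 1 M)"
    "complex_hom_induced 1 M torus origami_covering y = \<zero>\<^bsub>complex_homology 1 torus\<^esub>"
    by (auto simp: origami_H10_def)
  then obtain c where c: "is_cycle M c" "y = homology_class M c"
    by (auto simp: homology_simps)
  then obtain x where x: "x \<in> cell_chains" "cell_boundary x = 0" "is_boundary M (c - ccell x)"
    unfolding is_cycle_def by (meson cycle_homologous_cellular)
  then have "y = \<Psi> x" using c by (simp add: \<Psi>_def homology_class_eq_iff)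
  then show "y \<in> \<Psi> ` cycles0"
    using x y covering_class_zero_iff by (auto simp: cycles0_def)
next
  fix y assume "y \<in> \<Psi> ` cycles0"
  then obtain x where x: "x \<in> cycles0" "y = \<Psi> x" by auto
  then show "y \<in> carrier U"
    using covering_class_zero_iff[of x] is_cycle_ccell[of x]
    by (auto simp: origami_H10_def cycles0_def homology_simps \<Psi>_def)
qed

lemma U_simps:
  "\<zero>\<^bsub>U\<^esub> = \<Psi> 0" "\<Psi> x \<oplus>\<^bsub>U\<^esub> \<Psi> y = \<Psi> (x + y)" "a \<odot>\<^bsub>U\<^esub> \<Psi> x = \<Psi> (cscale a x)"
  using homology_simps[of M] by (simp_all add: origami_H10_def \<Psi>_def ccell_linear)

lemma \<Psi>_zero_iff:
  assumes "x \<in> cell_chains"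
  shows "\<Psi> x = \<zero>\<^bsub>U\<^esub> \<longleftrightarrow> x \<in> face_chains"
  using ccell_bounds_iff[OF assms] by (simp add: U_simps) (simp add: \<Psi>_def homology_class_eq_iff ccell_linear)

lemma action_\<Psi>:
  assumes h: "h \<in> carrier G" and x: "x \<in> cycles0"
  shows "origami_H10_action G r u h (\<Psi> x) = \<Psi> (shift h x)"
proof -
  have "x \<in> cell_chains" "cell_boundary x = 0" using x by (auto simp: cycles0_def)
  then have "complex_hom_induced 1 M M (origami_aut G h) (\<Psi> x) = \<Psi> (shift h x)"
    using hom_induced_class[OF continuous_map_aut[OF h], of "ccell x"] is_cycle_ccell[of x]
    by (simp add: \<Psi>_def aut_ccell[OF h])
  then show ?thesis using x by (simp add: origami_H10_action_def carrier_U)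
qed

end

section \<open>Subspaces of chains\<close>

lemma complex_ring_simps [simp]:
  "carrier complex_ring = UNIV" "a \<oplus>\<^bsub>complex_ring\<^esub> b = a + b" "a \<otimes>\<^bsub>complex_ring\<^esub> b = a * b"
  "\<zero>\<^bsub>complex_ring\<^esub> = 0" "\<one>\<^bsub>complex_ring\<^esub> = 1"
  by (simp_all add: ring_of_type_algebra_def)

lemma field_complex_ring: "field complex_ring"
  by (rule field_from_type_algebra)

definition csubspace :: "('s \<Rightarrow>\<^sub>0 complex) set \<Rightarrow> bool" where
  "csubspace S \<longleftrightarrow> 0 \<in> S \<and> (\<forall>x\<in>S. \<forall>y\<in>S. x + y \<in> S) \<and> (\<forall>a. \<forall>x\<in>S. cscale a x \<in> S)"

definition clinear_on :: "('s \<Rightarrow>\<^sub>0 complex) set \<Rightarrow> (('s \<Rightarrow>\<^sub>0 complex) \<Rightarrow> ('t \<Rightarrow>\<^sub>0 complex)) \<Rightarrow> bool" where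
  "clinear_on S f \<longleftrightarrow> (\<forall>x\<in>S. \<forall>y\<in>S. f (x + y) = f x + f y) \<and> (\<forall>a. \<forall>x\<in>S. f (cscale a x) = cscale a (f x))"

definition supported :: "'s set \<Rightarrow> ('s \<Rightarrow>\<^sub>0 complex) set" where
  "supported A = {x. Poly_Mapping.keys x \<subseteq> A}"

definition chains :: "('s \<Rightarrow>\<^sub>0 complex) set \<Rightarrow> (complex, 's \<Rightarrow>\<^sub>0 complex) module" where
  "chains S = \<lparr>carrier = S, monoid.mult = (\<lambda>_ _. 0), one = 0, zero = 0, add = (+), module.smult = cscale\<rparr>"

abbreviation cdim :: "('s \<Rightarrow>\<^sub>0 complex) set \<Rightarrow> nat" where
  "cdim S \<equiv> vectorspace.dim complex_ring (chains S)"

lemma chains_simps [simp]: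
  "carrier (chains S) = S" "x \<oplus>\<^bsub>chains S\<^esub> y = x + y" "\<zero>\<^bsub>chains S\<^esub> = 0" "a \<odot>\<^bsub>chains S\<^esub> x = cscale a x"
  "(chains S)\<lparr>carrier := T\<rparr> = chains T"
  by (simp_all add: chains_def)

lemma csubspaceD:
  assumes "csubspace S"
  shows "0 \<in> S" "x \<in> S \<Longrightarrow> y \<in> S \<Longrightarrow> x + y \<in> S" "x \<in> S \<Longrightarrow> cscale a x \<in> S"
    "x \<in> S \<Longrightarrow> - x \<in> S" "x \<in> S \<Longrightarrow> y \<in> S \<Longrightarrow> x - y \<in> S" "(\<And>i. i \<in> I \<Longrightarrow> f i \<in> S) \<Longrightarrow> (\<Sum>i\<in>I. f i) \<in> S"
proof -
  show 1: "0 \<in> S" "x \<in> S \<Longrightarrow> y \<in> S \<Longrightarrow> x + y \<in> S" "x \<in> S \<Longrightarrow> cscale a x \<in> S" for x y a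
    using assms by (auto simp: csubspace_def)
  have m: "- x = cscale (-1) x" for x :: "'a \<Rightarrow>\<^sub>0 complex" by (auto intro!: poly_mapping_eqI)
  show 2: "x \<in> S \<Longrightarrow> - x \<in> S" for x unfolding m by (rule 1(3))
  show "x \<in> S \<Longrightarrow> y \<in> S \<Longrightarrow> x - y \<in> S" using 1(2)[of x "- y"] 2[of y] by simp
  show "(\<And>i. i \<in> I \<Longrightarrow> f i \<in> S) \<Longrightarrow> (\<Sum>i\<in>I. f i) \<in> S"
    by (induction I rule: infinite_finite_induct) (simp_all add: 1)
qed

lemma clinear_onD:
  assumes "clinear_on S f"
  shows "x \<in> S \<Longrightarrow> y \<in> S \<Longrightarrow> f (x + y) = f x + f y" "x \<in> S \<Longrightarrow> f (cscale a x) = cscale a (f x)"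
  using assms by (auto simp: clinear_on_def)

lemma clinear_on_more:
  assumes S: "csubspace S" and f: "clinear_on S f"
  shows "f 0 = 0" "x \<in> S \<Longrightarrow> y \<in> S \<Longrightarrow> f (x - y) = f x - f y"
    "(\<And>i. i \<in> I \<Longrightarrow> h i \<in> S) \<Longrightarrow> f (\<Sum>i\<in>I. h i) = (\<Sum>i\<in>I. f (h i))"
proof -
  show 0: "f 0 = 0" using clinear_onD(2)[OF f csubspaceD(1)[OF S], of 0] by simp
  show "x \<in> S \<Longrightarrow> y \<in> S \<Longrightarrow> f (x - y) = f x - f y"
    using clinear_onD(1)[OF f csubspaceD(5)[OF S], of x y y] by (simp add: algebra_simps)
  show "(\<And>i. i \<in> I \<Longrightarrow> h i \<in> S) \<Longrightarrow> f (\<Sum>i\<in>I. h i) = (\<Sum>i\<in>I. f (h i))"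
    by (induction I rule: infinite_finite_induct) (simp_all add: 0 clinear_onD(1)[OF f] csubspaceD(6)[OF S])
qed

lemma csubspace_image:
  assumes S: "csubspace S" and f: "clinear_on S f"
  shows "csubspace (f ` S)"
  unfolding csubspace_def
proof (intro conjI ballI allI)
  show "0 \<in> f ` S" using clinear_on_more(1)[OF S f] csubspaceD(1)[OF S] by (metis imageI)
next
  fix x y assume "x \<in> f ` S" "y \<in> f ` S"
  then obtain a b where "a \<in> S" "x = f a" "b \<in> S" "y = f b" by blast
  then show "x + y \<in> f ` S" using clinear_onD(1)[OF f] csubspaceD(2)[OF S] by (metis imageI)
next
  fix c x assume "x \<in> f ` S"
  then obtain a where "a \<in> S" "x = f a" by blast
  then show "cscale c x \<in> f ` S" using clinear_onD(2)[OF f] csubspaceD(3)[OF S] by (metis imageI)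
qed

lemma csubspace_kernel:
  assumes S: "csubspace S" and f: "clinear_on S f"
  shows "csubspace {x \<in> S. f x = 0}"
  unfolding csubspace_def using csubspaceD[OF S] clinear_onD[OF f] clinear_on_more(1)[OF S f] by simp

lemma csubspace_supported: "csubspace (supported A)"
  unfolding csubspace_def supported_def
  by (auto dest!: subsetD[OF Poly_Mapping.keys_add] subsetD[OF keys_cscale])

lemma vectorspace_chains:
  assumes "csubspace S"
  shows "vectorspace complex_ring (chains S)"
proof (rule vs_criteria[OF field_complex_ring])
  show "\<forall>v\<in>carrier (chains S). \<exists>w\<in>carrier (chains S). v \<oplus>\<^bsub>chains S\<^esub> w = \<zero>\<^bsub>chains S\<^esub>"
  proof
    fix v assume "v \<in> carrier (chains S)"
    then show "\<exists>w\<in>carrier (chains S). v \<oplus>\<^bsub>chains S\<^esub> w = \<zero>\<^bsub>chains S\<^esub>"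
      using csubspaceD(4)[OF assms] by (intro bexI[of _ "- v"]) simp_all
  qed
qed (use csubspaceD[OF assms] in \<open>auto simp: cscale_add_left cscale_add_right add.assoc add.commute\<close>)

lemma linear_map_chains:
  assumes "csubspace S" "csubspace T" "clinear_on S f" "f ` S \<subseteq> T"
  shows "linear_map complex_ring (chains S) (chains T) f"
proof -
  have v: "vectorspace complex_ring (chains S)" "vectorspace complex_ring (chains T)"
    using assms by (simp_all add: vectorspace_chains)
  then have m: "module complex_ring (chains S)" "module complex_ring (chains T)"
    by (simp_all add: vectorspace_def)
  have "f \<in> module_hom complex_ring (chains S) (chains T)"
    using assms(3,4) by (auto simp: module_hom_def clinear_on_def)
  then have "mod_hom complex_ring (chains S) (chains T) f"
    using m by (simp add: mod_hom_def mod_hom_axioms_def)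
  then show ?thesis using v by (simp add: linear_map_def)
qed

text \<open>Extend the identity of \<open>S\<close> to all chains.\<close>

lemma linear_projection_exists:
  assumes S: "csubspace S"
  obtains p where "clinear_on UNIV p" "\<And>x. p x \<in> S" "\<And>x. x \<in> S \<Longrightarrow> p x = x"
proof -
  have v1: "vector_space (cscale :: complex \<Rightarrow> ('a \<Rightarrow>\<^sub>0 complex) \<Rightarrow> _)"
    by (rule vector_space.intro) (simp_all add: cscale_add_right cscale_add_left)
  interpret V: vector_space "cscale :: complex \<Rightarrow> ('a \<Rightarrow>\<^sub>0 complex) \<Rightarrow> _" by (rule v1)
  interpret P: vector_space_pair "cscale :: complex \<Rightarrow> ('a \<Rightarrow>\<^sub>0 complex) \<Rightarrow> _" "cscale :: complex \<Rightarrow> ('a \<Rightarrow>\<^sub>0 complex) \<Rightarrow> _"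
    by (rule vector_space_pair.intro[OF v1 v1])
  have sub: "V.subspace S" using S by (auto simp: csubspace_def V.subspace_def)
  obtain B where B: "B \<subseteq> S" "V.independent B" "S \<subseteq> V.span B"
    using V.maximal_independent_subset by blast
  have spB: "V.span B = S" using B sub V.span_minimal[OF B(1) sub] by blast
  obtain g where g: "Vector_Spaces.linear cscale cscale g" "\<forall>x\<in>B. g x = x" "range g = V.span B"
    using P.linear_independent_extend_subspace[OF B(2), of "\<lambda>x. x"] by auto
  have gadd: "g (x + y) = g x + g y" "g (cscale a x) = cscale a (g x)" for x y a
    using g(1) by (auto simp: Vector_Spaces.linear_iff)
  have "g x = x" if "x \<in> V.span B" for x
    using that
  proof (induction rule: V.span_induct_alt)
    case base
    then show ?case using gadd(2)[of 0 0] by simp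
  next
    case (step c x y)
    then show ?case using g(2) by (simp add: gadd)
  qed
  then show ?thesis using that[of g] g(3) spB gadd by (auto simp: clinear_on_def)
qed

lemma fin_dim_supported:
  assumes "finite A"
  shows "vectorspace.fin_dim complex_ring (chains (supported A))"
  using assms
proof (induction A rule: finite_induct)
  case empty
  interpret V: vectorspace complex_ring "chains (supported {} :: ('a \<Rightarrow>\<^sub>0 complex) set)"
    by (rule vectorspace_chains[OF csubspace_supported])
  show ?case unfolding V.fin_dim_def
    by (intro exI[of _ "{}"]) (simp add: V.span_empty, auto simp: supported_def)
next
  case (insert a A)
  interpret V: vectorspace complex_ring "chains (supported A)"
    by (rule vectorspace_chains[OF csubspace_supported])
  interpret V': vectorspace complex_ring "chains (supported (insert a A))"
    by (rule vectorspace_chains[OF csubspace_supported])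
  obtain B where B: "finite B" "B \<subseteq> supported A" "V.span B = supported A"
    using insert.IH by (auto simp: V.fin_dim_def)
  have AA: "supported A \<subseteq> supported (insert a A)" by (auto simp: supported_def)
  let ?a = "Poly_Mapping.single a (1 :: complex)"
  have aS: "?a \<in> supported (insert a A)" by (auto simp: supported_def)
  have BS: "insert ?a B \<subseteq> carrier (chains (supported (insert a A)))" using B AA aS by auto
  have subm: "submodule complex_ring (supported A) (chains (supported (insert a A)))"
    using V'.module_axioms AA csubspaceD[OF csubspace_supported[of A]] by (auto intro!: submodule.intro)
  have spB: "V'.span B = supported A"
    using V'.span_li_not_depend(1)[OF B(2) subm] B(3) by simp
  have "V'.span (insert ?a B) = supported (insert a A)"
  proof
    show "V'.span (insert ?a B) \<subseteq> supported (insert a A)" using V'.span_is_subset2[OF BS] by simp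
    show "supported (insert a A) \<subseteq> V'.span (insert ?a B)"
    proof
      fix x assume x: "x \<in> supported (insert a A)"
      define y where "y = x - Poly_Mapping.single a (Poly_Mapping.lookup x a)"
      have "y \<in> supported A"
        using x by (auto simp: supported_def y_def in_keys_iff lookup_minus lookup_single when_def split: if_splits)
      then have y: "y \<in> V'.span (insert ?a B)"
        using spB V'.span_is_monotone[of B "insert ?a B"] by blast
      have sub: "submodule complex_ring (V'.span (insert ?a B)) (chains (supported (insert a A)))"
        by (rule V'.span_is_submodule[OF BS])
      have "?a \<in> V'.span (insert ?a B)" using V'.in_own_span[OF BS] by blast
      then have "cscale (Poly_Mapping.lookup x a) ?a \<in> V'.span (insert ?a B)"
        using submodule.smult_closed[OF sub, of "Poly_Mapping.lookup x a" ?a] by simp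
      then have "y + cscale (Poly_Mapping.lookup x a) ?a \<in> V'.span (insert ?a B)"
        using submodule.m_closed[OF sub y] by simp
      then show "x \<in> V'.span (insert ?a B)" by (simp add: y_def)
    qed
  qed
  then show ?case
    unfolding V'.fin_dim_def using B(1) BS by (intro exI[of _ "insert ?a B"]) simp
qed

lemma fin_dim_chains:
  assumes S: "csubspace S" and A: "finite A" "S \<subseteq> supported A"
  shows "vectorspace.fin_dim complex_ring (chains S)"
proof -
  obtain p where p: "clinear_on UNIV p" "\<And>x. p x \<in> S" "\<And>x. x \<in> S \<Longrightarrow> p x = x"
    by (rule linear_projection_exists[OF S]) (rule that)
  have "clinear_on (supported A) p" using p(1) by (simp add: clinear_on_def)
  moreover have im: "p ` supported A = S" using p A by force
  ultimately interpret linear_map complex_ring "chains (supported A)" "chains S" p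
    by (intro linear_map_chains csubspace_supported S) auto
  show ?thesis using rank_nullity_main(2)[OF fin_dim_supported[OF A(1)]] im by simp
qed

lemma cdim_rank_nullity:
  assumes S: "csubspace S" and A: "finite A" "S \<subseteq> supported A" and f: "clinear_on S f"
  shows "cdim S = cdim (f ` S) + cdim {x \<in> S. f x = 0}"
proof -
  interpret linear_map complex_ring "chains S" "chains (f ` S)" f
    by (intro linear_map_chains csubspace_image S f) auto
  show ?thesis
    using rank_nullity[OF fin_dim_chains[OF S A]] by (simp add: im_def ker_def)
qed

lemma cdim_zero: "cdim {0 :: 's \<Rightarrow>\<^sub>0 complex} = 0"
proof -
  have "csubspace {0 :: 's \<Rightarrow>\<^sub>0 complex}" by (simp add: csubspace_def)
  then interpret V: vectorspace complex_ring "chains {0 :: 's \<Rightarrow>\<^sub>0 complex}" by (rule vectorspace_chains)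
  have "V.basis {}" unfolding V.basis_def by (simp add: V.span_empty) (auto simp: V.lin_dep_def)
  then show ?thesis using V.dim_basis[of "{}"] by simp
qed

lemma cdim_inj:
  assumes S: "csubspace S" and A: "finite A" "S \<subseteq> supported A" and f: "clinear_on S f"
    and inj: "\<And>x. x \<in> S \<Longrightarrow> f x = 0 \<Longrightarrow> x = 0"
  shows "cdim (f ` S) = cdim S"
proof -
  have "{x \<in> S. f x = 0} = {0}" using inj csubspaceD(1)[OF S] clinear_on_more(1)[OF S f] by auto
  then show ?thesis using cdim_rank_nullity[OF S A f] by (simp add: cdim_zero)
qed

lemma single_eq_0_iff: "Poly_Mapping.single a c = 0 \<longleftrightarrow> c = 0"
  by (metis lookup_single_eq lookup_zero single_zero)

lemma cdim_supported:
  assumes "finite A"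
  shows "cdim (supported A) = card A"
  using assms
proof (induction A rule: finite_induct)
  case empty
  have "supported {} = {0 :: 'a \<Rightarrow>\<^sub>0 complex}" by (auto simp: supported_def)
  then show ?case by (simp add: cdim_zero)
next
  case (insert a A)
  define f where "f x = Poly_Mapping.single a (Poly_Mapping.lookup x a)" for x :: "'a \<Rightarrow>\<^sub>0 complex"
  have f: "clinear_on (supported (insert a A)) f"
    by (auto simp: clinear_on_def f_def lookup_add single_add)
  have fi: "f ` supported (insert a A) = range (Poly_Mapping.single a)"
  proof (intro equalityI subsetI)
    fix x assume "x \<in> range (Poly_Mapping.single a :: complex \<Rightarrow> _)"
    then obtain c where c: "x = Poly_Mapping.single a c" by auto
    then have "x \<in> supported (insert a A)" "f x = x" by (auto simp: supported_def f_def)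
    then show "x \<in> f ` supported (insert a A)" by (metis imageI)
  qed (auto simp: f_def)
  have fk: "{x \<in> supported (insert a A). f x = 0} = supported A"
    using insert.hyps(2) by (auto simp: supported_def f_def in_keys_iff single_eq_0_iff)
  have cs: "csubspace (range (Poly_Mapping.single a :: complex \<Rightarrow> _))"
    using csubspace_image[OF csubspace_supported f] by (simp add: fi)
  have "cdim (range (Poly_Mapping.single a :: complex \<Rightarrow> _)) = 1"
  proof -
    interpret V: vectorspace complex_ring "chains (range (Poly_Mapping.single a :: complex \<Rightarrow> _))"
      by (rule vectorspace_chains[OF cs])
    let ?a = "Poly_Mapping.single a (1 :: complex)"
    have aS: "{?a} \<subseteq> carrier (chains (range (Poly_Mapping.single a)))" by auto
    have sub: "submodule complex_ring (V.span {?a}) (chains (range (Poly_Mapping.single a)))"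
      by (rule V.span_is_submodule[OF aS])
    have "Poly_Mapping.single a c \<in> V.span {?a}" for c
      using submodule.smult_closed[OF sub, of c ?a] V.in_own_span[OF aS] by simp
    then have "V.span {?a} = range (Poly_Mapping.single a)"
      using V.span_is_subset2[OF aS] by auto
    moreover have "?a \<noteq> 0" by (simp add: single_eq_0_iff)
    ultimately show ?thesis by (intro V.dim1I) auto
  qed
  then show ?case
    using cdim_rank_nullity[OF csubspace_supported, of "insert a A" "insert a A" f] f insert by (simp add: fi fk)
qed

section \<open>Eigenvectors\<close>

lemma cdim_mono:
  assumes S: "csubspace S" and A: "finite A" "S \<subseteq> supported A"
  shows "cdim S \<le> card A"
proof -
  obtain p where p: "clinear_on UNIV p" "\<And>x. p x \<in> S" "\<And>x. x \<in> S \<Longrightarrow> p x = x"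
    by (rule linear_projection_exists[OF S]) (rule that)
  have "clinear_on (supported A) p" using p(1) by (simp add: clinear_on_def)
  moreover have "p ` supported A = S" using p A by force
  ultimately show ?thesis
    using cdim_rank_nullity[OF csubspace_supported A(1) order_refl, of p] cdim_supported[OF A(1)] by simp
qed

text \<open>Split off a root \<open>a\<close> from the polynomial \<open>p\<close> that annihilates \<open>v\<close>, say \<open>p = (X - a) q\<close>. Either \<open>q\<close> applied to \<open>v\<close> is an
  eigenvector with eigenvalue \<open>a\<close>, or \<open>q\<close> annihilates \<open>v\<close> too.\<close>

lemma eigenvector_from_polynomial:
  fixes f :: "('s \<Rightarrow>\<^sub>0 complex) \<Rightarrow> ('s \<Rightarrow>\<^sub>0 complex)"
  assumes S: "csubspace S" and f: "clinear_on S f" "\<And>x. x \<in> S \<Longrightarrow> f x \<in> S" and v: "v \<in> S" "v \<noteq> 0"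
  shows "\<lbrakk>degree p = n; p \<noteq> 0; (\<Sum>i\<le>n. cscale (coeff p i) ((f ^^ i) v)) = 0\<rbrakk>
    \<Longrightarrow> \<exists>a x. x \<in> S \<and> x \<noteq> 0 \<and> f x = cscale a x"
proof (induction n arbitrary: p)
  case 0
  then have "coeff p 0 \<noteq> 0" using leading_coeff_0_iff[of p] by simp
  moreover have "cscale (inverse (coeff p 0)) (cscale (coeff p 0) v) = 0" using 0 by simp
  ultimately show ?case using v by simp
next
  case (Suc n)
  have "\<not> constant (poly p)" using Suc.prems(1) by (simp add: constant_degree)
  then obtain a where "poly p a = 0" using fundamental_theorem_of_algebra by blast
  then obtain q where q: "p = [:- a, 1:] * q" by (auto simp: poly_eq_0_iff_dvd dvd_def)
  have q0: "q \<noteq> 0" using q Suc.prems(2) by auto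
  have dq: "degree q = n"
    using Suc.prems(1) q0 unfolding q by (subst (asm) degree_mult_eq) auto
  have fi: "(f ^^ i) v \<in> S" for i by (induction i) (auto simp: v f)
  define w where "w = (\<Sum>i\<le>n. cscale (coeff q i) ((f ^^ i) v))"
  have wS: "w \<in> S" unfolding w_def by (intro csubspaceD(6)[OF S] csubspaceD(3)[OF S] fi)
  have fw: "f w = (\<Sum>i\<le>n. cscale (coeff q i) ((f ^^ Suc i) v))"
    unfolding w_def
    by (subst clinear_on_more(3)[OF S f(1)]) (simp_all add: csubspaceD(3)[OF S] fi clinear_onD(2)[OF f(1) fi])
  have "coeff q (Suc n) = 0" using dq by (simp add: coeff_eq_0)
  have "(\<Sum>i\<le>Suc n. cscale (coeff p i) ((f ^^ i) v))
      = (\<Sum>i\<le>Suc n. cscale (coeff (pCons 0 q) i) ((f ^^ i) v)) - (\<Sum>i\<le>Suc n. cscale (a * coeff q i) ((f ^^ i) v))"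
  proof -
    have "coeff p i = coeff (pCons 0 q) i + (- (a * coeff q i))" for i by (simp add: q)
    moreover have "cscale (- c) z = - cscale c z" for c and z :: "'s \<Rightarrow>\<^sub>0 complex" by (auto intro!: poly_mapping_eqI)
    ultimately show ?thesis by (simp only: cscale_add_left sum.distrib sum_negf diff_conv_add_uminus)
  qed
  also have "(\<Sum>i\<le>Suc n. cscale (coeff (pCons 0 q) i) ((f ^^ i) v)) = f w"
    unfolding fw by (subst sum.atMost_Suc_shift) simp
  also have "(\<Sum>i\<le>Suc n. cscale (a * coeff q i) ((f ^^ i) v)) = cscale a w"
    using \<open>coeff q (Suc n) = 0\<close> by (simp add: w_def cscale_sum_right)
  finally have eq: "f w = cscale a w" using Suc.prems(3) by simp
  show ?case
  proof (cases "w = 0")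
    case True
    then show ?thesis using Suc.IH[OF dq q0] by (simp add: w_def)
  next
    case False
    then show ?thesis using wS eq by blast
  qed
qed

text \<open>The vectors \<open>v, f v, f\<^sup>2 v, \<dots>\<close> are linearly dependent, so that a polynomial in \<open>f\<close> annihilates \<open>v\<close>.\<close>

lemma eigenvector_exists:
  assumes S: "csubspace S" and A: "finite A" "S \<subseteq> supported A"
    and f: "clinear_on S f" "\<And>x. x \<in> S \<Longrightarrow> f x \<in> S" and v: "v \<in> S" "v \<noteq> 0"
  shows "\<exists>a x. x \<in> S \<and> x \<noteq> 0 \<and> f x = cscale a x"
proof -
  let ?n = "card A"
  define L where "L y = (\<Sum>i\<le>?n. cscale (Poly_Mapping.lookup y i) ((f ^^ i) v))" for y :: "nat \<Rightarrow>\<^sub>0 complex"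
  have L: "clinear_on (supported {..?n}) L"
    by (auto simp: clinear_on_def L_def lookup_add cscale_add_left sum.distrib cscale_sum_right)
  have fi: "(f ^^ i) v \<in> S" for i by (induction i) (auto simp: v f)
  have LS: "L ` supported {..?n} \<subseteq> S"
    unfolding L_def by (auto intro!: csubspaceD(6)[OF S] csubspaceD(3)[OF S] fi)
  have "\<exists>y. y \<in> supported {..?n} \<and> L y = 0 \<and> y \<noteq> 0"
  proof (rule ccontr)
    assume "\<not> ?thesis"
    then have "cdim (L ` supported {..?n}) = card {..?n}"
      using cdim_inj[OF csubspace_supported _ order_refl L] cdim_supported[of "{..?n}"] by auto
    moreover have "cdim (L ` supported {..?n}) \<le> card A"
      using cdim_mono[OF csubspace_image[OF csubspace_supported L] A(1)] LS A(2) by blast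
    ultimately show False by simp
  qed
  then obtain y where y: "y \<in> supported {..?n}" "L y = 0" "y \<noteq> 0" by blast
  define p where "p = (\<Sum>i\<le>?n. monom (Poly_Mapping.lookup y i) i)"
  have cp: "coeff p i = (if i \<le> ?n then Poly_Mapping.lookup y i else 0)" for i
    by (simp add: p_def coeff_sum)
  have p0: "p \<noteq> 0"
  proof
    assume "p = 0"
    then have "Poly_Mapping.lookup y i = 0" if "i \<le> ?n" for i using cp[of i] that by simp
    then have "y = 0" using y(1) by (intro poly_mapping_eqI) (auto simp: supported_def in_keys_iff)
    then show False using y(3) by simp
  qed
  have dp: "degree p \<le> ?n" by (rule degree_le) (simp add: cp)
  have "(\<Sum>i\<le>degree p. cscale (coeff p i) ((f ^^ i) v)) = (\<Sum>i\<le>?n. cscale (coeff p i) ((f ^^ i) v))"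
    using dp by (intro sum.mono_neutral_left) (auto simp: coeff_eq_0)
  also have "\<dots> = L y" by (simp add: L_def cp)
  finally show ?thesis
    using eigenvector_from_polynomial[OF S f v refl p0] y(2) by simp
qed

section \<open>Invariant subspaces of the cellular chains\<close>

context origami
begin

lemma cell_chains_supported: "cell_chains = supported (carrier G \<times> UNIV)"
  by (simp add: cell_chains_def supported_def)

lemma finite_cells: "finite (carrier G \<times> (UNIV :: bool set))"
  using finite_G by simp

lemma shift_linear: "shift h (x + y) = shift h x + shift h y" "shift h (x - y) = shift h x - shift h y"
  "shift h (cscale a x) = cscale a (shift h x)" "shift h (\<Sum>i\<in>I. f i) = (\<Sum>i\<in>I. shift h (f i))" "shift h 0 = 0"
  by (simp_all add: shift_def clinear_extend_add clinear_extend_diff clinear_extend_cscale clinear_extend_sum)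

lemma shift_single: "shift h (Poly_Mapping.single e a) = Poly_Mapping.single (h \<otimes> fst e, snd e) a"
  by (simp add: shift_def)

lemma shift_in: "h \<in> carrier G \<Longrightarrow> x \<in> cell_chains \<Longrightarrow> shift h x \<in> cell_chains"
  unfolding shift_def cell_chains_def mem_Collect_eq by (rule keys_clinear_extend) auto

lemma shift_one: "x \<in> cell_chains \<Longrightarrow> shift \<one> x = x"
proof -
  assume x: "x \<in> cell_chains"
  have "shift \<one> x = clinear_extend (\<lambda>e. Poly_Mapping.single e 1) x"
    unfolding shift_def by (rule clinear_extend_cong) (use x in \<open>auto simp: cell_chains_def\<close>)
  then show ?thesis by (simp add: clinear_extend_ident)
qed

lemma shift_shift:
  assumes "h \<in> carrier G" "k \<in> carrier G" "x \<in> cell_chains"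
  shows "shift h (shift k x) = shift (h \<otimes> k) x"
  unfolding shift_def clinear_extend_clinear_extend
  by (rule clinear_extend_cong) (use assms in \<open>auto simp: cell_chains_def m_assoc\<close>)

lemma shift_inv: "h \<in> carrier G \<Longrightarrow> x \<in> cell_chains \<Longrightarrow> shift (inv h) (shift h x) = x"
  "h \<in> carrier G \<Longrightarrow> x \<in> cell_chains \<Longrightarrow> shift h (shift (inv h) x) = x"
  by (simp_all add: shift_shift shift_one)

definition invariant :: "('g \<times> bool \<Rightarrow>\<^sub>0 complex) set \<Rightarrow> bool" where
  "invariant S \<longleftrightarrow> csubspace S \<and> S \<subseteq> cell_chains \<and> (\<forall>h\<in>carrier G. \<forall>x\<in>S. shift h x \<in> S)"

definition equivariant :: "('g \<times> bool \<Rightarrow>\<^sub>0 complex) set \<Rightarrow> (('g \<times> bool \<Rightarrow>\<^sub>0 complex) \<Rightarrow> ('g \<times> bool \<Rightarrow>\<^sub>0 complex)) \<Rightarrow> bool" where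
  "equivariant S f \<longleftrightarrow> clinear_on S f \<and> (\<forall>h\<in>carrier G. \<forall>x\<in>S. f (shift h x) = shift h (f x))"

definition irreducible :: "('g \<times> bool \<Rightarrow>\<^sub>0 complex) set \<Rightarrow> bool" where
  "irreducible Y \<longleftrightarrow> invariant Y \<and> Y \<noteq> {0} \<and> (\<forall>S. invariant S \<longrightarrow> S \<subseteq> Y \<longrightarrow> S = {0} \<or> S = Y)"

lemma invariantD:
  assumes "invariant S"
  shows "csubspace S" "S \<subseteq> cell_chains" "S \<subseteq> supported (carrier G \<times> UNIV)" "h \<in> carrier G \<Longrightarrow> x \<in> S \<Longrightarrow> shift h x \<in> S"
  using assms by (auto simp: invariant_def cell_chains_supported)

lemma equivariantD:
  assumes "equivariant S f"
  shows "clinear_on S f" "h \<in> carrier G \<Longrightarrow> x \<in> S \<Longrightarrow> f (shift h x) = shift h (f x)"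
  using assms by (auto simp: equivariant_def)

lemma equivariant_subset: "equivariant D f \<Longrightarrow> S \<subseteq> D \<Longrightarrow> equivariant S f"
  unfolding equivariant_def clinear_on_def by blast

lemma invariant_cell_chains: "invariant cell_chains"
  unfolding invariant_def using shift_in csubspace_supported by (simp add: cell_chains_supported)

lemma invariant_image:
  assumes "invariant S" "equivariant S f" "f ` S \<subseteq> cell_chains"
  shows "invariant (f ` S)"
  unfolding invariant_def
proof (intro conjI ballI)
  fix h x assume h: "h \<in> carrier G" and "x \<in> f ` S"
  then obtain y where y: "y \<in> S" "x = f y" by blast
  then have "shift h x = f (shift h y)" using equivariantD(2)[OF assms(2) h] by simp
  then show "shift h x \<in> f ` S" using invariantD(4)[OF assms(1) h y(1)] by blast
qed (use assms csubspace_image[OF invariantD(1)[OF assms(1)] equivariantD(1)[OF assms(2)]] in auto)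

lemma invariant_kernel:
  assumes "invariant S" "equivariant S f"
  shows "invariant {x \<in> S. f x = 0}"
  unfolding invariant_def
  using csubspace_kernel[OF invariantD(1)[OF assms(1)] equivariantD(1)[OF assms(2)]] invariantD[OF assms(1)]
    equivariantD(2)[OF assms(2)] by (auto simp: shift_linear)

text \<open>Average a linear projection onto \<open>S\<close> over the group.\<close>

lemma equivariant_projection_exists:
  assumes S: "invariant S"
  obtains p where "equivariant cell_chains p" "\<And>x. x \<in> cell_chains \<Longrightarrow> p x \<in> S" "\<And>x. x \<in> S \<Longrightarrow> p x = x"
proof -
  let ?N = "of_nat (card (carrier G)) :: complex"
  have N0: "?N \<noteq> 0" using finite_G by (simp add: card_gt_0_iff) (use one_closed in blast)
  obtain P where P: "clinear_on UNIV P" "\<And>x. P x \<in> S" "\<And>x. x \<in> S \<Longrightarrow> P x = x"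
    by (rule linear_projection_exists[OF invariantD(1)[OF S]]) (rule that)
  have Pl: "P (x + y) = P x + P y" "P (cscale a x) = cscale a (P x)" for x y a
    using clinear_onD[OF P(1)] by auto
  define p where "p x = cscale (1 / ?N) (\<Sum>g\<in>carrier G. shift g (P (shift (inv g) x)))" for x
  show ?thesis
  proof (rule that[of p])
    show "equivariant cell_chains p"
      unfolding equivariant_def
    proof (intro conjI ballI)
      show "clinear_on cell_chains p"
        by (simp add: clinear_on_def p_def shift_linear Pl sum.distrib cscale_add_right cscale_sum_right mult.commute)
      fix h x assume h: "h \<in> carrier G" and x: "x \<in> cell_chains"
      have "(\<Sum>g\<in>carrier G. shift g (P (shift (inv g) (shift h x))))
          = (\<Sum>k\<in>carrier G. shift (h \<otimes> k) (P (shift (inv (h \<otimes> k)) (shift h x))))"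
      proof (rule sum.reindex_bij_betw[symmetric])
        show "bij_betw ((\<otimes>) h) (carrier G) (carrier G)"
          using h by (intro bij_betw_byWitness[where f' = "(\<otimes>) (inv h)"]) (auto simp: m_assoc[symmetric])
      qed
      also have "\<dots> = (\<Sum>k\<in>carrier G. shift h (shift k (P (shift (inv k) x))))"
      proof (rule sum.cong)
        fix k assume k: "k \<in> carrier G"
        have "shift (inv (h \<otimes> k)) (shift h x) = shift (inv k) x"
          using h k x by (simp add: shift_shift inv_mult_group m_assoc)
        moreover have "P y \<in> cell_chains" for y using P(2) invariantD(2)[OF S] by blast
        ultimately show "shift (h \<otimes> k) (P (shift (inv (h \<otimes> k)) (shift h x))) = shift h (shift k (P (shift (inv k) x)))"
          using h k by (simp add: shift_shift)
      qed simp
      finally show "p (shift h x) = shift h (p x)" by (simp add: p_def shift_linear)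
    qed
    show "p x \<in> S" if "x \<in> cell_chains" for x
      unfolding p_def using P(2) invariantD(4)[OF S]
      by (intro csubspaceD(3)[OF invariantD(1)[OF S]] csubspaceD(6)[OF invariantD(1)[OF S]]) auto
    show "p x = x" if x: "x \<in> S" for x
    proof -
      have "shift g (P (shift (inv g) x)) = x" if "g \<in> carrier G" for g
        using that x invariantD(2)[OF S] invariantD(4)[OF S, of "inv g" x] P(3) by (simp add: shift_inv subsetD)
      then have "(\<Sum>g\<in>carrier G. shift g (P (shift (inv g) x))) = (\<Sum>g\<in>carrier G. cscale 1 x)" by simp
      also have "\<dots> = cscale ?N x" by (simp only: cscale_sum_left[symmetric]) simp
      finally show ?thesis using N0 by (simp add: p_def)
    qed
  qed
qed

lemma schur_zero_or_bij:
  assumes S: "irreducible S" and T: "irreducible T" and f: "equivariant S f" "f ` S \<subseteq> T"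
  shows "(\<forall>x\<in>S. f x = 0) \<or> bij_betw f S T"
proof -
  have iS: "invariant S" and iT: "invariant T" using S T by (auto simp: irreducible_def)
  have k: "invariant {x \<in> S. f x = 0}" by (rule invariant_kernel[OF iS f(1)])
  have im: "invariant (f ` S)" using invariant_image[OF iS f(1)] f(2) invariantD(2)[OF iT] by blast
  from k S have "{x \<in> S. f x = 0} = {0} \<or> {x \<in> S. f x = 0} = S" by (auto simp: irreducible_def)
  then show ?thesis
  proof
    assume k0: "{x \<in> S. f x = 0} = {0}"
    have inj: "inj_on f S"
    proof (rule inj_onI)
      fix x y assume xy: "x \<in> S" "y \<in> S" "f x = f y"
      then have "x - y \<in> {x \<in> S. f x = 0}"
        using clinear_on_more(2)[OF invariantD(1)[OF iS] equivariantD(1)[OF f(1)]] csubspaceD(5)[OF invariantD(1)[OF iS]] by simp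
      then show "x = y" using k0 by simp
    qed
    have "f ` S \<noteq> {0}"
    proof
      assume "f ` S = {0}"
      then have "{x \<in> S. f x = 0} = S" by auto
      then show False using k0 S by (simp add: irreducible_def)
    qed
    then have "f ` S = T" using im T f(2) unfolding irreducible_def by blast
    then show ?thesis using inj by (simp add: bij_betw_def)
  qed auto
qed

text \<open>The eigenspace of an eigenvalue of \<open>f\<close> is invariant and not \<open>0\<close>.\<close>

lemma schur_scalar:
  assumes S: "irreducible S" and f: "equivariant S f" "\<And>x. x \<in> S \<Longrightarrow> f x \<in> S"
  shows "\<exists>a. \<forall>x\<in>S. f x = cscale a x"
proof -
  have iS: "invariant S" using S by (auto simp: irreducible_def)
  note cS = invariantD(1)[OF iS]
  obtain v where v: "v \<in> S" "v \<noteq> 0" using S csubspaceD(1)[OF cS] by (auto simp: irreducible_def)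
  obtain a x where ax: "x \<in> S" "x \<noteq> 0" "f x = cscale a x"
    using eigenvector_exists[OF cS finite_cells invariantD(3)[OF iS] equivariantD(1)[OF f(1)] f(2) v] by blast
  have "equivariant S (\<lambda>x. f x - cscale a x)"
    using f(1) by (auto simp: equivariant_def clinear_on_def shift_linear cscale_add_right cscale_diff_right mult.commute)
  from invariant_kernel[OF iS this]
  have "{x \<in> S. f x - cscale a x = 0} = {0} \<or> {x \<in> S. f x - cscale a x = 0} = S"
    using S by (auto simp: irreducible_def)
  moreover have "x \<in> {x \<in> S. f x - cscale a x = 0}" using ax by simp
  ultimately have "{x \<in> S. f x - cscale a x = 0} = S" using ax(2) by blast
  then have "\<forall>x\<in>S. f x = cscale a x" by auto
  then show ?thesis by blast
qed

text \<open>By induction on the dimension: a subspace that is not irreducible has a proper invariant one, which has smaller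
  dimension because a projection onto it has a kernel.\<close>

lemma irreducible_exists:
  assumes S: "invariant S" "S \<noteq> {0}"
  shows "\<exists>T. irreducible T \<and> T \<subseteq> S"
  using S
proof (induction "cdim S" arbitrary: S rule: less_induct)
  case less
  show ?case
  proof (cases "irreducible S")
    case False
    then obtain T where T: "invariant T" "T \<subseteq> S" "T \<noteq> {0}" "T \<noteq> S"
      using less.prems by (auto simp: irreducible_def)
    obtain p where p: "equivariant cell_chains p" "\<And>x. x \<in> cell_chains \<Longrightarrow> p x \<in> T" "\<And>x. x \<in> T \<Longrightarrow> p x = x"
      by (rule equivariant_projection_exists[OF T(1)]) (rule that)
    have pS: "clinear_on S p"
      by (rule equivariantD(1)[OF equivariant_subset[OF p(1) invariantD(2)[OF less.prems(1)]]])
    have pim: "p ` S = T" using p T(2) invariantD(2)[OF less.prems(1)] by force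
    note cS = invariantD(1)[OF less.prems(1)]
    have rn: "cdim S = cdim T + cdim {x \<in> S. p x = 0}"
      using cdim_rank_nullity[OF cS finite_cells invariantD(3)[OF less.prems(1)] pS] unfolding pim .
    have "cdim {x \<in> S. p x = 0} \<noteq> 0"
    proof
      obtain x where x: "x \<in> S" "x \<notin> T" using T(2,4) by blast
      let ?y = "x - p x"
      have xc: "x \<in> cell_chains" "p x \<in> cell_chains" using x invariantD(2)[OF less.prems(1)] p(2) invariantD(2)[OF T(1)] by auto
      have yS: "?y \<in> S" using x p(2)[OF xc(1)] T(2) csubspaceD(5)[OF cS] by auto
      have y0: "p ?y = 0"
        using clinear_on_more(2)[OF invariantD(1)[OF invariant_cell_chains] equivariantD(1)[OF p(1)] xc] p(3)[OF p(2)[OF xc(1)]] by simp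
      have yn: "?y \<noteq> 0" using x p(2)[OF xc(1)] by auto
      assume z: "cdim {x \<in> S. p x = 0} = 0"
      let ?K = "{x \<in> S. p x = 0}"
      have cK: "csubspace ?K" by (rule csubspace_kernel[OF cS pS])
      interpret V: vectorspace complex_ring "chains ?K" by (rule vectorspace_chains[OF cK])
      have fd: "V.fin_dim" using fin_dim_chains[OF cK finite_cells] invariantD(3)[OF less.prems(1)] by blast
      obtain B where B: "finite B" "V.basis B" using V.finite_basis_exists[OF fd] by blast
      then have "card B = 0" using z V.dim_basis[OF B] by simp
      then have "B = {}" using B(1) by simp
      then have "V.span {} = ?K" using B(2) by (simp add: V.basis_def)
      then have "?K = {0}" by (simp add: V.span_empty)
      then show False using yS y0 yn by blast
    qed
    then have "cdim T < cdim S" using rn by simp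
    from less.hyps[OF this T(1,3)] show ?thesis using T(2) by blast
  qed (use less.prems in blast)
qed

end

section \<open>Equivariant maps on the cellular chains\<close>

lemma clinear_extend_fun:
  "clinear_extend (\<lambda>s. b s + b' s) c = clinear_extend b c + clinear_extend b' c"
  "clinear_extend (\<lambda>s. cscale a (b s)) c = cscale a (clinear_extend b c)"
  "clinear_extend (\<lambda>s. 0) c = 0"
  by (simp_all add: clinear_extend_def cscale_add_right sum.distrib cscale_sum_right mult.commute)

lemma clinear_extend_expand:
  assumes "clinear_on UNIV f"
  shows "f (clinear_extend b c) = clinear_extend (\<lambda>s. f (b s)) c"
  using clinear_on_more(3)[OF _ assms, of "Poly_Mapping.keys c" "\<lambda>s. cscale (Poly_Mapping.lookup c s) (b s)"]
    clinear_onD(2)[OF assms] by (simp add: clinear_extend_def csubspace_def)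

lemma clinear_on_clinear_extend: "clinear_on S (clinear_extend b)"
  by (simp add: clinear_on_def clinear_extend_add clinear_extend_cscale)

context origami
begin

text \<open>The part of a chain on the top or on the right sides, moved to the top sides. Together the two components
  identify a chain with a pair of elements of the group algebra, whose elements are here the chains on top sides.\<close>

definition component :: "bool \<Rightarrow> ('g \<times> bool \<Rightarrow>\<^sub>0 complex) \<Rightarrow> ('g \<times> bool \<Rightarrow>\<^sub>0 complex)" where
  "component b = clinear_extend (\<lambda>e. if snd e = b then Poly_Mapping.single (fst e, True) 1 else 0)"

definition embed :: "bool \<Rightarrow> ('g \<times> bool \<Rightarrow>\<^sub>0 complex) \<Rightarrow> ('g \<times> bool \<Rightarrow>\<^sub>0 complex)" where
  "embed b = clinear_extend (\<lambda>e. Poly_Mapping.single (fst e, b) 1)"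

lemma component_linear: "component b (x + y) = component b x + component b y" "component b (cscale a x) = cscale a (component b x)" "component b 0 = 0"
  by (simp_all add: component_def clinear_extend_add clinear_extend_cscale)

lemma embed_linear: "embed b (x + y) = embed b x + embed b y" "embed b (cscale a x) = cscale a (embed b x)" "embed b 0 = 0"
  by (simp_all add: embed_def clinear_extend_add clinear_extend_cscale)

lemma component_embed:
  assumes "y \<in> supported (carrier G \<times> {True})"
  shows "component b (embed b' y) = (if b = b' then y else 0)"
proof -
  have "component b (embed b' y) = clinear_extend (\<lambda>e. if b = b' then Poly_Mapping.single (fst e, True) 1 else 0) y"
    unfolding component_def embed_def clinear_extend_clinear_extend by (rule clinear_extend_cong) auto
  also have "\<dots> = (if b = b' then clinear_extend (\<lambda>e. Poly_Mapping.single e 1) y else 0)"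
    using assms by (auto simp: supported_def clinear_extend_fun intro!: clinear_extend_cong)
  finally show ?thesis by (simp add: clinear_extend_ident)
qed

lemma embed_component: "embed True (component True x) + embed False (component False x) = x"
proof -
  have "embed True (component True x) + embed False (component False x) = clinear_extend (\<lambda>e. Poly_Mapping.single e 1) x"
    unfolding embed_def component_def clinear_extend_clinear_extend clinear_extend_fun(1)[symmetric]
    by (rule clinear_extend_cong) (auto simp: prod_eq_iff)
  then show ?thesis by (simp add: clinear_extend_ident)
qed

lemma embed_in: "y \<in> cell_chains \<Longrightarrow> embed b y \<in> cell_chains"
  unfolding embed_def cell_chains_def mem_Collect_eq by (rule keys_clinear_extend) auto

text \<open>The equivariant map that sends the top side of the square \<open>\<one>\<close> to \<open>component True z\<close> and its right side to
  \<open>component False z\<close>.\<close>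

definition \<phi> :: "('g \<times> bool \<Rightarrow>\<^sub>0 complex) \<Rightarrow> ('g \<times> bool \<Rightarrow>\<^sub>0 complex) \<Rightarrow> ('g \<times> bool \<Rightarrow>\<^sub>0 complex)" where
  "\<phi> z = clinear_extend (\<lambda>e. shift (fst e) (component (snd e) z))"

lemma \<phi>_linear: "\<phi> z (x + y) = \<phi> z x + \<phi> z y" "\<phi> z (x - y) = \<phi> z x - \<phi> z y" "\<phi> z (cscale a x) = cscale a (\<phi> z x)"
  "\<phi> z 0 = 0" "\<phi> z (\<Sum>i\<in>I. f i) = (\<Sum>i\<in>I. \<phi> z (f i))"
  by (simp_all add: \<phi>_def clinear_extend_add clinear_extend_cscale clinear_extend_diff clinear_extend_sum)

lemma \<phi>_linear_left: "\<phi> (z + z') x = \<phi> z x + \<phi> z' x" "\<phi> (cscale a z) x = cscale a (\<phi> z x)"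
  by (simp_all add: \<phi>_def component_linear shift_linear clinear_extend_fun)

lemma \<phi>_single: "\<phi> z (Poly_Mapping.single e a) = cscale a (shift (fst e) (component (snd e) z))"
  by (simp add: \<phi>_def)

lemma csubspace_clinear_extend:
  assumes "csubspace S" "\<And>s. s \<in> Poly_Mapping.keys c \<Longrightarrow> b s \<in> S"
  shows "clinear_extend b c \<in> S"
  unfolding clinear_extend_def by (intro csubspaceD(6)[OF assms(1)] csubspaceD(3)[OF assms(1)] assms(2))

lemma \<phi>_in:
  assumes Y: "invariant Y" and z: "\<And>b. component b z \<in> Y" and x: "x \<in> cell_chains"
  shows "\<phi> z x \<in> Y"
  unfolding \<phi>_def
  by (rule csubspace_clinear_extend[OF invariantD(1)[OF Y]]) (use x z invariantD(4)[OF Y] in \<open>auto simp: cell_chains_def\<close>)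

lemma \<phi>_shift:
  assumes z: "\<And>b. component b z \<in> cell_chains" and h: "h \<in> carrier G" and x: "x \<in> cell_chains"
  shows "\<phi> z (shift h x) = shift h (\<phi> z x)"
proof -
  have "\<phi> z (shift h x) = clinear_extend (\<lambda>e. shift (h \<otimes> fst e) (component (snd e) z)) x"
    unfolding \<phi>_def shift_def[of h] clinear_extend_clinear_extend by simp
  also have "\<dots> = clinear_extend (\<lambda>e. shift h (shift (fst e) (component (snd e) z))) x"
    by (rule clinear_extend_cong) (use x h z in \<open>auto simp: cell_chains_def shift_shift\<close>)
  also have "\<dots> = shift h (\<phi> z x)"
    unfolding \<phi>_def by (subst clinear_extend_expand) (auto simp: clinear_on_def shift_linear)
  finally show ?thesis .
qed

text \<open>The cellular chains are a free module on the top and right side of the square \<open>\<one>\<close>, so an equivariant map is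
  determined by two values.\<close>

lemma equivariant_eq_\<phi>:
  assumes f: "equivariant cell_chains f" and Y: "\<And>x. x \<in> cell_chains \<Longrightarrow> f x \<in> supported (carrier G \<times> {True})"
    and x: "x \<in> cell_chains"
  defines "z \<equiv> embed True (f (Poly_Mapping.single (\<one>, True) 1)) + embed False (f (Poly_Mapping.single (\<one>, False) 1))"
  shows "f x = \<phi> z x" "component b z = f (Poly_Mapping.single (\<one>, b) 1)"
proof -
  have s: "Poly_Mapping.single (g, b) 1 \<in> cell_chains" if "g \<in> carrier G" for g b
    using that by (simp add: cell_chains_def)
  have fs: "f (Poly_Mapping.single (\<one>, b) 1) \<in> supported (carrier G \<times> {True})" for b by (intro Y s) simp
  show c: "component b z = f (Poly_Mapping.single (\<one>, b) 1)" for b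
    by (cases b) (simp_all add: z_def component_linear component_embed[OF fs])
  have "f x = f (clinear_extend (\<lambda>e. Poly_Mapping.single e 1) x)" by (simp add: clinear_extend_ident)
  also have "\<dots> = clinear_extend (\<lambda>e. f (Poly_Mapping.single e 1)) x"
  proof -
    have "f (\<Sum>e\<in>Poly_Mapping.keys x. cscale (Poly_Mapping.lookup x e) (Poly_Mapping.single e 1))
        = (\<Sum>e\<in>Poly_Mapping.keys x. f (cscale (Poly_Mapping.lookup x e) (Poly_Mapping.single e 1)))"
      by (rule clinear_on_more(3)[OF invariantD(1)[OF invariant_cell_chains] equivariantD(1)[OF f]])
        (use x in \<open>auto simp: cell_chains_def\<close>)
    also have "\<dots> = (\<Sum>e\<in>Poly_Mapping.keys x. cscale (Poly_Mapping.lookup x e) (f (Poly_Mapping.single e 1)))"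
      by (rule sum.cong[OF refl], rule clinear_onD(2)[OF equivariantD(1)[OF f]]) (use x in \<open>auto simp: cell_chains_def\<close>)
    finally show ?thesis unfolding clinear_extend_def .
  qed
  also have "\<dots> = \<phi> z x"
    unfolding \<phi>_def
  proof (rule clinear_extend_cong)
    fix e assume "e \<in> Poly_Mapping.keys x"
    then have g: "fst e \<in> carrier G" using x by (auto simp: cell_chains_def)
    then have "Poly_Mapping.single e 1 = shift (fst e) (Poly_Mapping.single (\<one>, snd e) 1)"
      by (simp add: shift_single)
    then show "f (Poly_Mapping.single e 1) = shift (fst e) (component (snd e) z)"
      using equivariantD(2)[OF f g s[OF one_closed]] by (simp add: c)
  qed
  finally show "f x = \<phi> z x" .
qed

text \<open>The parameters \<open>z\<close> for which \<open>\<phi> z\<close> maps into \<open>Y\<close>.\<close>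

definition pairs :: "('g \<times> bool \<Rightarrow>\<^sub>0 complex) set \<Rightarrow> ('g \<times> bool \<Rightarrow>\<^sub>0 complex) set" where
  "pairs Y = {z \<in> cell_chains. \<forall>b. component b z \<in> Y}"

lemma csubspace_pairs:
  assumes "csubspace Y"
  shows "csubspace (pairs Y)"
  unfolding csubspace_def pairs_def
  using csubspaceD[OF assms] csubspaceD[OF invariantD(1)[OF invariant_cell_chains]] by (simp add: component_linear)

lemma embed_in_pairs:
  assumes Y: "csubspace Y" "Y \<subseteq> supported (carrier G \<times> {True})" and a: "a \<in> Y" and b: "b \<in> Y"
  shows "embed True a + embed False b \<in> pairs Y" "component True (embed True a + embed False b) = a" "component False (embed True a + embed False b) = b"
proof -
  have CT: "supported (carrier G \<times> {True}) \<subseteq> cell_chains" by (auto simp: supported_def cell_chains_def)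
  show c: "component True (embed True a + embed False b) = a" "component False (embed True a + embed False b) = b"
    using a b Y(2) by (simp_all add: component_linear component_embed subsetD)
  have ac: "a \<in> cell_chains" and bc: "b \<in> cell_chains" using a b Y(2) CT by blast+
  have e: "embed True a + embed False b \<in> cell_chains"
    by (intro csubspaceD(2)[OF invariantD(1)[OF invariant_cell_chains]] embed_in ac bc)
  have "component k (embed True a + embed False b) \<in> Y" for k by (cases k) (simp_all add: c a b)
  then show "embed True a + embed False b \<in> pairs Y" using e by (simp add: pairs_def)
qed

lemma cdim_pairs:
  assumes Y: "csubspace Y" "Y \<subseteq> supported (carrier G \<times> {True})"
  shows "cdim (pairs Y) = 2 * cdim Y"
proof -
  have sub: "pairs Y \<subseteq> supported (carrier G \<times> UNIV)" by (auto simp: pairs_def cell_chains_supported)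
  have cl: "clinear_on S (component b)" for S b by (simp add: clinear_on_def component_linear)
  have im: "component True ` pairs Y = Y"
  proof
    show "Y \<subseteq> component True ` pairs Y"
    proof
      fix a assume a: "a \<in> Y"
      show "a \<in> component True ` pairs Y"
        using embed_in_pairs[OF Y a csubspaceD(1)[OF Y(1)]] by (intro image_eqI[of _ _ "embed True a + embed False 0"]) simp_all
    qed
  qed (auto simp: pairs_def)
  let ?K = "{z \<in> pairs Y. component True z = 0}"
  have K: "csubspace ?K" by (rule csubspace_kernel[OF csubspace_pairs[OF Y(1)] cl])
  have im2: "component False ` ?K = Y"
  proof
    show "Y \<subseteq> component False ` ?K"
    proof
      fix a assume a: "a \<in> Y"
      show "a \<in> component False ` ?K"
        using embed_in_pairs[OF Y csubspaceD(1)[OF Y(1)] a] by (intro image_eqI[of _ _ "embed True 0 + embed False a"]) simp_all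
    qed
  qed (auto simp: pairs_def)
  have "cdim (component False ` ?K) = cdim ?K"
  proof (rule cdim_inj[OF K finite_cells _ cl])
    show "?K \<subseteq> supported (carrier G \<times> UNIV)" using sub by blast
    fix x assume "x \<in> ?K" "component False x = 0"
    then show "x = 0" using embed_component[of x] by (simp add: embed_linear)
  qed
  then show ?thesis
    using cdim_rank_nullity[OF csubspace_pairs[OF Y(1)] finite_cells sub cl, of True] unfolding im im2 by simp
qed

lemma face_in: "g \<in> carrier G \<Longrightarrow> cchain (face g) \<in> cell_chains"
proof -
  assume g: "g \<in> carrier G"
  have "Poly_Mapping.single (k, b) (1::complex) \<in> cell_chains" if "k \<in> carrier G" for k b
    using that by (simp add: cell_chains_def)
  then show ?thesis
    unfolding face_def cchain_simps
    by (intro csubspaceD(2,5)[OF invariantD(1)[OF invariant_cell_chains]]) (auto simp: g)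
qed

lemma shift_face:
  assumes "g \<in> carrier G"
  shows "cchain (face g) = shift g (cchain (face \<one>))"
  using assms by (simp add: face_def shift_linear shift_single)

lemma \<phi>_face:
  "\<phi> z (cchain (face \<one>)) = shift (inv u) (component True z) + shift \<one> (component False z) - shift \<one> (component True z) - shift (inv r) (component False z)"
  by (simp add: face_def \<phi>_linear \<phi>_single)

lemma \<phi>_kills_faces:
  assumes z: "\<And>b. component b z \<in> cell_chains" and 0: "\<phi> z (cchain (face \<one>)) = 0" and x: "x \<in> face_chains"
  shows "\<phi> z x = 0"
proof -
  have k: "\<phi> z (cchain (face g)) = 0" if "g \<in> carrier G" for g
    using \<phi>_shift[OF z that face_in[OF one_closed]] that 0 by (simp add: shift_face[of g] shift_linear)
  obtain y where y: "Poly_Mapping.keys y \<subseteq> carrier G" "x = clinear_extend (\<lambda>g. cchain (face g)) y"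
    using x by (auto simp: face_chains_def)
  have "\<phi> z x = clinear_extend (\<lambda>g. \<phi> z (cchain (face g))) y"
    unfolding y(2) by (rule clinear_extend_expand) (simp add: clinear_on_def \<phi>_linear)
  also have "\<dots> = clinear_extend (\<lambda>g. 0) y"
    by (rule clinear_extend_cong) (use k y(1) in auto)
  finally show ?thesis by (simp add: clinear_extend_fun)
qed

subsection \<open>Cycles are invariant, and faces are cycles\<close>

lemma cell_boundary_linear: "cell_boundary (x + y) = cell_boundary x + cell_boundary y"
  "cell_boundary (x - y) = cell_boundary x - cell_boundary y"
  "cell_boundary (cscale a x) = cscale a (cell_boundary x)" "cell_boundary 0 = 0" "cell_boundary (\<Sum>i\<in>I. f i) = (\<Sum>i\<in>I. cell_boundary (f i))"
  by (simp_all add: cell_boundary_def clinear_extend_add clinear_extend_cscale clinear_extend_diff clinear_extend_sum)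

lemma cell_boundary_single: "cell_boundary (Poly_Mapping.single (g, b) 1)
   = Poly_Mapping.single (vtx g) 1 - Poly_Mapping.single (vtx (g \<otimes> inv (step b))) 1"
  by (simp add: cell_boundary_def)

lemma aut_vtx: "h \<in> carrier G \<Longrightarrow> g \<in> carrier G \<Longrightarrow> origami_aut G h (vtx g) = vtx (h \<otimes> g)"
  by (simp add: vtx_def aut_q topspace_squares)

lemma cell_boundary_shift:
  assumes h: "h \<in> carrier G" and x: "x \<in> cell_chains"
  shows "cell_boundary (shift h x) = clinear_extend (\<lambda>v. Poly_Mapping.single (origami_aut G h v) 1) (cell_boundary x)"
  unfolding cell_boundary_def shift_def clinear_extend_clinear_extend
  by (rule clinear_extend_cong)
     (use x h in \<open>auto simp: cell_chains_def clinear_extend_diff aut_vtx m_assoc\<close>)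

lemma side_sum_linear: "side_sum b (x + y) = side_sum b x + side_sum b y" "side_sum b (x - y) = side_sum b x - side_sum b y"
  "side_sum b (cscale a x) = a * side_sum b x" "side_sum b (0 :: 'g \<times> bool \<Rightarrow>\<^sub>0 complex) = 0" "side_sum b (\<Sum>i\<in>I. f i) = (\<Sum>i\<in>I. side_sum b (f i))"
  for x y :: "'g \<times> bool \<Rightarrow>\<^sub>0 complex"
  by (simp_all add: side_sum_def cpair_add cpair_diff cpair_sum)

lemma side_sum_single: "side_sum b (Poly_Mapping.single e a) = (if snd e = b then a else 0)"
  by (simp add: side_sum_def)

lemma side_sum_shift: "side_sum b (shift h x) = side_sum b x"
  by (simp add: side_sum_def shift_def cpair_clinear_extend)

lemma invariant_cycles0: "invariant cycles0"
  unfolding invariant_def csubspace_def cycles0_def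
  using csubspaceD[OF invariantD(1)[OF invariant_cell_chains]]
  by (auto simp: cell_boundary_linear side_sum_linear side_sum_shift cell_boundary_shift shift_in)

lemma face_in_cycles0:
  assumes g: "g \<in> carrier G"
  shows "cchain (face g) \<in> cycles0"
proof -
  have "g \<otimes> inv u \<otimes> inv r \<otimes> commutator = g \<otimes> inv r \<otimes> inv u"
    using g by (simp add: m_assoc) (simp add: m_assoc[symmetric])
  then have "vtx (g \<otimes> inv r \<otimes> inv u) = vtx (g \<otimes> inv u \<otimes> inv r)"
    using vtx_commutator[of "g \<otimes> inv u \<otimes> inv r"] g by simp
  then have "cell_boundary (cchain (face g)) = 0"
    by (simp add: face_def cell_boundary_linear cell_boundary_single step_def)
  moreover have "side_sum b (cchain (face g)) = 0" for b
    by (simp add: face_def side_sum_linear side_sum_single)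
  ultimately show ?thesis using face_in[OF g] by (simp add: cycles0_def)
qed

lemma face_chains_subset: "face_chains \<subseteq> cycles0"
proof
  fix x assume "x \<in> face_chains"
  then obtain y where y: "Poly_Mapping.keys y \<subseteq> carrier G" "x = clinear_extend (\<lambda>g. cchain (face g)) y"
    by (auto simp: face_chains_def)
  show "x \<in> cycles0"
    unfolding y(2) by (rule csubspace_clinear_extend[OF invariantD(1)[OF invariant_cycles0]]) (use y(1) face_in_cycles0 in auto)
qed

lemma invariant_face_chains: "invariant face_chains"
  unfolding invariant_def
proof (intro conjI ballI)
  have eq: "{y :: 'g \<Rightarrow>\<^sub>0 complex. Poly_Mapping.keys y \<subseteq> carrier G} = supported (carrier G)" by (simp add: supported_def)
  show "csubspace face_chains"
    unfolding face_chains_def eq by (intro csubspace_image csubspace_supported clinear_on_clinear_extend)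
  show "face_chains \<subseteq> cell_chains" using face_chains_subset by (auto simp: cycles0_def)
  fix h x assume h: "h \<in> carrier G" and "x \<in> face_chains"
  then obtain y where y: "Poly_Mapping.keys y \<subseteq> carrier G" "x = clinear_extend (\<lambda>g. cchain (face g)) y"
    by (auto simp: face_chains_def)
  have "shift h x = clinear_extend (\<lambda>g. shift h (cchain (face g))) y"
    unfolding y(2) by (rule clinear_extend_expand) (simp add: clinear_on_def shift_linear)
  also have "\<dots> = clinear_extend (\<lambda>g. cchain (face (h \<otimes> g))) y"
  proof (rule clinear_extend_cong)
    fix g assume "g \<in> Poly_Mapping.keys y"
    then have g: "g \<in> carrier G" using y(1) by blast
    show "shift h (cchain (face g)) = cchain (face (h \<otimes> g))"
      unfolding shift_face[OF g] shift_face[OF m_closed[OF h g]] using g h by (simp add: shift_shift face_in)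
  qed
  also have "\<dots> = clinear_extend (\<lambda>g. cchain (face g)) (clinear_extend (\<lambda>g. Poly_Mapping.single (h \<otimes> g) 1) y)"
    by (simp add: clinear_extend_clinear_extend)
  finally show "shift h x \<in> face_chains"
    unfolding face_chains_def using y(1) h by (auto intro!: imageI keys_clinear_extend)
qed

end

context origami
begin

definition isomorphic :: "('g \<times> bool \<Rightarrow>\<^sub>0 complex) set \<Rightarrow> ('g \<times> bool \<Rightarrow>\<^sub>0 complex) set \<Rightarrow> bool" where
  "isomorphic S T \<longleftrightarrow> (\<exists>f. equivariant S f \<and> bij_betw f S T)"

lemma equivariant_inverse:
  assumes S: "invariant S" and f: "equivariant S f" "bij_betw f S T"
  shows "equivariant T (inv_into S f)"
proof -
  let ?g = "inv_into S f"
  have g: "?g y \<in> S" "f (?g y) = y" if "y \<in> T" for y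
    using that f(2) by (auto simp: bij_betw_def inv_into_into f_inv_into_f)
  have gf: "?g (f x) = x" if "x \<in> S" for x using that f(2) by (simp add: bij_betw_def)
  note c = csubspaceD[OF invariantD(1)[OF S]]
  have "?g (x + y) = ?g x + ?g y" if "x \<in> T" "y \<in> T" for x y
    using gf[OF c(2)[OF g(1)[OF that(1)] g(1)[OF that(2)]]] clinear_onD(1)[OF equivariantD(1)[OF f(1)]] g that by simp
  moreover have "?g (cscale a x) = cscale a (?g x)" if "x \<in> T" for a x
    using gf[OF c(3)[OF g(1)[OF that]]] clinear_onD(2)[OF equivariantD(1)[OF f(1)]] g that by metis
  moreover have "?g (shift h x) = shift h (?g x)" if "x \<in> T" "h \<in> carrier G" for h x
    using gf[OF invariantD(4)[OF S that(2) g(1)[OF that(1)]]] equivariantD(2)[OF f(1) that(2)] g that(1) by metis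
  ultimately show ?thesis by (simp add: equivariant_def clinear_on_def)
qed

lemma isomorphic_sym: "invariant S \<Longrightarrow> isomorphic S T \<Longrightarrow> isomorphic T S"
  unfolding isomorphic_def using equivariant_inverse bij_betw_inv_into by blast

lemma sum_shift_fixed:
  assumes x: "x \<in> cell_chains" and k: "k \<in> carrier G"
  shows "shift k (\<Sum>h\<in>carrier G. shift h x) = (\<Sum>h\<in>carrier G. shift h x)"
proof -
  have "shift k (\<Sum>h\<in>carrier G. shift h x) = (\<Sum>h\<in>carrier G. shift (k \<otimes> h) x)"
    unfolding shift_linear by (rule sum.cong) (use x k in \<open>auto simp: shift_shift\<close>)
  also have "\<dots> = (\<Sum>h\<in>carrier G. shift h x)"
  proof (rule sum.reindex_bij_betw)
    show "bij_betw ((\<otimes>) k) (carrier G) (carrier G)"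
      using k by (intro bij_betw_byWitness[where f' = "(\<otimes>) (inv k)"]) (auto simp: m_assoc[symmetric])
  qed
  finally show ?thesis .
qed

lemma sum_shift:
  assumes x: "x \<in> cell_chains"
  shows "(\<Sum>h\<in>carrier G. shift h x)
    = cscale (side_sum True x) (\<Sum>h\<in>carrier G. Poly_Mapping.single (h, True) 1) + cscale (side_sum False x) (\<Sum>h\<in>carrier G. Poly_Mapping.single (h, False) 1)"
proof -
  have "(\<Sum>h\<in>carrier G. shift h x) = clinear_extend (\<lambda>e. \<Sum>h\<in>carrier G. Poly_Mapping.single (h \<otimes> fst e, snd e) 1) x"
    by (simp add: shift_def clinear_extend_def cscale_sum_right sum.swap[of _ _ "carrier G"])
  also have "\<dots> = clinear_extend (\<lambda>e. \<Sum>h\<in>carrier G. Poly_Mapping.single (h, snd e) 1) x"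
  proof (rule clinear_extend_cong)
    fix e assume "e \<in> Poly_Mapping.keys x"
    then have g: "fst e \<in> carrier G" using x by (auto simp: cell_chains_def)
    have "bij_betw (\<lambda>h. h \<otimes> fst e) (carrier G) (carrier G)"
      using g by (intro bij_betw_byWitness[where f' = "\<lambda>h. h \<otimes> inv (fst e)"]) (auto simp: m_assoc)
    then show "(\<Sum>h\<in>carrier G. Poly_Mapping.single (h \<otimes> fst e, snd e) 1) = (\<Sum>h\<in>carrier G. Poly_Mapping.single (h, snd e) (1::complex))"
      by (rule sum.reindex_bij_betw[of _ _ _ "\<lambda>h. Poly_Mapping.single (h, snd e) 1"])
  qed
  also have "\<dots> = cscale (side_sum True x) (\<Sum>h\<in>carrier G. Poly_Mapping.single (h, True) 1) + cscale (side_sum False x) (\<Sum>h\<in>carrier G. Poly_Mapping.single (h, False) 1)"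
    by (rule clinear_extend_two_valued)
  finally show ?thesis .
qed

text \<open>The sum of the translates of a chain depends only on its two side sums (\<open>sum_shift\<close>), which are \<open>0\<close> here.\<close>

lemma fixed_cycle0_zero:
  assumes x: "x \<in> cycles0" and fx: "\<And>h. h \<in> carrier G \<Longrightarrow> shift h x = x"
  shows "x = 0"
proof -
  let ?N = "of_nat (card (carrier G)) :: complex"
  have N0: "?N \<noteq> 0" using finite_G by (simp add: card_gt_0_iff) (use one_closed in blast)
  have "cscale ?N x = (\<Sum>h\<in>carrier G. cscale 1 x)" by (simp only: cscale_sum_left[symmetric]) simp
  also have "\<dots> = (\<Sum>h\<in>carrier G. shift h x)" by (rule sum.cong) (simp_all add: fx)
  also have "\<dots> = 0" using sum_shift[of x] x by (simp add: cycles0_def)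
  finally have "cscale (1 / ?N) (cscale ?N x) = 0" by simp
  then show ?thesis using N0 by simp
qed

end

section \<open>Coboundaries of equivariant functions on the vertices\<close>

locale generated_origami = origami G r u for G :: "('g, 'b) monoid_scheme" (structure) and r u +
  assumes generated: "generate G {r, u} = carrier G"
begin

lemma subgroup_containing_generators:
  assumes "subgroup H G" "r \<in> H" "u \<in> H"
  shows "H = carrier G"
  using generate_subgroup_incl[of "{r, u}" H] assms generated subgroup.subset by blast

text \<open>A word in the generators is a path along the sides of the squares.\<close>

lemma vertices_connected:
  assumes "s \<in> carrier G" "g \<in> carrier G"
  shows "\<exists>x\<in>cell_chains. cell_boundary x = Poly_Mapping.single (vtx g) 1 - Poly_Mapping.single (vtx (g \<otimes> s)) 1"
proof -
  let ?d = "\<lambda>g k. Poly_Mapping.single (vtx g) (1::complex) - Poly_Mapping.single (vtx k) 1"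
  have cc: "csubspace cell_chains" by (rule invariantD(1)[OF invariant_cell_chains])
  have one_step: "\<exists>x\<in>cell_chains. cell_boundary x = ?d g (g \<otimes> inv (step b))" if "g \<in> carrier G" for g b
    using that by (intro bexI[of _ "Poly_Mapping.single (g, b) 1"]) (simp_all add: cell_boundary_single cell_chains_def)
  have flip: "\<exists>x\<in>cell_chains. cell_boundary x = ?d k g" if ex: "\<exists>x\<in>cell_chains. cell_boundary x = ?d g k" for g k
  proof -
    obtain x where x: "x \<in> cell_chains" "cell_boundary x = ?d g k" using ex by blast
    have "cell_boundary (0 - x) = ?d k g" by (simp only: cell_boundary_linear x(2)) simp
    then show ?thesis using csubspaceD(5)[OF cc csubspaceD(1)[OF cc] x(1)] by blast
  qed
  have gen: "s \<in> generate G {r, u}" using assms generated by simp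
  have "\<forall>g\<in>carrier G. \<exists>x\<in>cell_chains. cell_boundary x = ?d g (g \<otimes> s)"
    using gen
  proof (induction rule: generate.induct)
    case one
    show ?case by (intro ballI bexI[of _ 0] csubspaceD(1)[OF cc]) (simp add: cell_boundary_linear)
  next
    case (incl h)
    then obtain b where b: "h = step b" by (metis insertE singletonD step_def)
    show ?case
    proof
      fix g assume g: "g \<in> carrier G"
      have hc: "h \<in> carrier G" unfolding b by (rule step_in)
      have "\<exists>x\<in>cell_chains. cell_boundary x = ?d (g \<otimes> h) (g \<otimes> h \<otimes> inv h)"
        using one_step[OF m_closed[OF g hc], of b] unfolding b[symmetric] .
      moreover have "g \<otimes> h \<otimes> inv h = g" using g hc by (simp add: m_assoc)
      ultimately have "\<exists>x\<in>cell_chains. cell_boundary x = ?d (g \<otimes> h) g" by simp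
      then show "\<exists>x\<in>cell_chains. cell_boundary x = ?d g (g \<otimes> h)" by (rule flip)
    qed
  next
    case (inv h)
    then obtain b where b: "h = step b" by (metis insertE singletonD step_def)
    show ?case unfolding b using one_step by blast
  next
    case (eng h k)
    have hk: "h \<in> carrier G" "k \<in> carrier G" using eng.hyps generated by simp_all
    show ?case
    proof
      fix g assume g: "g \<in> carrier G"
      obtain x where x: "x \<in> cell_chains" "cell_boundary x = ?d g (g \<otimes> h)" using eng.IH(1) g by blast
      obtain y where y: "y \<in> cell_chains" "cell_boundary y = ?d (g \<otimes> h) (g \<otimes> h \<otimes> k)" using eng.IH(2) g hk by blast
      have "cell_boundary (x + y) = ?d g (g \<otimes> (h \<otimes> k))"
        using g hk by (simp add: cell_boundary_linear x y m_assoc)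
      then show "\<exists>x\<in>cell_chains. cell_boundary x = ?d g (g \<otimes> (h \<otimes> k))"
        using csubspaceD(2)[OF cc x(1) y(1)] by blast
    qed
  qed
  then show ?thesis using assms by blast
qed

text \<open>A combination of paths from all vertices to a base vertex. Divided by the order of \<open>G\<close> it connects the average of
  all vertices with the base vertex, and this average is invariant under \<open>G\<close>.\<close>

lemma base_chain_exists:
  "\<exists>p\<in>cell_chains. cell_boundary p = cscale (of_nat (card (carrier G))) (Poly_Mapping.single (vtx \<one>) 1) - (\<Sum>k\<in>carrier G. Poly_Mapping.single (vtx k) 1)"
proof -
  have "\<forall>k\<in>carrier G. \<exists>x. x \<in> cell_chains \<and> cell_boundary x = Poly_Mapping.single (vtx \<one>) 1 - Poly_Mapping.single (vtx k) 1"
    using vertices_connected[OF _ one_closed] by (simp add: Bex_def)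
  from bchoice[OF this] obtain x where x: "\<And>k. k \<in> carrier G \<Longrightarrow> x k \<in> cell_chains"
    "\<And>k. k \<in> carrier G \<Longrightarrow> cell_boundary (x k) = Poly_Mapping.single (vtx \<one>) 1 - Poly_Mapping.single (vtx k) 1" by blast
  have "cell_boundary (\<Sum>k\<in>carrier G. x k) = (\<Sum>k\<in>carrier G. cscale 1 (Poly_Mapping.single (vtx \<one>) 1)) - (\<Sum>k\<in>carrier G. Poly_Mapping.single (vtx k) 1)"
    by (simp add: cell_boundary_linear x(2) sum_subtractf)
  then have "cell_boundary (\<Sum>k\<in>carrier G. x k) = cscale (of_nat (card (carrier G))) (Poly_Mapping.single (vtx \<one>) 1) - (\<Sum>k\<in>carrier G. Poly_Mapping.single (vtx k) 1)"
    by (simp only: cscale_sum_left[symmetric]) simp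
  moreover have "(\<Sum>k\<in>carrier G. x k) \<in> cell_chains"
    by (intro csubspaceD(6)[OF invariantD(1)[OF invariant_cell_chains]] x(1))
  ultimately show ?thesis by (rule bexI)
qed

text \<open>If \<open>w\<close> is fixed by the commutator, this is the coboundary of the equivariant function on the vertices whose
  value at the upper right corner of the square \<open>g\<close> is \<open>shift g w\<close>. The top side of the square \<open>\<one>\<close> starts at the
  upper right corner of the square \<open>inv r\<close>, and its right side at that of \<open>inv u\<close>.\<close>

definition \<delta> :: "('g \<times> bool \<Rightarrow>\<^sub>0 complex) \<Rightarrow> ('g \<times> bool \<Rightarrow>\<^sub>0 complex)" where
  "\<delta> w = embed True (w - shift (inv r) w) + embed False (w - shift (inv u) w)"

text \<open>Since \<open>w\<close> is fixed by the commutator, the function \<open>\<psi>\<close> that sends the vertex of the square \<open>g\<close> to \<open>shift g w\<close> is well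
  defined, and \<open>\<phi> (\<delta> w)\<close> is the boundary followed by \<open>\<psi>\<close>.\<close>

lemma \<delta>_kills_cycles:
  assumes w: "w \<in> cell_chains" "w \<in> supported (carrier G \<times> {True})" "shift (inv r) w \<in> supported (carrier G \<times> {True})"
      "shift (inv u) w \<in> supported (carrier G \<times> {True})" "shift commutator w = w"
    and x: "x \<in> cell_chains" "cell_boundary x = 0"
  shows "\<phi> (\<delta> w) x = 0"
proof -
  have d: "component b (\<delta> w) = w - shift (inv (step b)) w" for b
  proof -
    have "w - shift (inv r) w \<in> supported (carrier G \<times> {True})" "w - shift (inv u) w \<in> supported (carrier G \<times> {True})"
      by (intro csubspaceD(5)[OF csubspace_supported] w)+
    then show ?thesis by (cases b) (simp_all add: \<delta>_def component_linear component_embed step_def)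
  qed
  have fix_gen: "shift s w = w" if "s \<in> generate G {commutator}" for s
    using that
  proof (induction rule: generate.induct)
    case one
    then show ?case by (simp add: shift_one w)
  next
    case (incl h)
    then show ?case using w by simp
  next
    case (inv h)
    then show ?case using shift_inv(1)[of commutator w] w by simp
  next
    case (eng h k)
    have "generate G {commutator} \<subseteq> carrier G" by (rule generate_incl) simp
    then have "shift (h \<otimes> k) w = shift h (shift k w)" using eng.hyps w(1) by (subst shift_shift) auto
    then show ?case by (simp only: eng.IH)
  qed
  define \<psi> where "\<psi> v = shift (SOME g. g \<in> carrier G \<and> vtx g = v) w" for v
  have \<psi>: "\<psi> (vtx g) = shift g w" if g: "g \<in> carrier G" for g
  proof -
    define k where "k = (SOME k. k \<in> carrier G \<and> vtx k = vtx g)"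
    have k: "k \<in> carrier G \<and> vtx k = vtx g" unfolding k_def by (rule someI[of _ g]) (simp add: g)
    then obtain s where s: "s \<in> generate G {commutator}" "k = g \<otimes> s" using vtx_eq_iff[OF g, of k] by auto
    have "generate G {commutator} \<subseteq> carrier G" by (rule generate_incl) simp
    then have "shift k w = shift g (shift s w)" unfolding s(2) using s(1) g w(1) by (subst shift_shift) auto
    then show ?thesis by (simp add: \<psi>_def k_def[symmetric] fix_gen[OF s(1)])
  qed
  have "\<phi> (\<delta> w) x = clinear_extend \<psi> (cell_boundary x)"
    unfolding \<phi>_def cell_boundary_def clinear_extend_clinear_extend
  proof (rule clinear_extend_cong)
    fix e assume "e \<in> Poly_Mapping.keys x"
    then have g: "fst e \<in> carrier G" using x by (auto simp: cell_chains_def)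
    show "shift (fst e) (component (snd e) (\<delta> w)) = clinear_extend \<psi> (case e of (g, b) \<Rightarrow> Poly_Mapping.single (vtx g) 1 - Poly_Mapping.single (vtx (g \<otimes> inv (step b))) 1)"
      using g w(1) by (cases e) (simp add: d clinear_extend_diff \<psi> shift_linear shift_shift)
  qed
  then show ?thesis by (simp add: x)
qed

text \<open>A map that vanishes on cycles factors through the boundary, so its values on sides are differences of values of
  a function on the vertices. The value at the vertex of the square \<open>h\<close> is obtained from a chain that connects the
  average of all vertices with it; this choice makes the function equivariant.\<close>

lemma killing_cycles_is_\<delta>:
  assumes z: "z \<in> cell_chains" "\<And>b. component b z \<in> Y" and Y: "invariant Y" "Y \<subseteq> supported (carrier G \<times> {True})"
    and kill: "\<And>x. x \<in> cell_chains \<Longrightarrow> cell_boundary x = 0 \<Longrightarrow> \<phi> z x = 0"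
  shows "\<exists>w\<in>Y. shift commutator w = w \<and> z = \<delta> w"
proof -
  let ?N = "of_nat (card (carrier G)) :: complex"
  let ?S = "\<Sum>k\<in>carrier G. Poly_Mapping.single (vtx k) (1::complex)"
  have N0: "?N \<noteq> 0" using finite_G by (simp add: card_gt_0_iff) (use one_closed in blast)
  note cc = csubspaceD[OF invariantD(1)[OF invariant_cell_chains]]
  have zc: "component b z \<in> cell_chains" for b using z(2) invariantD(2)[OF Y(1)] by blast
  obtain p where p: "p \<in> cell_chains" "cell_boundary p = cscale ?N (Poly_Mapping.single (vtx \<one>) 1) - ?S"
    using base_chain_exists by blast
  have ps: "cell_boundary (shift h p) = cscale ?N (Poly_Mapping.single (vtx h) 1) - ?S" if h: "h \<in> carrier G" for h
  proof -
    have "clinear_extend (\<lambda>v. Poly_Mapping.single (origami_aut G h v) 1) ?S = (\<Sum>k\<in>carrier G. Poly_Mapping.single (vtx (h \<otimes> k)) 1)"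
      unfolding clinear_extend_sum by (rule sum.cong) (use h in \<open>simp_all add: aut_vtx\<close>)
    also have "\<dots> = ?S"
    proof (rule sum.reindex_bij_betw[of _ _ _ "\<lambda>k. Poly_Mapping.single (vtx k) 1"])
      show "bij_betw ((\<otimes>) h) (carrier G) (carrier G)"
        using h by (intro bij_betw_byWitness[where f' = "(\<otimes>) (inv h)"]) (auto simp: m_assoc[symmetric])
    qed
    finally show ?thesis
      using h by (simp add: cell_boundary_shift[OF h p(1)] p(2) clinear_extend_diff aut_vtx)
  qed
  define w where "w = cscale (1 / ?N) (\<phi> z p)"
  have wY: "w \<in> Y"
    unfolding w_def by (rule csubspaceD(3)[OF invariantD(1)[OF Y(1)] \<phi>_in[OF Y(1) z(2) p(1)]])
  have wc: "w \<in> cell_chains" using wY invariantD(2)[OF Y(1)] by blast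
  have Nw: "cscale ?N w = \<phi> z p" using N0 by (simp add: w_def)
  have component: "component b z = w - shift (inv (step b)) w" for b
  proof -
    let ?e = "Poly_Mapping.single (\<one>, b) 1 :: 'g \<times> bool \<Rightarrow>\<^sub>0 complex"
    \<comment> \<open>the side \<open>?e\<close>, preceded and followed by the connections of its endpoints with the average, is a cycle\<close>
    let ?x = "cscale ?N ?e - p + shift (inv (step b)) p"
    have ec: "?e \<in> cell_chains" by (simp add: cell_chains_def)
    have xc: "?x \<in> cell_chains" by (intro cc(2) cc(5) cc(3) ec p(1) shift_in) simp
    have "cell_boundary ?x = 0"
      unfolding cell_boundary_linear cell_boundary_single p(2) ps[OF inv_closed[OF step_in]]
      by (simp add: cscale_diff_right)
    then have "\<phi> z ?x = 0" using kill xc by blast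
    then have "cscale ?N (component b z) - cscale ?N w + shift (inv (step b)) (cscale ?N w) = 0"
      using \<phi>_shift[OF zc _ p(1), of "inv (step b)"] zc[of b] by (simp add: \<phi>_linear \<phi>_single Nw shift_one)
    then have "cscale ?N (component b z - w + shift (inv (step b)) w) = 0"
      by (simp add: cscale_add_right cscale_diff_right shift_linear)
    then have "cscale (1 / ?N) (cscale ?N (component b z - w + shift (inv (step b)) w)) = 0" by simp
    then have "component b z - w + shift (inv (step b)) w = 0" using N0 by simp
    then show ?thesis by (simp add: algebra_simps eq_neg_iff_add_eq_0)
  qed
  have "shift commutator w = w"
  proof -
    have vc: "vtx commutator = vtx \<one>" using vtx_commutator[of \<one>] by simp
    have "cell_boundary (shift commutator p - p) = 0"
      using ps[of commutator] by (simp add: cell_boundary_linear p(2) vc)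
    then have "\<phi> z (shift commutator p - p) = 0"
      using kill p(1) by (simp add: cc(5) shift_in)
    then have "shift commutator (\<phi> z p) = \<phi> z p" using \<phi>_shift[OF zc _ p(1), of commutator] by (simp add: \<phi>_linear)
    then show ?thesis by (simp add: w_def shift_linear)
  qed
  moreover have "z = \<delta> w"
    using embed_component[of z] component[of True] component[of False] by (simp add: \<delta>_def step_def)
  ultimately show ?thesis using wY by blast
qed

end

section \<open>Counting isomorphic summands\<close>

context origami
begin

definition decomposition :: "('g \<times> bool \<Rightarrow>\<^sub>0 complex) set \<Rightarrow> nat \<Rightarrow> (nat \<Rightarrow> ('g \<times> bool \<Rightarrow>\<^sub>0 complex) set) \<Rightarrow> bool" where
  "decomposition H n S \<longleftrightarrow> (\<forall>i<n. irreducible (S i) \<and> S i \<subseteq> H) \<and>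
     (\<forall>x\<in>H. \<exists>!w. w \<in> (\<Pi>\<^sub>E i\<in>{..<n}. S i) \<and> (\<Sum>i<n. w i) = x)"

text \<open>Split off irreducible subspaces one by one, each with an equivariant projection.\<close>

lemma decomposition_exists:
  assumes "invariant H"
  shows "\<exists>n S. decomposition H n S"
  using assms
proof (induction "cdim H" arbitrary: H rule: less_induct)
  case less
  note H = invariantD[OF less.prems]
  note cH = csubspaceD[OF H(1)]
  show ?case
  proof (cases "H = {0}")
    case True
    then have "decomposition H 0 (\<lambda>_. {})" by (auto simp: decomposition_def)
    then show ?thesis by blast
  next
    case False
    then obtain T where T: "irreducible T" "T \<subseteq> H" using irreducible_exists[OF less.prems] by blast
    then have iT: "invariant T" by (simp add: irreducible_def)
    note cT = csubspaceD[OF invariantD(1)[OF iT]]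
    obtain p where p: "equivariant cell_chains p" "\<And>x. x \<in> cell_chains \<Longrightarrow> p x \<in> T" "\<And>x. x \<in> T \<Longrightarrow> p x = x"
      by (rule equivariant_projection_exists[OF iT]) (rule that)
    have pH: "equivariant H p" by (rule equivariant_subset[OF p(1) H(2)])
    note pl = clinear_onD[OF equivariantD(1)[OF pH]] clinear_on_more[OF H(1) equivariantD(1)[OF pH]]
    define K where "K = {x \<in> H. p x = 0}"
    have K: "invariant K" unfolding K_def by (rule invariant_kernel[OF less.prems pH])
    have pim: "p ` H = T" using p T(2) H(2) by force
    have "cdim H = cdim T + cdim K"
      using cdim_rank_nullity[OF H(1) finite_cells H(3) equivariantD(1)[OF pH]] unfolding pim K_def .
    moreover have "cdim T \<noteq> 0"
    proof
      assume z: "cdim T = 0"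
      interpret V: vectorspace complex_ring "chains T" by (rule vectorspace_chains[OF invariantD(1)[OF iT]])
      have fd: "V.fin_dim" by (rule fin_dim_chains[OF invariantD(1)[OF iT] finite_cells invariantD(3)[OF iT]])
      obtain B where B: "finite B" "V.basis B" using V.finite_basis_exists[OF fd] by blast
      then have "card B = 0" using z V.dim_basis[OF B] by simp
      then have "B = {}" using B(1) by simp
      then have "V.span {} = T" using B(2) by (simp add: V.basis_def)
      then have "T = {0}" by (simp add: V.span_empty)
      then show False using T(1) by (simp add: irreducible_def)
    qed
    ultimately have "cdim K < cdim H" by simp
    from less.hyps[OF this K] obtain n S where S: "decomposition K n S" by blast
    have KH: "K \<subseteq> H" by (auto simp: K_def)
    have Si: "irreducible (S i)" "S i \<subseteq> K" if "i < n" for i using S that by (auto simp: decomposition_def)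
    define S' where "S' i = (if i = n then T else S i)" for i
    have "\<exists>!w. w \<in> (\<Pi>\<^sub>E i\<in>{..<Suc n}. S' i) \<and> (\<Sum>i<Suc n. w i) = x" if x: "x \<in> H" for x
    proof -
      have xT: "p x \<in> T" using p(2) H(2) x by blast
      have xK: "x - p x \<in> K"
        unfolding K_def using x xT T(2) pl(4)[OF x, of "p x"] p(3)[OF xT] cH(5) by auto
      then obtain w where w: "w \<in> (\<Pi>\<^sub>E i\<in>{..<n}. S i)" "(\<Sum>i<n. w i) = x - p x"
        and uniq: "\<And>w'. w' \<in> (\<Pi>\<^sub>E i\<in>{..<n}. S i) \<Longrightarrow> (\<Sum>i<n. w' i) = x - p x \<Longrightarrow> w' = w"
        using S unfolding decomposition_def by metis
      show ?thesis
      proof (rule ex1I[of _ "w(n := p x)"])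
        show "w(n := p x) \<in> (\<Pi>\<^sub>E i\<in>{..<Suc n}. S' i) \<and> (\<Sum>i<Suc n. (w(n := p x)) i) = x"
          using w xT by (auto simp: PiE_iff S'_def extensional_def less_Suc_eq)
      next
        fix v assume v: "v \<in> (\<Pi>\<^sub>E i\<in>{..<Suc n}. S' i) \<and> (\<Sum>i<Suc n. v i) = x"
        then have vS': "v i \<in> S' i" if "i < Suc n" for i using that by (auto simp: PiE_iff)
        have vS: "v i \<in> S i" if "i < n" for i using vS'[of i] that by (simp add: S'_def)
        have vT: "v n \<in> T" using vS'[of n] by (simp add: S'_def)
        have vK: "(\<Sum>i<n. v i) \<in> K"
          by (rule csubspaceD(6)[OF invariantD(1)[OF K]]) (use vS Si(2) in blast)
        have xs: "x = (\<Sum>i<n. v i) + v n" using v by simp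
        have "p x = p (\<Sum>i<n. v i) + p (v n)"
          unfolding xs using vK KH vT T(2) by (intro pl(1)) auto
        then have pv: "p x = v n" using vK p(3)[OF vT] by (simp add: K_def)
        have "restrict v {..<n} = w"
          by (rule uniq) (use vS xs pv in \<open>auto simp: PiE_iff\<close>)
        then have "w i = v i" if "i < n" for i using that by auto
        moreover have "v i = undefined" if "i \<ge> Suc n" for i
          using v that by (auto simp: PiE_iff extensional_def)
        moreover have "w i = undefined" if "i \<ge> n" for i
          using w(1) that by (auto simp: PiE_iff extensional_def)
        ultimately have "v i = (w(n := p x)) i" for i
          using pv by (cases "i < n"; cases "i = n") simp_all
        then show "v = w(n := p x)" by (rule ext)
      qed
    qed
    moreover have "irreducible (S' i) \<and> S' i \<subseteq> H" if "i < Suc n" for i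
      using that Si[of i] T KH by (auto simp: S'_def less_Suc_eq)
    ultimately have "decomposition H (Suc n) S'" by (simp add: decomposition_def)
    then show ?thesis by blast
  qed
qed

lemma decomposition_projections:
  assumes H: "invariant H" and S: "decomposition H n S"
  obtains pr where "\<And>i. i < n \<Longrightarrow> equivariant H (pr i)" "\<And>i x. i < n \<Longrightarrow> x \<in> H \<Longrightarrow> pr i x \<in> S i"
    "\<And>x. x \<in> H \<Longrightarrow> x = (\<Sum>i<n. pr i x)" "\<And>i j x. i < n \<Longrightarrow> j < n \<Longrightarrow> x \<in> S i \<Longrightarrow> pr j x = (if j = i then x else 0)"
proof -
  have Si: "invariant (S i)" "S i \<subseteq> H" if "i < n" for i
    using S that by (auto simp: decomposition_def irreducible_def)
  note cS = csubspaceD[OF invariantD(1)[OF Si(1)]]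
  note cH = csubspaceD[OF invariantD(1)[OF H]]
  define w where "w x = (THE w. w \<in> (\<Pi>\<^sub>E i\<in>{..<n}. S i) \<and> (\<Sum>i<n. w i) = x)" for x
  have ex1: "\<exists>!w. w \<in> (\<Pi>\<^sub>E i\<in>{..<n}. S i) \<and> (\<Sum>i<n. w i) = x" if "x \<in> H" for x
    using S that unfolding decomposition_def by blast
  have w: "w x \<in> (\<Pi>\<^sub>E i\<in>{..<n}. S i) \<and> (\<Sum>i<n. w x i) = x" if "x \<in> H" for x
    unfolding w_def by (rule theI'[OF ex1[OF that]])
  have wS: "w x i \<in> S i" if "x \<in> H" "i < n" for x i
    using w[OF that(1)] that(2) by (auto simp: PiE_iff)
  have wu: "w x i = v i" if "x \<in> H" "\<And>i. i < n \<Longrightarrow> v i \<in> S i" "(\<Sum>i<n. v i) = x" "i < n" for x v i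
  proof -
    have "restrict v {..<n} \<in> (\<Pi>\<^sub>E i\<in>{..<n}. S i) \<and> (\<Sum>i<n. restrict v {..<n} i) = x"
      using that by auto
    then have "w x = restrict v {..<n}" using w[OF that(1)] ex1[OF that(1)] by blast
    then show ?thesis using that(4) by simp
  qed
  show ?thesis
  proof (rule that[of "\<lambda>i x. w x i"])
    fix i assume i: "i < n"
    show "equivariant H (\<lambda>x. w x i)"
      unfolding equivariant_def clinear_on_def
    proof (intro conjI ballI allI)
      fix x y assume xy: "x \<in> H" "y \<in> H"
      show "w (x + y) i = w x i + w y i"
        by (rule wu) (use xy i cH(2) cS(2) wS w in \<open>auto simp: sum.distrib\<close>)
    next
      fix a x assume x: "x \<in> H"
      show "w (cscale a x) i = cscale a (w x i)"
        by (rule wu) (use x i cH(3) cS(3) wS w in \<open>auto simp: cscale_sum_right[symmetric]\<close>)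
    next
      fix h x assume hx: "h \<in> carrier G" "x \<in> H"
      show "w (shift h x) i = shift h (w x i)"
        by (rule wu) (use hx i invariantD(4)[OF H] invariantD(4)[OF Si(1)] wS w in \<open>auto simp: shift_linear(4)[symmetric]\<close>)
    qed
  next
    fix i j x assume ij: "i < n" "j < n" and x: "x \<in> S i"
    show "w x j = (if j = i then x else 0)"
      by (rule wu) (use ij x Si(2) cS(1) in \<open>auto simp: sum.delta\<close>)
  qed (use w wS in auto)
qed

end

context generated_origami
begin

definition fixed :: "'g \<Rightarrow> ('g \<times> bool \<Rightarrow>\<^sub>0 complex) set \<Rightarrow> ('g \<times> bool \<Rightarrow>\<^sub>0 complex) set" where
  "fixed h Y = {y \<in> Y. shift h y = y}"

text \<open>The image \<open>J\<close> contains \<open>shift (inv u) a - a\<close> and \<open>b - shift (inv r) b\<close> for all \<open>a\<close> and \<open>b\<close> in \<open>Y\<close>, so that \<open>G\<close> acts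
  trivially modulo \<open>J\<close>. Hence \<open>J\<close> is invariant, and it is \<open>Y\<close> unless it is \<open>0\<close> and \<open>G\<close> acts trivially on \<open>Y\<close>.\<close>

lemma \<phi>_face_image:
  assumes Y: "irreducible Y" "Y \<subseteq> supported (carrier G \<times> {True})"
  defines "J \<equiv> (\<lambda>z. \<phi> z (cchain (face \<one>))) ` pairs Y"
  shows "J = Y \<or> (\<forall>h\<in>carrier G. \<forall>y\<in>Y. shift h y = y)"
proof -
  have iY: "invariant Y" using Y by (simp add: irreducible_def)
  note cY = csubspaceD[OF invariantD(1)[OF iY]]
  have Yc: "y \<in> cell_chains" if "y \<in> Y" for y using that invariantD(2)[OF iY] by blast
  have J: "csubspace J"
    unfolding J_def by (intro csubspace_image csubspace_pairs invariantD(1)[OF iY]) (simp add: clinear_on_def \<phi>_linear_left)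
  have JY: "J \<subseteq> Y"
    unfolding J_def using \<phi>_in[OF iY _ face_in[OF one_closed]] by (auto simp: pairs_def)
  note cJ = csubspaceD[OF J]
  have ab: "shift (inv u) a + b - a - shift (inv r) b \<in> J" if "a \<in> Y" "b \<in> Y" for a b
    unfolding J_def using embed_in_pairs[OF invariantD(1)[OF iY] Y(2) that] that Yc
    by (intro image_eqI[of _ _ "embed True a + embed False b"]) (simp_all add: \<phi>_face shift_one)
  define Hs where "Hs = {h \<in> carrier G. \<forall>y\<in>Y. shift h y - y \<in> J}"
  have "subgroup Hs G"
  proof (rule subgroupI)
    show "Hs \<subseteq> carrier G" by (auto simp: Hs_def)
    show "Hs \<noteq> {}" using cJ(1) Yc shift_one by (auto simp: Hs_def intro!: exI[of _ \<one>])
  next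
    fix h assume "h \<in> Hs"
    then have h: "h \<in> carrier G" "\<And>y. y \<in> Y \<Longrightarrow> shift h y - y \<in> J" by (auto simp: Hs_def)
    have "shift (inv h) y - y \<in> J" if y: "y \<in> Y" for y
    proof -
      have "shift (inv h) y \<in> Y" using invariantD(4)[OF iY] h y by simp
      from cJ(4)[OF h(2)[OF this]] show ?thesis using shift_inv(2)[OF h(1) Yc[OF y]] by simp
    qed
    then show "inv h \<in> Hs" using h by (simp add: Hs_def)
  next
    fix h k assume "h \<in> Hs" "k \<in> Hs"
    then have h: "h \<in> carrier G" "\<And>y. y \<in> Y \<Longrightarrow> shift h y - y \<in> J" and k: "k \<in> carrier G" "\<And>y. y \<in> Y \<Longrightarrow> shift k y - y \<in> J"
      by (auto simp: Hs_def)
    have "shift (h \<otimes> k) y - y \<in> J" if y: "y \<in> Y" for y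
    proof -
      have "shift k y \<in> Y" using invariantD(4)[OF iY] k y by simp
      from cJ(2)[OF h(2)[OF this] k(2)[OF y]] show ?thesis
        using shift_shift[OF h(1) k(1) Yc[OF y]] by simp
    qed
    then show "h \<otimes> k \<in> Hs" using h k by (simp add: Hs_def)
  qed
  moreover have "inv u \<in> Hs"
    using ab[OF _ cY(1)] by (simp add: Hs_def shift_linear)
  moreover have "inv r \<in> Hs"
    using cJ(4)[OF ab[OF cY(1)]] by (simp add: Hs_def shift_linear)
  ultimately have "r \<in> Hs" "u \<in> Hs"
    using subgroup.m_inv_closed[of Hs G "inv r"] subgroup.m_inv_closed[of Hs G "inv u"] by simp_all
  then have Hs: "Hs = carrier G" using subgroup_containing_generators \<open>subgroup Hs G\<close> by blast
  have "invariant J"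
    unfolding invariant_def
  proof (intro conjI ballI J)
    show "J \<subseteq> cell_chains" using JY invariantD(2)[OF iY] by blast
    fix h j assume h: "h \<in> carrier G" and j: "j \<in> J"
    have "shift h j - j \<in> J" using h j JY Hs by (auto simp: Hs_def)
    from cJ(2)[OF this j] show "shift h j \<in> J" by simp
  qed
  then have "J = {0} \<or> J = Y" using Y(1) JY by (simp add: irreducible_def)
  then show ?thesis
  proof
    assume 0: "J = {0}"
    have "shift h y = y" if "h \<in> carrier G" "y \<in> Y" for h y
    proof -
      have "shift h y - y \<in> J" using that Hs by (auto simp: Hs_def)
      then show ?thesis using 0 by simp
    qed
    then show ?thesis by blast
  qed simp
qed

text \<open>If \<open>G\<close> acts trivially on \<open>Y\<close>, no summand is isomorphic to \<open>Y\<close>. Otherwise let \<open>P\<close> be the space of equivariant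
  maps from the cellular chains to \<open>Y\<close> that vanish on the faces. By Schur's
  lemma the restriction of such a map to a summand isomorphic to \<open>Y\<close> is a multiple of a fixed isomorphism. The
  list \<open>L\<close> of these scalars is a linear map on \<open>P\<close>. It is onto because every equivariant map on the summands extends
  to all cellular chains, and its kernel consists of the coboundaries of equivariant functions on the vertices.\<close>

theorem count_summands:
  assumes Y: "irreducible Y" "Y \<subseteq> supported (carrier G \<times> {True})"
    and p0: "equivariant cell_chains p0" "\<And>x. x \<in> cell_chains \<Longrightarrow> p0 x \<in> face_chains" "\<And>x. x \<in> face_chains \<Longrightarrow> p0 x = x"
    and S: "decomposition {x \<in> cycles0. p0 x = 0} n S"
  shows "card {i. i < n \<and> isomorphic Y (S i)} + cdim (fixed commutator Y) = cdim Y"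
proof -
  let ?H = "{x \<in> cycles0. p0 x = 0}" and ?F1 = "cchain (face \<one>)"
  define I where "I = {i. i < n \<and> isomorphic Y (S i)}"
  have finI: "finite I" by (simp add: I_def)
  have iY: "invariant Y" using Y by (simp add: irreducible_def)
  note cY = csubspaceD[OF invariantD(1)[OF iY]]
  have Yc: "y \<in> cell_chains" if "y \<in> Y" for y using that invariantD(2)[OF iY] by blast
  have cyc: "cycles0 \<subseteq> cell_chains" by (auto simp: cycles0_def)
  have iH: "invariant ?H"
    by (rule invariant_kernel[OF invariant_cycles0 equivariant_subset[OF p0(1) cyc]])
  have Hc: "?H \<subseteq> cell_chains" using cyc by blast
  have Sirr: "irreducible (S i)" and SH: "S i \<subseteq> ?H" if "i < n" for i using S that by (auto simp: decomposition_def)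
  have iS: "invariant (S i)" if "i < n" for i using Sirr[OF that] by (simp add: irreducible_def)
  obtain y0 where y0: "y0 \<in> Y" "y0 \<noteq> 0" using Y(1) cY(1) by (auto simp: irreducible_def)
  have Snz: "\<exists>x. x \<in> S i \<and> x \<noteq> 0" if "i < n" for i
    using Sirr[OF that] csubspaceD(1)[OF invariantD(1)[OF iS[OF that]]] by (auto simp: irreducible_def)
  show ?thesis
  proof (cases "\<forall>h\<in>carrier G. \<forall>y\<in>Y. shift h y = y")
    case True
    have "I = {}"
    proof (rule ccontr)
      assume "I \<noteq> {}"
      then obtain i f where i: "i < n" and f: "equivariant Y f" "bij_betw f Y (S i)"
        by (auto simp: I_def isomorphic_def)
      have fy: "f y0 \<in> S i" using f(2) y0 by (auto simp: bij_betw_def)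
      have "f y0 = 0"
      proof (rule fixed_cycle0_zero)
        show "f y0 \<in> cycles0" using fy SH[OF i] by blast
        show "shift h (f y0) = f y0" if "h \<in> carrier G" for h
          using equivariantD(2)[OF f(1) that y0(1)] True that y0 by simp
      qed
      moreover have "f 0 = 0" by (rule clinear_on_more(1)[OF invariantD(1)[OF iY] equivariantD(1)[OF f(1)]])
      moreover have "inj_on f Y" using f(2) by (simp add: bij_betw_def)
      ultimately show False using inj_onD[of f Y y0 0] y0 cY(1) by simp
    qed
    moreover have "fixed commutator Y = Y" using True by (auto simp: fixed_def)
    ultimately show ?thesis by (simp add: I_def)
  next
    case False
    then have J: "(\<lambda>z. \<phi> z ?F1) ` pairs Y = Y" using \<phi>_face_image[OF Y] by blast
    have fix0: "y = 0" if y: "y \<in> Y" "\<And>h. h \<in> carrier G \<Longrightarrow> shift h y = y" for y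
    proof -
      let ?X = "{y \<in> Y. \<forall>h\<in>carrier G. shift h y = y}"
      have "invariant ?X"
        unfolding invariant_def csubspace_def using cY Yc by (auto simp: shift_linear)
      then have "?X = {0} \<or> ?X = Y" using Y(1) by (simp add: irreducible_def)
      moreover have "?X \<noteq> Y" using False by blast
      moreover have "y \<in> ?X" using y by simp
      ultimately show ?thesis by simp
    qed
    define P where "P = {z \<in> pairs Y. \<phi> z ?F1 = 0}"
    have pairs_sub: "pairs Y \<subseteq> supported (carrier G \<times> UNIV)" by (auto simp: pairs_def cell_chains_supported)
    have lin\<phi>: "clinear_on T (\<lambda>z. \<phi> z x)" for T x by (simp add: clinear_on_def \<phi>_linear_left)
    have cP: "csubspace P" unfolding P_def by (rule csubspace_kernel[OF csubspace_pairs[OF invariantD(1)[OF iY]] lin\<phi>])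
    have P_sub: "P \<subseteq> supported (carrier G \<times> UNIV)" using pairs_sub by (auto simp: P_def)
    have PY: "component b z \<in> Y" if "z \<in> P" for z b using that by (simp add: P_def pairs_def)
    have Pc: "component b z \<in> cell_chains" if "z \<in> P" for z b using PY[OF that] Yc by blast
    have "2 * cdim Y = cdim Y + cdim P"
      using cdim_rank_nullity[OF csubspace_pairs[OF invariantD(1)[OF iY]] finite_cells pairs_sub lin\<phi>, of ?F1]
      unfolding J P_def cdim_pairs[OF invariantD(1)[OF iY] Y(2)] .
    then have dimP: "cdim P = cdim Y" by simp
    have \<phi>eq: "equivariant cell_chains (\<phi> z)" if "z \<in> P" for z
      using \<phi>_shift[OF Pc[OF that]] by (simp add: equivariant_def clinear_on_def \<phi>_linear)
    have \<phi>Y: "\<phi> z x \<in> Y" if "z \<in> P" "x \<in> cell_chains" for z x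
      by (rule \<phi>_in[OF iY PY[OF that(1)] that(2)])
    have "\<forall>i\<in>I. \<exists>f. equivariant (S i) f \<and> bij_betw f (S i) Y"
      using isomorphic_sym[OF iY] by (auto simp: I_def isomorphic_def)
    from bchoice[OF this] obtain f where f: "\<And>i. i \<in> I \<Longrightarrow> equivariant (S i) (f i)" "\<And>i. i \<in> I \<Longrightarrow> bij_betw (f i) (S i) Y"
      by blast
    have In: "i < n" if "i \<in> I" for i using that by (simp add: I_def)
    have fY: "f i x \<in> Y" if "i \<in> I" "x \<in> S i" for i x using f(2)[OF that(1)] that(2) by (auto simp: bij_betw_def)
    have f0: "f i x = 0 \<longleftrightarrow> x = 0" if "i \<in> I" "x \<in> S i" for i x
    proof -
      have "f i 0 = 0"
        by (rule clinear_on_more(1)[OF invariantD(1)[OF iS[OF In[OF that(1)]]] equivariantD(1)[OF f(1)[OF that(1)]]])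
      moreover have "inj_on (f i) (S i)" using f(2)[OF that(1)] by (simp add: bij_betw_def)
      moreover have "0 \<in> S i" by (rule csubspaceD(1)[OF invariantD(1)[OF iS[OF In[OF that(1)]]]])
      ultimately show ?thesis using that(2) by (metis inj_on_eq_iff)
    qed
    have scal: "\<exists>a. \<forall>x\<in>S i. \<phi> z x = cscale a (f i x)" if i: "i \<in> I" and z: "z \<in> P" for i z
    proof -
      let ?g = "inv_into (S i) (f i)"
      have g: "equivariant Y ?g" by (rule equivariant_inverse[OF iS[OF In[OF i]] f(1)[OF i] f(2)[OF i]])
      have Sc: "x \<in> cell_chains" if "x \<in> S i" for x using that SH[OF In[OF i]] Hc by blast
      have gY: "?g y \<in> S i" "f i (?g y) = y" if "y \<in> Y" for y
        using that f(2)[OF i] by (auto simp: bij_betw_def inv_into_into f_inv_into_f)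
      have "equivariant (S i) (\<lambda>x. ?g (\<phi> z x))"
        unfolding equivariant_def clinear_on_def
      proof (intro conjI ballI allI)
        fix x y assume xy: "x \<in> S i" "y \<in> S i"
        show "?g (\<phi> z (x + y)) = ?g (\<phi> z x) + ?g (\<phi> z y)"
          unfolding \<phi>_linear by (rule clinear_onD(1)[OF equivariantD(1)[OF g] \<phi>Y[OF z Sc[OF xy(1)]] \<phi>Y[OF z Sc[OF xy(2)]]])
      next
        fix a x assume x: "x \<in> S i"
        show "?g (\<phi> z (cscale a x)) = cscale a (?g (\<phi> z x))"
          unfolding \<phi>_linear by (rule clinear_onD(2)[OF equivariantD(1)[OF g] \<phi>Y[OF z Sc[OF x]]])
      next
        fix h x assume h: "h \<in> carrier G" and x: "x \<in> S i"
        show "?g (\<phi> z (shift h x)) = shift h (?g (\<phi> z x))"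
          unfolding \<phi>_shift[OF Pc[OF z] h Sc[OF x]] by (rule equivariantD(2)[OF g h \<phi>Y[OF z Sc[OF x]]])
      qed
      from schur_scalar[OF Sirr[OF In[OF i]] this] obtain a where a: "\<forall>x\<in>S i. ?g (\<phi> z x) = cscale a x"
        using gY(1)[OF \<phi>Y[OF z Sc]] by blast
      have "\<phi> z x = cscale a (f i x)" if x: "x \<in> S i" for x
        using gY(2)[OF \<phi>Y[OF z Sc[OF x]]] a x clinear_onD(2)[OF equivariantD(1)[OF f(1)[OF i]] x] by metis
      then show ?thesis by blast
    qed
    have uniq: "a = b" if i: "i \<in> I" and eq: "\<forall>x\<in>S i. cscale a (f i x) = cscale b (f i x)" for i a b
    proof -
      obtain x where x: "x \<in> S i" "x \<noteq> 0" using Snz[OF In[OF i]] by blast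
      have "cscale (a - b) (f i x) = cscale a (f i x) - cscale b (f i x)"
        using cscale_add_left[of "a - b" b "f i x"] by simp
      then have ab0: "cscale (a - b) (f i x) = 0" using eq x by simp
      show "a = b"
      proof (rule ccontr)
        assume "a \<noteq> b"
        moreover have "cscale (1 / (a - b)) (cscale (a - b) (f i x)) = 0" using ab0 by simp
        ultimately have "f i x = 0" by simp
        then show False using f0[OF i x(1)] x(2) by simp
      qed
    qed
    define s where "s i z = (SOME a. \<forall>x\<in>S i. \<phi> z x = cscale a (f i x))" for i z
    have s: "\<phi> z x = cscale (s i z) (f i x)" if "i \<in> I" "z \<in> P" "x \<in> S i" for i z x
      using someI_ex[OF scal[OF that(1,2)]] that(3) unfolding s_def by blast
    have s_eq: "s i z = a" if "i \<in> I" "z \<in> P" "\<And>x. x \<in> S i \<Longrightarrow> \<phi> z x = cscale a (f i x)" for i z a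
      by (rule uniq[OF that(1)]) (use s[OF that(1,2)] that(3) in metis)
    define L where "L z = (\<Sum>i\<in>I. Poly_Mapping.single i (s i z))" for z
    have lookL: "Poly_Mapping.lookup (L z) i = (if i \<in> I then s i z else 0)" for z i
      using finI by (simp add: L_def lookup_sum lookup_single when_def)
    have linL: "clinear_on P L"
      unfolding clinear_on_def
    proof (intro conjI ballI allI)
      fix z z' assume z: "z \<in> P" "z' \<in> P"
      have "s i (z + z') = s i z + s i z'" if "i \<in> I" for i
        by (rule s_eq[OF that csubspaceD(2)[OF cP z]]) (simp add: \<phi>_linear_left s[OF that z(1)] s[OF that z(2)] cscale_add_left)
      then show "L (z + z') = L z + L z'" by (intro poly_mapping_eqI) (simp add: lookL lookup_add)
    next
      fix a z assume z: "z \<in> P"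
      have "s i (cscale a z) = a * s i z" if "i \<in> I" for i
        by (rule s_eq[OF that csubspaceD(3)[OF cP z]]) (simp add: \<phi>_linear_left s[OF that z])
      then show "L (cscale a z) = cscale a (L z)" by (intro poly_mapping_eqI) (simp add: lookL)
    qed
    obtain pr where pr: "\<And>i. i < n \<Longrightarrow> equivariant ?H (pr i)" "\<And>i x. i < n \<Longrightarrow> x \<in> ?H \<Longrightarrow> pr i x \<in> S i"
      "\<And>x. x \<in> ?H \<Longrightarrow> x = (\<Sum>i<n. pr i x)" "\<And>i j x. i < n \<Longrightarrow> j < n \<Longrightarrow> x \<in> S i \<Longrightarrow> pr j x = (if j = i then x else 0)"
      by (rule decomposition_projections[OF iH S]) (rule that)
    have imL: "L ` P = supported I"
    proof
      show "L ` P \<subseteq> supported I" by (auto simp: supported_def in_keys_iff lookL split: if_splits)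
      show "supported I \<subseteq> L ` P"
      proof
        fix t :: "nat \<Rightarrow>\<^sub>0 complex" assume t: "t \<in> supported I"
        obtain p1 where p1: "equivariant cell_chains p1" "\<And>x. x \<in> cell_chains \<Longrightarrow> p1 x \<in> cycles0" "\<And>x. x \<in> cycles0 \<Longrightarrow> p1 x = x"
          by (rule equivariant_projection_exists[OF invariant_cycles0]) (rule that)
        \<comment> \<open>an equivariant projection onto the complement \<open>?H\<close> of the faces in \<open>cycles0\<close>\<close>
        define pH where "pH x = p1 x - p0 (p1 x)" for x
        have cc: "csubspace cell_chains" by (rule invariantD(1)[OF invariant_cell_chains])
        note l0 = clinear_onD[OF equivariantD(1)[OF p0(1)]] clinear_on_more[OF cc equivariantD(1)[OF p0(1)]]
        note l1 = clinear_onD[OF equivariantD(1)[OF p1(1)]] clinear_on_more[OF cc equivariantD(1)[OF p1(1)]]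
        have p1c: "p1 x \<in> cell_chains" if "x \<in> cell_chains" for x using p1(2)[OF that] cyc by blast
        have p0c: "p0 x \<in> cell_chains" "p0 x \<in> cycles0" if "x \<in> cell_chains" for x
          using p0(2)[OF that] face_chains_subset cyc by blast+
        have pHH: "pH x \<in> ?H" if x: "x \<in> cell_chains" for x
        proof -
          have "pH x \<in> cycles0"
            unfolding pH_def by (rule csubspaceD(5)[OF invariantD(1)[OF invariant_cycles0] p1(2)[OF x] p0c(2)[OF p1c[OF x]]])
          moreover have "p0 (pH x) = 0"
            unfolding pH_def using l0(4)[OF p1c[OF x] p0c(1)[OF p1c[OF x]]] p0(3)[OF p0(2)[OF p1c[OF x]]] by simp
          ultimately show ?thesis by simp
        qed
        have pHeq: "equivariant cell_chains pH"
          unfolding equivariant_def clinear_on_def pH_def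
          using l0(1,2) l1(1,2) p1c equivariantD(2)[OF p0(1)] equivariantD(2)[OF p1(1)]
          by (simp add: cscale_diff_right shift_linear)
        \<comment> \<open>the map with the prescribed scalars on the summands, extended by \<open>0\<close> on the faces\<close>
        define F where "F x = (\<Sum>i\<in>I. cscale (Poly_Mapping.lookup t i) (f i (pr i (pH x))))" for x
        have prS: "pr i (pH x) \<in> S i" if "i \<in> I" "x \<in> cell_chains" for i x
          by (rule pr(2)[OF In[OF that(1)] pHH[OF that(2)]])
        have Feq: "equivariant cell_chains F"
          unfolding equivariant_def clinear_on_def
        proof (intro conjI ballI allI)
          fix x y assume xy: "x \<in> cell_chains" "y \<in> cell_chains"
          have "f i (pr i (pH (x + y))) = f i (pr i (pH x)) + f i (pr i (pH y))" if "i \<in> I" for i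
            using clinear_onD(1)[OF equivariantD(1)[OF pHeq] xy] clinear_onD(1)[OF equivariantD(1)[OF pr(1)[OF In[OF that]]] pHH[OF xy(1)] pHH[OF xy(2)]]
              clinear_onD(1)[OF equivariantD(1)[OF f(1)[OF that]] prS[OF that xy(1)] prS[OF that xy(2)]] by simp
          then show "F (x + y) = F x + F y" by (simp add: F_def cscale_add_right sum.distrib)
        next
          fix a x assume x: "x \<in> cell_chains"
          have "f i (pr i (pH (cscale a x))) = cscale a (f i (pr i (pH x)))" if "i \<in> I" for i
            using clinear_onD(2)[OF equivariantD(1)[OF pHeq] x] clinear_onD(2)[OF equivariantD(1)[OF pr(1)[OF In[OF that]]] pHH[OF x]]
              clinear_onD(2)[OF equivariantD(1)[OF f(1)[OF that]] prS[OF that x]] by simp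
          then show "F (cscale a x) = cscale a (F x)" by (simp add: F_def cscale_sum_right mult.commute)
        next
          fix h x assume h: "h \<in> carrier G" and x: "x \<in> cell_chains"
          have "f i (pr i (pH (shift h x))) = shift h (f i (pr i (pH x)))" if "i \<in> I" for i
            using equivariantD(2)[OF pHeq h x] equivariantD(2)[OF pr(1)[OF In[OF that]] h pHH[OF x]]
              equivariantD(2)[OF f(1)[OF that] h prS[OF that x]] by simp
          then show "F (shift h x) = shift h (F x)" by (simp add: F_def shift_linear)
        qed
        have FY: "F x \<in> Y" if "x \<in> cell_chains" for x
          unfolding F_def by (intro cY(6) cY(3) fY prS that)
        define z where "z = embed True (F (Poly_Mapping.single (\<one>, True) 1)) + embed False (F (Poly_Mapping.single (\<one>, False) 1))"
        have sc: "Poly_Mapping.single (\<one>, b) 1 \<in> cell_chains" for b by (simp add: cell_chains_def)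
        have FCT: "F x \<in> supported (carrier G \<times> {True})" if "x \<in> cell_chains" for x using FY[OF that] Y(2) by blast
        have \<phi>F: "F x = \<phi> z x" if "x \<in> cell_chains" for x
          unfolding z_def by (rule equivariant_eq_\<phi>(1)[OF Feq FCT that])
        have z_pairs: "z \<in> pairs Y"
          unfolding z_def by (rule embed_in_pairs(1)[OF invariantD(1)[OF iY] Y(2) FY[OF sc] FY[OF sc]])
        have pHface: "pH x = 0" if "x \<in> face_chains" for x
          using that p1(3)[of x] p0(3)[OF that] face_chains_subset by (auto simp: pH_def)
        have one: "?F1 \<in> face_chains"
          unfolding face_chains_def by (intro image_eqI[of _ _ "Poly_Mapping.single \<one> 1"]) auto
        have zeroS: "0 \<in> S i" if "i < n" for i by (rule csubspaceD(1)[OF invariantD(1)[OF iS[OF that]]])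
        have pr0: "pr i 0 = 0" if "i < n" for i
          by (rule clinear_on_more(1)[OF invariantD(1)[OF iH] equivariantD(1)[OF pr(1)[OF that]]])
        have fpr0: "f i (pr i 0) = 0" if "i \<in> I" for i
          using f0[OF that zeroS[OF In[OF that]]] pr0[OF In[OF that]] by simp
        have "F ?F1 = 0" unfolding F_def pHface[OF one] by (simp add: fpr0)
        then have zP: "z \<in> P" using z_pairs \<phi>F[OF face_in[OF one_closed]] by (simp add: P_def)
        have "s i z = Poly_Mapping.lookup t i" if i: "i \<in> I" for i
        proof (rule s_eq[OF i zP])
          fix x assume x: "x \<in> S i"
          have xH: "x \<in> ?H" using SH[OF In[OF i]] x by blast
          have xc: "x \<in> cell_chains" using xH Hc by blast
          have pHx: "pH x = x" using xH p1(3)[of x] by (simp add: pH_def)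
          have "F x = (\<Sum>j\<in>I. if j = i then cscale (Poly_Mapping.lookup t i) (f i x) else 0)"
            unfolding F_def pHx
          proof (rule sum.cong)
            fix j assume j: "j \<in> I"
            have "f j 0 = 0" using f0[OF j zeroS[OF In[OF j]]] by simp
            then show "cscale (Poly_Mapping.lookup t j) (f j (pr j x)) = (if j = i then cscale (Poly_Mapping.lookup t i) (f i x) else 0)"
              using pr(4)[OF In[OF i] In[OF j] x] by simp
          qed simp
          also have "\<dots> = cscale (Poly_Mapping.lookup t i) (f i x)" using finI i by simp
          finally show "\<phi> z x = cscale (Poly_Mapping.lookup t i) (f i x)" using \<phi>F[OF xc] by simp
        qed
        then have "L z = t"
          using t by (intro poly_mapping_eqI) (auto simp: lookL supported_def in_keys_iff)
        then show "t \<in> L ` P" using zP by blast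
      qed
    qed
    have \<delta>in: "\<delta> w \<in> P \<and> L (\<delta> w) = 0" if w: "w \<in> fixed commutator Y" for w
    proof -
      have wY: "w \<in> Y" "shift commutator w = w" using w by (auto simp: fixed_def)
      have inY: "w - shift (inv r) w \<in> Y" "w - shift (inv u) w \<in> Y"
        by (intro cY(5) wY(1) invariantD(4)[OF iY]; simp)+
      have kill: "\<phi> (\<delta> w) x = 0" if "x \<in> cell_chains" "cell_boundary x = 0" for x
        by (rule \<delta>_kills_cycles[OF Yc[OF wY(1)] _ _ _ wY(2) that])
           (use wY(1) Y(2) invariantD(4)[OF iY, of "inv r" w] invariantD(4)[OF iY, of "inv u" w] in auto)
      have "\<delta> w \<in> pairs Y" unfolding \<delta>_def by (rule embed_in_pairs(1)[OF invariantD(1)[OF iY] Y(2) inY])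
      then have dP: "\<delta> w \<in> P"
        using kill[of ?F1] face_in_cycles0[OF one_closed] by (simp add: P_def cycles0_def)
      have "s i (\<delta> w) = 0" if i: "i \<in> I" for i
        by (rule s_eq[OF i dP]) (use kill SH[OF In[OF i]] in \<open>auto simp: cycles0_def\<close>)
      then have "L (\<delta> w) = 0" by (intro poly_mapping_eqI) (simp add: lookL)
      then show ?thesis using dP by simp
    qed
    \<comment> \<open>A map in the kernel vanishes on all summands, by Schur's lemma also on those not isomorphic to \<open>Y\<close>, and therefore
      on \<open>cycles0\<close>.\<close>
    have ker: "{z \<in> P. L z = 0} = \<delta> ` fixed commutator Y"
    proof
      show "\<delta> ` fixed commutator Y \<subseteq> {z \<in> P. L z = 0}" using \<delta>in by blast
      show "{z \<in> P. L z = 0} \<subseteq> \<delta> ` fixed commutator Y"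
      proof
        fix z assume "z \<in> {z \<in> P. L z = 0}"
        then have z: "z \<in> P" "L z = 0" by auto
        have killS: "\<phi> z x = 0" if i: "i < n" and x: "x \<in> S i" for i x
        proof (cases "i \<in> I")
          case True
          have "s i z = 0" using lookL[of z i] True z(2) by simp
          then show ?thesis using s[OF True z(1) x] by simp
        next
          case False
          have "S i \<subseteq> cell_chains" using SH[OF i] Hc by blast
          then have "(\<forall>x\<in>S i. \<phi> z x = 0) \<or> bij_betw (\<phi> z) (S i) Y"
            using schur_zero_or_bij[OF Sirr[OF i] Y(1) equivariant_subset[OF \<phi>eq[OF z(1)]]] \<phi>Y[OF z(1)] by blast
          moreover have "\<not> bij_betw (\<phi> z) (S i) Y"
          proof
            assume "bij_betw (\<phi> z) (S i) Y"
            then have "isomorphic (S i) Y"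
              unfolding isomorphic_def using equivariant_subset[OF \<phi>eq[OF z(1)] \<open>S i \<subseteq> cell_chains\<close>] by blast
            then show False using False i isomorphic_sym[OF iS[OF i]] by (simp add: I_def)
          qed
          ultimately have "\<forall>x\<in>S i. \<phi> z x = 0" by simp
          then show ?thesis using x by simp
        qed
        have killH: "\<phi> z x = 0" if x: "x \<in> ?H" for x
        proof -
          have "\<phi> z x = (\<Sum>i<n. \<phi> z (pr i x))"
            by (subst pr(3)[OF x]) (rule \<phi>_linear(5))
          also have "\<dots> = 0" by (rule sum.neutral) (use killS pr(2) x in auto)
          finally show ?thesis .
        qed
        have killC: "\<phi> z x = 0" if x: "x \<in> cycles0" for x
        proof -
          have xc: "x \<in> cell_chains" using x cyc by blast
          have f: "p0 x \<in> face_chains" by (rule p0(2)[OF xc])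
          have fc: "p0 x \<in> cell_chains" "p0 x \<in> cycles0" using f face_chains_subset cyc by blast+
          have "x - p0 x \<in> ?H"
            using csubspaceD(5)[OF invariantD(1)[OF invariant_cycles0] x fc(2)]
              clinear_on_more(2)[OF invariantD(1)[OF invariant_cell_chains] equivariantD(1)[OF p0(1)] xc fc(1)] p0(3)[OF f] by simp
          then have "\<phi> z (x - p0 x) = 0" by (rule killH)
          moreover have "\<phi> z (p0 x) = 0"
            by (rule \<phi>_kills_faces[OF Pc[OF z(1)] _ f]) (use z(1) in \<open>simp add: P_def\<close>)
          ultimately show ?thesis by (simp add: \<phi>_linear)
        qed
        have killZ: "\<phi> z x = 0" if x: "x \<in> cell_chains" "cell_boundary x = 0" for x
        proof -
          \<comment> \<open>a cycle minus the average of its translates lies in \<open>cycles0\<close>, and the image of the average is a fixed vector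
            of \<open>Y\<close>, that is, \<open>0\<close>\<close>
          let ?N = "of_nat (card (carrier G)) :: complex"
          have N0: "?N \<noteq> 0" using finite_G by (simp add: card_gt_0_iff) (use one_closed in blast)
          have sumc: "(\<Sum>h\<in>carrier G. shift h x) \<in> cell_chains"
            by (intro csubspaceD(6)[OF invariantD(1)[OF invariant_cell_chains]] shift_in x)
          have "cell_boundary (\<Sum>h\<in>carrier G. shift h x) = 0"
            unfolding cell_boundary_linear by (rule sum.neutral) (simp add: cell_boundary_shift x)
          moreover have "side_sum b (\<Sum>h\<in>carrier G. shift h x) = ?N * side_sum b x" for b
            by (simp add: side_sum_linear side_sum_shift)
          ultimately have "cscale ?N x - (\<Sum>h\<in>carrier G. shift h x) \<in> cycles0"
            unfolding cycles0_def using x sumc csubspaceD(3,5)[OF invariantD(1)[OF invariant_cell_chains]]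
            by (simp add: cell_boundary_linear(2,3) side_sum_linear(2,3))
          from killC[OF this] have "cscale ?N (\<phi> z x) = (\<Sum>h\<in>carrier G. shift h (\<phi> z x))"
            using \<phi>_shift[OF Pc[OF z(1)] _ x(1)] by (simp add: \<phi>_linear)
          moreover have "(\<Sum>h\<in>carrier G. shift h (\<phi> z x)) = 0"
          proof (rule fix0)
            show "(\<Sum>h\<in>carrier G. shift h (\<phi> z x)) \<in> Y"
              by (intro cY(6) invariantD(4)[OF iY] \<phi>Y[OF z(1) x(1)])
            show "shift h (\<Sum>h\<in>carrier G. shift h (\<phi> z x)) = (\<Sum>h\<in>carrier G. shift h (\<phi> z x))" if "h \<in> carrier G" for h
              by (rule sum_shift_fixed[OF Yc[OF \<phi>Y[OF z(1) x(1)]] that])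
          qed
          ultimately have "cscale (1 / ?N) (cscale ?N (\<phi> z x)) = 0" by simp
          then show ?thesis using N0 by simp
        qed
        have "z \<in> cell_chains" using z(1) by (simp add: P_def pairs_def)
        then have "\<exists>w\<in>Y. shift commutator w = w \<and> z = \<delta> w"
          by (rule killing_cycles_is_\<delta>[OF _ PY[OF z(1)] iY Y(2) killZ])
        then show "z \<in> \<delta> ` fixed commutator Y" by (auto simp: fixed_def)
      qed
    qed
    have lin\<delta>: "clinear_on T \<delta>" for T
    proof -
      have "embed b (x - y) = embed b x - embed b y" for b x y by (simp add: embed_def clinear_extend_diff)
      then show ?thesis
        by (simp add: clinear_on_def \<delta>_def shift_linear embed_linear cscale_add_right cscale_diff_right)
    qed
    have cfix: "csubspace (fixed commutator Y)"
      unfolding csubspace_def fixed_def using cY by (simp add: shift_linear)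
    have inj\<delta>: "w = 0" if w: "w \<in> fixed commutator Y" and d: "\<delta> w = 0" for w
    proof -
      have wY: "w \<in> Y" using w by (simp add: fixed_def)
      have inY: "w - shift (inv r) w \<in> Y" "w - shift (inv u) w \<in> Y"
        by (intro cY(5) wY invariantD(4)[OF iY]; simp)+
      have "component True (\<delta> w) = w - shift (inv r) w" "component False (\<delta> w) = w - shift (inv u) w"
        unfolding \<delta>_def by (rule embed_in_pairs(2,3)[OF invariantD(1)[OF iY] Y(2) inY])+
      moreover have "component b 0 = 0" for b using component_linear(2)[of b 0 0] by (simp add: component_linear)
      ultimately have "w - shift (inv r) w = 0" "w - shift (inv u) w = 0" unfolding d by simp_all
      then have eq: "shift (inv r) w = w" "shift (inv u) w = w" by simp_all
      let ?St = "{h \<in> carrier G. shift h w = w}"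
      have wc: "w \<in> cell_chains" using Yc wY by blast
      have "subgroup ?St G"
      proof (rule subgroupI)
        have "\<one> \<in> ?St" using shift_one[OF wc] by simp
        then show "?St \<noteq> {}" by (metis empty_iff)
        show "inv h \<in> ?St" if "h \<in> ?St" for h using that shift_inv(1)[of h w] wc by simp
        show "h \<otimes> k \<in> ?St" if "h \<in> ?St" "k \<in> ?St" for h k using that shift_shift[of h k w] wc by simp
      qed simp
      moreover have "r \<in> ?St" "u \<in> ?St" using eq shift_inv(2)[of r w] shift_inv(2)[of u w] wc by simp_all
      ultimately have "?St = carrier G" by (rule subgroup_containing_generators)
      then show ?thesis using fix0[OF wY] by blast
    qed
    have "fixed commutator Y \<subseteq> supported (carrier G \<times> UNIV)" using invariantD(3)[OF iY] by (auto simp: fixed_def)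
    then have "cdim (\<delta> ` fixed commutator Y) = cdim (fixed commutator Y)"
      using cdim_inj[OF cfix finite_cells _ lin\<delta> inj\<delta>] by blast
    moreover have "cdim P = cdim (L ` P) + cdim {z \<in> P. L z = 0}"
      by (rule cdim_rank_nullity[OF cP finite_cells P_sub linL])
    ultimately have "cdim Y = card I + cdim (fixed commutator Y)"
      using cdim_supported[OF finI] unfolding imL ker dimP by simp
    then show ?thesis by (simp add: I_def)
  qed
qed

end

section \<open>Module records isomorphic to spaces of chains\<close>

text \<open>A linear isomorphism onto a module record. That the record is a vector space is a consequence
  (\<open>chain_iso_vectorspace\<close>).\<close>

definition chain_iso :: "('s \<Rightarrow>\<^sub>0 complex) set \<Rightarrow> (complex, 'z, 'm) module_scheme \<Rightarrow> (('s \<Rightarrow>\<^sub>0 complex) \<Rightarrow> 'z) \<Rightarrow> bool" where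
  "chain_iso S Z e \<longleftrightarrow> csubspace S \<and> bij_betw e S (carrier Z) \<and> e 0 = \<zero>\<^bsub>Z\<^esub> \<and>
     (\<forall>x\<in>S. \<forall>y\<in>S. e (x + y) = e x \<oplus>\<^bsub>Z\<^esub> e y) \<and> (\<forall>a. \<forall>x\<in>S. e (cscale a x) = a \<odot>\<^bsub>Z\<^esub> e x)"

lemma chain_isoD:
  assumes "chain_iso S Z e"
  shows "csubspace S" "inj_on e S" "e ` S = carrier Z" "e 0 = \<zero>\<^bsub>Z\<^esub>"
    "x \<in> S \<Longrightarrow> y \<in> S \<Longrightarrow> e (x + y) = e x \<oplus>\<^bsub>Z\<^esub> e y" "x \<in> S \<Longrightarrow> e (cscale a x) = a \<odot>\<^bsub>Z\<^esub> e x"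
    "x \<in> S \<Longrightarrow> e x \<in> carrier Z" "x \<in> S \<Longrightarrow> y \<in> S \<Longrightarrow> e x = e y \<longleftrightarrow> x = y"
  using assms by (auto simp: chain_iso_def bij_betw_def inj_on_eq_iff)

lemma chain_iso_subspace:
  assumes "chain_iso S Z e" "csubspace T" "T \<subseteq> S"
  shows "chain_iso T (Z\<lparr>carrier := e ` T\<rparr>) e"
  using assms(2,3) chain_isoD[OF assms(1)] inj_on_subset[OF chain_isoD(2)[OF assms(1)] assms(3)]
  by (simp add: chain_iso_def bij_betw_def subset_iff)

lemma chain_iso_vectorspace:
  assumes "chain_iso S Z e"
  shows "vectorspace complex_ring Z"
proof -
  note c = csubspaceD[OF chain_isoD(1)[OF assms]]
  note e = chain_isoD(4-)[OF assms]
  have [simp]: "carrier Z = e ` S" using chain_isoD(3)[OF assms] by simp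
  show ?thesis
  proof (rule vs_criteria[OF field_complex_ring])
    show "\<forall>v\<in>carrier Z. \<exists>w\<in>carrier Z. v \<oplus>\<^bsub>Z\<^esub> w = \<zero>\<^bsub>Z\<^esub>"
    proof
      fix v assume "v \<in> carrier Z"
      then obtain x where x: "x \<in> S" "v = e x" by auto
      then have "v \<oplus>\<^bsub>Z\<^esub> e (- x) = \<zero>\<^bsub>Z\<^esub>" using e(2)[OF x(1) c(4)[OF x(1)]] e(1) by simp
      then show "\<exists>w\<in>carrier Z. v \<oplus>\<^bsub>Z\<^esub> w = \<zero>\<^bsub>Z\<^esub>" using c(4)[OF x(1)] by auto
    qed
    show "\<zero>\<^bsub>Z\<^esub> \<in> carrier Z" unfolding e(1)[symmetric] using c(1) by simp
    show "\<forall>v\<in>carrier Z. v \<oplus>\<^bsub>Z\<^esub> \<zero>\<^bsub>Z\<^esub> = v"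
      unfolding e(1)[symmetric] using c(1) by (auto simp: e(2)[symmetric])
  qed (auto simp: c e(2,3)[symmetric] cscale_add_left cscale_add_right add_ac)
qed

lemma chain_iso_module_hom:
  assumes "chain_iso S Z e"
  shows "e \<in> module_hom complex_ring (chains S) Z"
  using chain_isoD[OF assms] by (auto simp: module_hom_def)

lemma chain_iso_dim:
  assumes e: "chain_iso S Z e" and A: "finite A" "S \<subseteq> supported A"
  shows "vectorspace.dim complex_ring Z = cdim S"
proof -
  have v: "vectorspace complex_ring (chains S)" "vectorspace complex_ring Z"
    using chain_iso_vectorspace[OF e] vectorspace_chains[OF chain_isoD(1)[OF e]] by simp_all
  then have "module complex_ring (chains S)" "module complex_ring Z" by (simp_all add: vectorspace_def)
  then have "mod_hom complex_ring (chains S) Z e"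
    using chain_iso_module_hom[OF e] by (simp add: mod_hom_def mod_hom_axioms_def)
  then interpret linear_map complex_ring "chains S" Z e using v by (simp add: linear_map_def)
  show ?thesis
    using dim_eq[OF fin_dim_chains[OF chain_isoD(1)[OF e] A]] chain_isoD(2,3)[OF e] by simp
qed

lemma chain_iso_finsum:
  fixes n :: nat
  assumes e: "chain_iso S Z e" and w: "\<And>i. i < n \<Longrightarrow> w i \<in> S"
  shows "finsum Z (\<lambda>i. e (w i)) {..<n} = e (\<Sum>i<n. w i)"
proof -
  interpret Z: vectorspace complex_ring Z by (rule chain_iso_vectorspace[OF e])
  from w show ?thesis
  proof (induction n)
    case 0
    then show ?case by (simp add: chain_isoD(4)[OF e])
  next
    case (Suc n)
    have s: "(\<Sum>i<n. w i) \<in> S" by (rule csubspaceD(6)[OF chain_isoD(1)[OF e]]) (use Suc.prems in simp)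
    have "finsum Z (\<lambda>i. e (w i)) {..<Suc n} = e (w n) \<oplus>\<^bsub>Z\<^esub> finsum Z (\<lambda>i. e (w i)) {..<n}"
      unfolding lessThan_Suc by (rule Z.finsum_insert) (use Suc.prems chain_isoD(7)[OF e] in auto)
    also have "\<dots> = e (w n + (\<Sum>i<n. w i))"
      using Suc.IH Suc.prems by (simp add: chain_isoD(5)[OF e _ s])
    finally show ?case by (simp add: add.commute)
  qed
qed

text \<open>The inverse of \<open>\<sigma> h\<close> is \<open>\<sigma> (inv h)\<close>.\<close>

lemma group_action_of_extensional:
  fixes G :: "('g, 'b) monoid_scheme" (structure)
  assumes "group G" and ext: "\<And>h. h \<in> carrier G \<Longrightarrow> \<sigma> h \<in> extensional E"
    and cl: "\<And>h x. h \<in> carrier G \<Longrightarrow> x \<in> E \<Longrightarrow> \<sigma> h x \<in> E"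
    and one: "\<And>x. x \<in> E \<Longrightarrow> \<sigma> \<one> x = x"
    and mul: "\<And>h k x. h \<in> carrier G \<Longrightarrow> k \<in> carrier G \<Longrightarrow> x \<in> E \<Longrightarrow> \<sigma> (h \<otimes> k) x = \<sigma> h (\<sigma> k x)"
  shows "group_action G E \<sigma>"
proof -
  interpret group G by (rule assms)
  have bij: "\<sigma> h \<in> Bij E" if h: "h \<in> carrier G" for h
  proof -
    have "bij_betw (\<sigma> h) E E"
    proof (rule bij_betwI[where g = "\<sigma> (inv h)"])
      show "\<sigma> h \<in> E \<rightarrow> E" "\<sigma> (inv h) \<in> E \<rightarrow> E" using cl h by auto
      show "\<sigma> (inv h) (\<sigma> h x) = x" if "x \<in> E" for x using mul[of "inv h" h x] one h that by simp
      show "\<sigma> h (\<sigma> (inv h) x) = x" if "x \<in> E" for x using mul[of h "inv h" x] one h that by simp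
    qed
    then show ?thesis using ext[OF h] by (simp add: Bij_def)
  qed
  have "\<sigma> (h \<otimes> k) = compose E (\<sigma> h) (\<sigma> k)" if "h \<in> carrier G" "k \<in> carrier G" for h k
    by (rule extensionalityI[OF ext]) (use that mul in \<open>auto simp: compose_def\<close>)
  then have "\<sigma> \<in> hom G (BijGroup E)"
    by (auto simp: hom_def BijGroup_def bij)
  then show ?thesis
    by (simp add: group_action_def group_hom_def group_hom_axioms_def group_BijGroup assms)
qed

lemma subspace_iff:
  assumes "vectorspace complex_ring Z"
  shows "VectorSpace.subspace complex_ring W Z \<longleftrightarrow> W \<subseteq> carrier Z \<and> \<zero>\<^bsub>Z\<^esub> \<in> W \<and>
    (\<forall>x\<in>W. \<forall>y\<in>W. x \<oplus>\<^bsub>Z\<^esub> y \<in> W) \<and> (\<forall>a. \<forall>x\<in>W. a \<odot>\<^bsub>Z\<^esub> x \<in> W)"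
  using assms by (auto simp: VectorSpace.subspace_def LinearCombinations.submodule_def vectorspace_def)

context origami
begin

text \<open>The map \<open>e\<close> is an isomorphism of representations from the invariant subspace \<open>Y\<close> to \<open>(Z, \<sigma>)\<close>. Group actions on a set are
  extensional by definition, and this does not follow from the other conditions.\<close>

definition models :: "(complex, 'z, 'm) module_scheme \<Rightarrow> ('g \<Rightarrow> 'z \<Rightarrow> 'z) \<Rightarrow> (('g \<times> bool \<Rightarrow>\<^sub>0 complex) \<Rightarrow> 'z) \<Rightarrow>
    ('g \<times> bool \<Rightarrow>\<^sub>0 complex) set \<Rightarrow> bool" where
  "models Z \<sigma> e Y \<longleftrightarrow> invariant Y \<and> chain_iso Y Z e \<and> (\<forall>h\<in>carrier G. \<sigma> h \<in> extensional (carrier Z)) \<and>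
     (\<forall>h\<in>carrier G. \<forall>x\<in>Y. e (shift h x) = \<sigma> h (e x))"

lemma modelsD:
  assumes "models Z \<sigma> e Y"
  shows "invariant Y" "chain_iso Y Z e" "h \<in> carrier G \<Longrightarrow> \<sigma> h \<in> extensional (carrier Z)"
    "h \<in> carrier G \<Longrightarrow> x \<in> Y \<Longrightarrow> e (shift h x) = \<sigma> h (e x)"
  using assms by (auto simp: models_def)

lemma models_subset:
  assumes m: "models Z \<sigma> e Y" and S: "invariant S" "S \<subseteq> Y"
  shows "models (Z\<lparr>carrier := e ` S\<rparr>) (restrict_representation \<sigma> (e ` S)) e S"
  using S modelsD(4)[OF m] chain_iso_subspace[OF modelsD(2)[OF m] invariantD(1)[OF S(1)] S(2)]
  by (auto simp: models_def restrict_representation_def)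

lemma models_representation:
  assumes m: "models Z \<sigma> e Y"
  shows "representation complex_ring G Z \<sigma>"
proof -
  note e = chain_isoD[OF modelsD(2)[OF m]]
  note c = csubspaceD[OF e(1)]
  note i = invariantD[OF modelsD(1)[OF m]]
  have Z: "carrier Z = e ` Y" by (simp add: e(3))
  have "group_action G (carrier Z) \<sigma>"
  proof (rule group_action_of_extensional[OF group_axioms modelsD(3)[OF m]])
    show "\<sigma> h z \<in> carrier Z" if "h \<in> carrier G" "z \<in> carrier Z" for h z
      using that i(4) by (auto simp: Z modelsD(4)[OF m, symmetric])
    show "\<sigma> \<one> z = z" if "z \<in> carrier Z" for z
      using that i(2) shift_one by (auto simp: Z modelsD(4)[OF m, symmetric] subset_iff)
    show "\<sigma> (h \<otimes> k) z = \<sigma> h (\<sigma> k z)" if "h \<in> carrier G" "k \<in> carrier G" "z \<in> carrier Z" for h k z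
      using that i(2,4) shift_shift[of h k] by (auto simp: Z modelsD(4)[OF m, symmetric] subset_iff)
  qed
  moreover have "\<sigma> h \<in> module_hom complex_ring Z Z" if h: "h \<in> carrier G" for h
    using h by (auto simp: module_hom_def Z e(5,6)[symmetric] modelsD(4)[OF m, symmetric] c i(4) shift_linear)
  ultimately show ?thesis
    by (simp add: representation_def chain_iso_vectorspace[OF modelsD(2)[OF m]])
qed

lemma models_subrepresentation:
  assumes m: "models Z \<sigma> e Y"
  shows "subrepresentation complex_ring G Z \<sigma> W \<longleftrightarrow> (\<exists>S. invariant S \<and> S \<subseteq> Y \<and> W = e ` S)"
proof
  note e = chain_isoD[OF modelsD(2)[OF m]]
  note c = csubspaceD[OF e(1)]
  note i = invariantD[OF modelsD(1)[OF m]]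
  note sub = subspace_iff[OF chain_iso_vectorspace[OF modelsD(2)[OF m]]]
  {
    assume "subrepresentation complex_ring G Z \<sigma> W"
    then have "VectorSpace.subspace complex_ring W Z" and inv: "\<forall>g\<in>carrier G. \<sigma> g ` W \<subseteq> W"
      by (simp_all add: subrepresentation_def)
    then have W: "W \<subseteq> carrier Z" "\<zero>\<^bsub>Z\<^esub> \<in> W" "\<And>x y. x \<in> W \<Longrightarrow> y \<in> W \<Longrightarrow> x \<oplus>\<^bsub>Z\<^esub> y \<in> W"
      "\<And>a x. x \<in> W \<Longrightarrow> a \<odot>\<^bsub>Z\<^esub> x \<in> W"
      by (simp_all add: sub)
    have W': "\<sigma> h x \<in> W" if "h \<in> carrier G" "x \<in> W" for h x
      using bspec[OF inv that(1)] that(2) by (rule subsetD[OF _ imageI])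
    have "invariant {x \<in> Y. e x \<in> W}"
      using i W W' by (auto simp: invariant_def csubspace_def c e(4-6) modelsD(4)[OF m])
    moreover have "W = e ` {x \<in> Y. e x \<in> W}" using W(1) by (auto simp: e(3)[symmetric])
    ultimately show "\<exists>S. invariant S \<and> S \<subseteq> Y \<and> W = e ` S" by (intro exI conjI) auto
  }
  assume "\<exists>S. invariant S \<and> S \<subseteq> Y \<and> W = e ` S"
  then obtain S where S: "invariant S" "S \<subseteq> Y" "W = e ` S" by blast
  note cS = csubspaceD[OF invariantD(1)[OF S(1)]]
  have "e x \<oplus>\<^bsub>Z\<^esub> e y \<in> W" if "x \<in> S" "y \<in> S" for x y
    using that S(2) e(5)[of x y, symmetric] cS(2) by (simp add: S(3) subset_iff)
  moreover have "a \<odot>\<^bsub>Z\<^esub> e x \<in> W" if "x \<in> S" for a x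
    using that S(2) e(6)[of x a, symmetric] cS(3) by (simp add: S(3) subset_iff)
  moreover have "\<sigma> h (e x) \<in> W" if "h \<in> carrier G" "x \<in> S" for h x
    using that S(2) modelsD(4)[OF m, of h x, symmetric] invariantD(4)[OF S(1)] by (simp add: S(3) subset_iff)
  moreover have "\<zero>\<^bsub>Z\<^esub> \<in> W" unfolding e(4)[symmetric] S(3) using cS(1) by blast
  moreover have "W \<subseteq> carrier Z" using S(2,3) e(3) by blast
  ultimately show "subrepresentation complex_ring G Z \<sigma> W"
    by (auto simp: subrepresentation_def sub S(3))
qed

lemma models_irreducible:
  assumes m: "models Z \<sigma> e Y"
  shows "irreducible_representation complex_ring G Z \<sigma> \<longleftrightarrow> irreducible Y"
proof -
  note e = chain_isoD[OF modelsD(2)[OF m]]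
  note c = csubspaceD[OF e(1)]
  have img: "e ` S = e ` T \<longleftrightarrow> S = T" if "S \<subseteq> Y" "T \<subseteq> Y" for S T
    using inj_on_image_eq_iff[OF e(2) that] .
  have z: "{\<zero>\<^bsub>Z\<^esub>} = e ` {0}" by (simp add: e(4))
  have zY: "{0} \<subseteq> Y" using c(1) by simp
  have "(\<forall>W. subrepresentation complex_ring G Z \<sigma> W \<longrightarrow> W = {\<zero>\<^bsub>Z\<^esub>} \<or> W = carrier Z) \<longleftrightarrow>
      (\<forall>S. invariant S \<longrightarrow> S \<subseteq> Y \<longrightarrow> e ` S = e ` {0} \<or> e ` S = e ` Y)"
    unfolding models_subrepresentation[OF m] z e(3)[symmetric] by blast
  also have "\<dots> \<longleftrightarrow> (\<forall>S. invariant S \<longrightarrow> S \<subseteq> Y \<longrightarrow> S = {0} \<or> S = Y)"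
    using img[OF _ zY] img[OF _ subset_refl] by simp
  moreover have "carrier Z \<noteq> {\<zero>\<^bsub>Z\<^esub>} \<longleftrightarrow> Y \<noteq> {0}"
    unfolding z e(3)[symmetric] img[OF subset_refl zY] ..
  ultimately show ?thesis
    using models_representation[OF m] modelsD(1)[OF m]
    by (simp add: irreducible_representation_def irreducible_def)
qed

lemma models_isomorphic:
  assumes m: "models Z \<sigma> e Y" and m': "models Z' \<sigma>' e' Y'"
  shows "isomorphic_representations complex_ring G Z \<sigma> Z' \<sigma>' \<longleftrightarrow> isomorphic Y Y'"
proof
  note e = chain_isoD[OF modelsD(2)[OF m]]
  note e' = chain_isoD[OF modelsD(2)[OF m']]
  note c = csubspaceD[OF e(1)]
  note c' = csubspaceD[OF e'(1)]
  note i = invariantD[OF modelsD(1)[OF m]]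
  note i' = invariantD[OF modelsD(1)[OF m']]
  have inv: "inv_into Y e (e x) = x" if "x \<in> Y" for x using that e(2) by simp
  have inv': "inv_into Y' e' (e' x) = x" if "x \<in> Y'" for x using that e'(2) by simp
  have bij: "bij_betw e Y (carrier Z)" "bij_betw e' Y' (carrier Z')" by (simp_all add: bij_betw_def e(2,3) e'(2,3))
  {
    assume "isomorphic_representations complex_ring G Z \<sigma> Z' \<sigma>'"
    then obtain f where f: "f \<in> module_hom complex_ring Z Z'" "bij_betw f (carrier Z) (carrier Z')"
      "\<And>g v. g \<in> carrier G \<Longrightarrow> v \<in> carrier Z \<Longrightarrow> f (\<sigma> g v) = \<sigma>' g (f v)"
      unfolding isomorphic_representations_def by blast
    have fl: "f (x \<oplus>\<^bsub>Z\<^esub> y) = f x \<oplus>\<^bsub>Z'\<^esub> f y" "f (a \<odot>\<^bsub>Z\<^esub> x) = a \<odot>\<^bsub>Z'\<^esub> f x"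
      if "x \<in> carrier Z" "y \<in> carrier Z" for x y a
      using f(1) that by (auto simp: module_hom_def)
    define F where "F x = inv_into Y' e' (f (e x))" for x
    have F_eq: "F = inv_into Y' e' \<circ> (f \<circ> e)" by (simp add: fun_eq_iff F_def)
    have F: "F x \<in> Y'" "e' (F x) = f (e x)" if "x \<in> Y" for x
    proof -
      have "f (e x) \<in> e' ` Y'" using bij_betwE[OF f(2)] e(7)[OF that] e'(3) by blast
      then show "F x \<in> Y'" "e' (F x) = f (e x)" by (simp_all add: F_def inv_into_into f_inv_into_f)
    qed
    have Feq: "F x = y" if "x \<in> Y" "y \<in> Y'" "f (e x) = e' y" for x y
      using that inv' by (simp add: F_def)
    have "F (x + y) = F x + F y" if "x \<in> Y" "y \<in> Y" for x y
      by (rule Feq) (use that c(2) c'(2) F e(5,7) e'(5) fl(1) in auto)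
    moreover have "F (cscale a x) = cscale a (F x)" if "x \<in> Y" for a x
      by (rule Feq) (use that c(3) c'(3) F e(6,7) e'(6) fl(2)[OF e(7) e(7)] in auto)
    moreover have "F (shift h x) = shift h (F x)" if "h \<in> carrier G" "x \<in> Y" for h x
      by (rule Feq) (use that i(4) i'(4) F modelsD(4)[OF m] modelsD(4)[OF m'] f(3) e(7) in auto)
    moreover have "bij_betw F Y Y'"
      unfolding F_eq by (rule bij_betw_trans[OF bij_betw_trans[OF bij(1) f(2)] bij_betw_inv_into[OF bij(2)]])
    ultimately show "isomorphic Y Y'"
      unfolding isomorphic_def equivariant_def clinear_on_def by blast
  }
  assume "isomorphic Y Y'"
  then obtain F where F: "equivariant Y F" "bij_betw F Y Y'" by (auto simp: isomorphic_def)
  define f where "f z = e' (F (inv_into Y e z))" for z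
  have f_eq: "f = e' \<circ> (F \<circ> inv_into Y e)" by (simp add: fun_eq_iff f_def)
  note Fl = clinear_onD[OF equivariantD(1)[OF F(1)]] equivariantD(2)[OF F(1)]
  have FY: "F x \<in> Y'" if "x \<in> Y" for x using F(2) that by (auto simp: bij_betw_def)
  have fe: "f (e x) = e' (F x)" if "x \<in> Y" for x by (simp add: f_def inv that)
  have Z: "carrier Z = e ` Y" by (simp add: e(3))
  have "f \<in> module_hom complex_ring Z Z'"
    by (auto simp: module_hom_def Z e(5,6)[symmetric] fe c FY e'(5-7) Fl)
  moreover have "bij_betw f (carrier Z) (carrier Z')"
    unfolding f_eq by (rule bij_betw_trans[OF bij_betw_trans[OF bij_betw_inv_into[OF bij(1)] F(2)] bij(2)])
  moreover have "f (\<sigma> h z) = \<sigma>' h (f z)" if h: "h \<in> carrier G" and "z \<in> carrier Z" for h z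
  proof -
    obtain x where x: "x \<in> Y" "z = e x" using \<open>z \<in> carrier Z\<close> by (auto simp: Z)
    then show ?thesis
      using fe[OF i(4)[OF h x(1)]] fe[OF x(1)] Fl(3)[OF h x(1)]
      by (simp add: modelsD(4)[OF m h x(1)] modelsD(4)[OF m' h FY[OF x(1)]])
  qed
  ultimately show "isomorphic_representations complex_ring G Z \<sigma> Z' \<sigma>'"
    unfolding isomorphic_representations_def by blast
qed

end

lemma ex1_iff_card: "(\<exists>!w. w \<in> P \<and> Q w) \<longleftrightarrow> card {w \<in> P. Q w} = Suc 0"
  unfolding card_1_singleton_iff set_eq_iff mem_Collect_eq singleton_iff by metis

context origami
begin

lemma models_decomposition:
  assumes m: "models Z \<sigma> e Y"
  shows "irreducible_decomposition complex_ring G Z \<sigma> n W \<longleftrightarrow> (\<exists>S. decomposition Y n S \<and> (\<forall>i<n. W i = e ` S i))"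
proof -
  note e = chain_isoD[OF modelsD(2)[OF m]]
  interpret Z: vectorspace complex_ring Z by (rule chain_iso_vectorspace[OF modelsD(2)[OF m]])
  have summands: "(\<forall>i<n. subrepresentation complex_ring G Z \<sigma> (W i) \<and>
      irreducible_representation complex_ring G (Z\<lparr>carrier := W i\<rparr>) (restrict_representation \<sigma> (W i))) \<longleftrightarrow>
      (\<forall>i<n. irreducible (S i) \<and> S i \<subseteq> Y)"
    if S: "\<And>i. i < n \<Longrightarrow> invariant (S i) \<and> S i \<subseteq> Y \<and> W i = e ` S i" for S
  proof -
    have "subrepresentation complex_ring G Z \<sigma> (W i) \<and>
        irreducible_representation complex_ring G (Z\<lparr>carrier := W i\<rparr>) (restrict_representation \<sigma> (W i)) \<longleftrightarrow>
        irreducible (S i) \<and> S i \<subseteq> Y" if i: "i < n" for i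
    proof -
      have Si: "invariant (S i)" "S i \<subseteq> Y" "W i = e ` S i" using S[OF i] by simp_all
      have "subrepresentation complex_ring G Z \<sigma> (W i)"
        unfolding models_subrepresentation[OF m] using Si by blast
      then show ?thesis
        using models_irreducible[OF models_subset[OF m Si(1,2)]] Si(2) by (simp add: Si(3))
    qed
    then show ?thesis by simp
  qed
  have sums: "(\<forall>z\<in>carrier Z. \<exists>!w. w \<in> (\<Pi>\<^sub>E i\<in>{..<n}. W i) \<and> finsum Z w {..<n} = z) \<longleftrightarrow>
      (\<forall>x\<in>Y. \<exists>!w. w \<in> (\<Pi>\<^sub>E i\<in>{..<n}. S i) \<and> (\<Sum>i<n. w i) = x)"
    if S: "\<And>i. i < n \<Longrightarrow> invariant (S i) \<and> S i \<subseteq> Y \<and> W i = e ` S i" for S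
  proof -
    have SY: "x \<in> Y" if "i < n" "x \<in> S i" for i x using S that by blast
    define E where "E w = (\<lambda>i\<in>{..<n}. e (w i))" for w
    have bij: "bij_betw E (\<Pi>\<^sub>E i\<in>{..<n}. S i) (\<Pi>\<^sub>E i\<in>{..<n}. W i)"
    proof (rule bij_betwI[where g = "\<lambda>w. \<lambda>i\<in>{..<n}. inv_into Y e (w i)"])
      show "E \<in> (\<Pi>\<^sub>E i\<in>{..<n}. S i) \<rightarrow> (\<Pi>\<^sub>E i\<in>{..<n}. W i)"
        using S by (auto simp: E_def PiE_iff)
      have inv: "inv_into Y e (e x) = x" if "i < n" "x \<in> S i" for i x using SY[OF that] e(2) by simp
      show "(\<lambda>w. \<lambda>i\<in>{..<n}. inv_into Y e (w i)) \<in> (\<Pi>\<^sub>E i\<in>{..<n}. W i) \<rightarrow> (\<Pi>\<^sub>E i\<in>{..<n}. S i)"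
      proof (intro Pi_I PiE_I)
        fix w i assume w: "w \<in> (\<Pi>\<^sub>E i\<in>{..<n}. W i)" and i: "i \<in> {..<n}"
        then have "w i \<in> e ` S i" using PiE_mem[OF w i] S by simp
        then show "(\<lambda>i\<in>{..<n}. inv_into Y e (w i)) i \<in> S i" using i inv by auto
      qed auto
      show "(\<lambda>i\<in>{..<n}. inv_into Y e (E w i)) = w" if w: "w \<in> (\<Pi>\<^sub>E i\<in>{..<n}. S i)" for w
      proof (rule extensionalityI[where A = "{..<n}"])
        show "(\<lambda>i\<in>{..<n}. inv_into Y e (E w i)) i = w i" if "i \<in> {..<n}" for i
          using that inv[of i "w i"] PiE_mem[OF w that] by (simp add: E_def)
      qed (use w in \<open>auto simp: PiE_iff\<close>)
      show "E (\<lambda>i\<in>{..<n}. inv_into Y e (w i)) = w" if w: "w \<in> (\<Pi>\<^sub>E i\<in>{..<n}. W i)" for w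
      proof (rule extensionalityI[where A = "{..<n}"])
        show "E (\<lambda>i\<in>{..<n}. inv_into Y e (w i)) i = w i" if i: "i \<in> {..<n}" for i
        proof -
          have "w i \<in> e ` S i" using PiE_mem[OF w i] S i by simp
          then have "w i \<in> e ` Y" using S i by blast
          then show ?thesis using i by (simp add: E_def f_inv_into_f)
        qed
      qed (use w in \<open>auto simp: PiE_iff E_def\<close>)
    qed
    have sum: "finsum Z (E w) {..<n} = e (\<Sum>i<n. w i)" "(\<Sum>i<n. w i) \<in> Y" if w: "w \<in> (\<Pi>\<^sub>E i\<in>{..<n}. S i)" for w
    proof -
      have wY: "w i \<in> Y" if "i < n" for i using SY[OF that, of "w i"] PiE_mem[OF w] that by simp
      then show "(\<Sum>i<n. w i) \<in> Y" by (intro csubspaceD(6)[OF e(1)]) simp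
      have "finsum Z (E w) {..<n} = finsum Z (\<lambda>i. e (w i)) {..<n}"
        by (rule Z.finsum_cong') (use wY e(7) in \<open>auto simp: E_def\<close>)
      also have "\<dots> = e (\<Sum>i<n. w i)" by (rule chain_iso_finsum[OF modelsD(2)[OF m] wY])
      finally show "finsum Z (E w) {..<n} = e (\<Sum>i<n. w i)" .
    qed
    have "(\<exists>!w. w \<in> (\<Pi>\<^sub>E i\<in>{..<n}. W i) \<and> finsum Z w {..<n} = e x) \<longleftrightarrow>
        (\<exists>!w. w \<in> (\<Pi>\<^sub>E i\<in>{..<n}. S i) \<and> (\<Sum>i<n. w i) = x)" if x: "x \<in> Y" for x
    proof -
      let ?A = "{w \<in> (\<Pi>\<^sub>E i\<in>{..<n}. S i). (\<Sum>i<n. w i) = x}"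
      let ?B = "{w \<in> (\<Pi>\<^sub>E i\<in>{..<n}. W i). finsum Z w {..<n} = e x}"
      have PW: "(\<Pi>\<^sub>E i\<in>{..<n}. W i) = E ` (\<Pi>\<^sub>E i\<in>{..<n}. S i)" using bij by (simp add: bij_betw_def)
      have "?B = E ` ?A"
        unfolding PW using sum e(8)[OF _ x] by auto
      moreover have "inj_on E ?A" using bij by (auto simp: bij_betw_def intro: inj_on_subset)
      ultimately have "card ?B = card ?A" by (simp only: card_image)
      then show ?thesis by (simp only: ex1_iff_card)
    qed
    then show ?thesis by (simp add: e(3)[symmetric])
  qed
  show ?thesis
  proof
    assume d: "irreducible_decomposition complex_ring G Z \<sigma> n W"
    then have ex: "\<exists>S. invariant S \<and> S \<subseteq> Y \<and> W i = e ` S" if "i < n" for i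
      unfolding irreducible_decomposition_def models_subrepresentation[OF m] using that by simp
    define S where "S i = (SOME S. invariant S \<and> S \<subseteq> Y \<and> W i = e ` S)" for i
    have S: "invariant (S i) \<and> S i \<subseteq> Y \<and> W i = e ` S i" if "i < n" for i
      unfolding S_def by (rule someI_ex[OF ex[OF that]])
    have "decomposition Y n S"
      using d summands[OF S] sums[OF S] unfolding irreducible_decomposition_def decomposition_def by simp
    then show "\<exists>S. decomposition Y n S \<and> (\<forall>i<n. W i = e ` S i)" using S by (intro exI[of _ S]) simp
  next
    assume "\<exists>S. decomposition Y n S \<and> (\<forall>i<n. W i = e ` S i)"
    then obtain S where "decomposition Y n S \<and> (\<forall>i<n. W i = e ` S i)" ..
    then have S: "decomposition Y n S" "\<And>i. i < n \<Longrightarrow> W i = e ` S i" by simp_all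
    then have S': "invariant (S i) \<and> S i \<subseteq> Y \<and> W i = e ` S i" if "i < n" for i
      using that by (auto simp: decomposition_def irreducible_def)
    show "irreducible_decomposition complex_ring G Z \<sigma> n W"
      using S(1) summands[OF S'] sums[OF S'] models_representation[OF m]
      unfolding irreducible_decomposition_def decomposition_def by simp
  qed
qed

text \<open>A representation that is a quotient of a space of chains is isomorphic to a complement of the kernel.\<close>

lemma models_complement_of_kernel:
  assumes D: "invariant D" and surj: "e ` D = carrier Z" and zero: "e 0 = \<zero>\<^bsub>Z\<^esub>"
    and add: "\<And>x y. x \<in> D \<Longrightarrow> y \<in> D \<Longrightarrow> e (x + y) = e x \<oplus>\<^bsub>Z\<^esub> e y"
    and scale: "\<And>a x. x \<in> D \<Longrightarrow> e (cscale a x) = a \<odot>\<^bsub>Z\<^esub> e x"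
    and ext: "\<And>h. h \<in> carrier G \<Longrightarrow> \<sigma> h \<in> extensional (carrier Z)"
    and equi: "\<And>h x. h \<in> carrier G \<Longrightarrow> x \<in> D \<Longrightarrow> e (shift h x) = \<sigma> h (e x)"
    and p: "equivariant cell_chains p" "\<And>x. x \<in> cell_chains \<Longrightarrow> p x \<in> {x \<in> D. e x = \<zero>\<^bsub>Z\<^esub>}"
      "\<And>x. x \<in> {x \<in> D. e x = \<zero>\<^bsub>Z\<^esub>} \<Longrightarrow> p x = x"
  shows "models Z \<sigma> e {x \<in> D. p x = 0}"
proof -
  note i = invariantD[OF D]
  note c = csubspaceD[OF i(1)]
  have pD: "equivariant D p" by (rule equivariant_subset[OF p(1) i(2)])
  have Y: "invariant {x \<in> D. p x = 0}" by (rule invariant_kernel[OF D pD])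
  note pl = clinear_on_more[OF i(1) equivariantD(1)[OF pD]]
  have px: "p x \<in> D" "e (p x) = \<zero>\<^bsub>Z\<^esub>" if "x \<in> D" for x using p(2) i(2) that by auto
  have "e ` {x \<in> D. p x = 0} = carrier Z"
  proof
    show "carrier Z \<subseteq> e ` {x \<in> D. p x = 0}"
    proof
      fix z assume "z \<in> carrier Z"
      then obtain x where x: "x \<in> D" "z = e x" using surj by blast
      have d: "x - p x \<in> D" by (rule c(5)[OF x(1) px(1)[OF x(1)]])
      have "e x = e (x - p x) \<oplus>\<^bsub>Z\<^esub> \<zero>\<^bsub>Z\<^esub>" using add[OF d px(1)[OF x(1)]] px(2)[OF x(1)] by simp
      also have "\<dots> = e (x - p x)" using add[OF d c(1)] by (simp add: zero)
      finally have "z = e (x - p x)" using x(2) by simp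
      moreover have "p (x - p x) = 0"
        using pl(2)[OF x(1) px(1)[OF x(1)]] p(3)[of "p x"] px[OF x(1)] by simp
      ultimately show "z \<in> e ` {x \<in> D. p x = 0}" using d by blast
    qed
  qed (use surj in blast)
  moreover have "inj_on e {x \<in> D. p x = 0}"
  proof (rule inj_onI)
    fix x y assume x: "x \<in> {x \<in> D. p x = 0}" and y: "y \<in> {x \<in> D. p x = 0}" and eq: "e x = e y"
    have xD: "x \<in> D" and yD: "y \<in> D" using x y by simp_all
    have "e (x - y) = e y \<oplus>\<^bsub>Z\<^esub> e (- y)" using add[OF xD c(4)[OF yD]] eq by simp
    also have "\<dots> = \<zero>\<^bsub>Z\<^esub>" using add[OF yD c(4)[OF yD]] by (simp add: zero)
    finally have "p (x - y) = x - y" using p(3) c(5)[OF xD yD] by simp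
    then show "x = y" using pl(2)[OF xD yD] x y by simp
  qed
  ultimately show ?thesis
    using invariantD(1)[OF Y] zero add scale ext equi Y by (simp add: models_def chain_iso_def bij_betw_def)
qed

lemma lookup_shift:
  assumes h: "h \<in> carrier G" and g: "g \<in> carrier G" and x: "x \<in> cell_chains"
  shows "Poly_Mapping.lookup (shift h x) (h \<otimes> g, b) = Poly_Mapping.lookup x (g, b)"
proof -
  have "Poly_Mapping.lookup (shift h x) (h \<otimes> g, b) =
      (\<Sum>s\<in>Poly_Mapping.keys x. if h \<otimes> fst s = h \<otimes> g \<and> snd s = b then Poly_Mapping.lookup x s else 0)"
    unfolding shift_def clinear_extend_def lookup_sum
    by (rule sum.cong) (simp_all add: lookup_single when_def)
  also have "\<dots> = (\<Sum>s\<in>Poly_Mapping.keys x. if (g, b) = s then Poly_Mapping.lookup x s else 0)"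
  proof (rule sum.cong)
    fix s assume "s \<in> Poly_Mapping.keys x"
    then have "fst s \<in> carrier G" using x by (auto simp: cell_chains_def)
    then show "(if h \<otimes> fst s = h \<otimes> g \<and> snd s = b then Poly_Mapping.lookup x s else 0) =
        (if (g, b) = s then Poly_Mapping.lookup x s else 0)"
      using h g by (cases s) auto
  qed simp
  also have "\<dots> = Poly_Mapping.lookup x (g, b)" by (simp add: in_keys_iff)
  finally show ?thesis .
qed

text \<open>For a vector \<open>v \<noteq> 0\<close> of \<open>V\<close> the map \<open>e\<close> that sends the top side of the square \<open>g\<close> to \<open>\<rho> g v\<close> is onto, because its image is a
  subrepresentation of \<open>V\<close> that contains \<open>v\<close>.\<close>

lemma irreducible_model_exists:
  assumes "irreducible_representation complex_ring G V \<rho>"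
  obtains e Y where "models V \<rho> e Y" "Y \<subseteq> supported (carrier G \<times> {True})"
proof -
  have rep: "representation complex_ring G V \<rho>" and nz: "carrier V \<noteq> {\<zero>\<^bsub>V\<^esub>}"
    and irr: "\<And>W. subrepresentation complex_ring G V \<rho> W \<Longrightarrow> W = {\<zero>\<^bsub>V\<^esub>} \<or> W = carrier V"
    using assms by (auto simp: irreducible_representation_def)
  interpret V: vectorspace complex_ring V using rep by (simp add: representation_def)
  interpret A: group_action G "carrier V" \<rho> using rep by (simp add: representation_def)
  have hom: "\<rho> h \<in> module_hom complex_ring V V" if "h \<in> carrier G" for h
    using rep that by (simp add: representation_def)
  have \<rho>l: "\<rho> h (x \<oplus>\<^bsub>V\<^esub> y) = \<rho> h x \<oplus>\<^bsub>V\<^esub> \<rho> h y" "\<rho> h (a \<odot>\<^bsub>V\<^esub> x) = a \<odot>\<^bsub>V\<^esub> \<rho> h x" "\<rho> h x \<in> carrier V"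
    if "h \<in> carrier G" "x \<in> carrier V" "y \<in> carrier V" for h x y a
    using hom[OF that(1)] that(2,3) by (auto simp: module_hom_def)
  obtain v where v: "v \<in> carrier V" "v \<noteq> \<zero>\<^bsub>V\<^esub>" using nz V.zero_closed by blast
  let ?D = "supported (carrier G \<times> {True})"
  define e where "e x = finsum V (\<lambda>g. Poly_Mapping.lookup x (g, True) \<odot>\<^bsub>V\<^esub> \<rho> g v) (carrier G)" for x
  have cl: "(\<lambda>g. Poly_Mapping.lookup x (g, True) \<odot>\<^bsub>V\<^esub> \<rho> g v) \<in> carrier G \<rightarrow> carrier V" for x
    using \<rho>l(3)[OF _ v(1) v(1)] by auto
  have eV: "e x \<in> carrier V" for x unfolding e_def by (rule V.finsum_closed[OF cl])
  have e_add: "e (x + y) = e x \<oplus>\<^bsub>V\<^esub> e y" for x y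
  proof -
    have "e (x + y) = finsum V (\<lambda>g. Poly_Mapping.lookup x (g, True) \<odot>\<^bsub>V\<^esub> \<rho> g v \<oplus>\<^bsub>V\<^esub> Poly_Mapping.lookup y (g, True) \<odot>\<^bsub>V\<^esub> \<rho> g v) (carrier G)"
      unfolding e_def
      by (rule V.finsum_cong') (use \<rho>l(3)[OF _ v(1) v(1)] V.smult_l_distr in \<open>auto simp: lookup_add\<close>)
    then show ?thesis unfolding e_def by (simp add: V.finsum_addf[OF cl cl])
  qed
  have e_scale: "e (cscale a x) = a \<odot>\<^bsub>V\<^esub> e x" for a x
  proof -
    have "e (cscale a x) = finsum V (\<lambda>g. a \<odot>\<^bsub>V\<^esub> (Poly_Mapping.lookup x (g, True) \<odot>\<^bsub>V\<^esub> \<rho> g v)) (carrier G)"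
      unfolding e_def
      by (rule V.finsum_cong') (use \<rho>l(3)[OF _ v(1) v(1)] V.smult_assoc1 in auto)
    then show ?thesis unfolding e_def by (simp add: V.finsum_smult_ldistr[OF finite_G _ cl])
  qed
  have e_zero: "e 0 = \<zero>\<^bsub>V\<^esub>"
    using e_scale[of 0 0] V.smult_l_null[OF eV] by simp
  have e_shift: "e (shift h x) = \<rho> h (e x)" if h: "h \<in> carrier G" and x: "x \<in> cell_chains" for h x
  proof -
    have H: "module complex_ring V" by unfold_locales
    then have "mod_hom complex_ring V V (\<rho> h)"
      using hom[OF h] by (simp add: mod_hom_def mod_hom_axioms_def)
    then interpret H: mod_hom complex_ring V V "\<rho> h" .
    have finsum_hom: "\<rho> h (finsum V f A) = finsum V (\<lambda>g. \<rho> h (f g)) A" if "finite A" "f \<in> A \<rightarrow> carrier V" for f :: "'g \<Rightarrow> _" and A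
      using that
    proof (induction A)
      case empty
      then show ?case by simp
    next
      case (insert a A)
      then have f: "f \<in> A \<rightarrow> carrier V" "f a \<in> carrier V" by auto
      then have "(\<lambda>g. \<rho> h (f g)) \<in> A \<rightarrow> carrier V" "\<rho> h (f a) \<in> carrier V" using \<rho>l(3)[OF h] by auto
      then show ?case
        using f insert.IH[OF f(1)] insert.hyps V.finsum_closed[OF f(1)] \<rho>l(1)[OF h] by (simp add: V.finsum_insert)
    qed
    have im: "(\<otimes>) h ` carrier G = carrier G" by (rule surj_const_mult[OF h])
    have "e (shift h x) = finsum V (\<lambda>g. Poly_Mapping.lookup (shift h x) (g, True) \<odot>\<^bsub>V\<^esub> \<rho> g v) ((\<otimes>) h ` carrier G)"
      unfolding im e_def ..
    also have "\<dots> = finsum V (\<lambda>g. Poly_Mapping.lookup (shift h x) (h \<otimes> g, True) \<odot>\<^bsub>V\<^esub> \<rho> (h \<otimes> g) v) (carrier G)"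
      by (rule V.finsum_reindex) (use cl[of "shift h x"] inj_on_cmult[OF h] in \<open>simp_all add: im\<close>)
    also have "\<dots> = finsum V (\<lambda>g. \<rho> h (Poly_Mapping.lookup x (g, True) \<odot>\<^bsub>V\<^esub> \<rho> g v)) (carrier G)"
      by (rule V.finsum_cong')
        (use h x \<rho>l(2,3) v(1) in \<open>auto simp: lookup_shift A.composition_rule\<close>)
    also have "\<dots> = \<rho> h (e x)"
      unfolding e_def by (rule finsum_hom[OF finite_G cl, symmetric])
    finally show ?thesis .
  qed
  have D_sub: "?D \<subseteq> cell_chains" by (auto simp: supported_def cell_chains_def)
  have "shift h x \<in> ?D" if "h \<in> carrier G" "x \<in> ?D" for h x
    using that unfolding shift_def supported_def mem_Collect_eq by (intro keys_clinear_extend) auto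
  then have D: "invariant ?D"
    unfolding invariant_def using csubspace_supported D_sub by blast
  note cD = csubspaceD[OF invariantD(1)[OF D]]
  have surj: "e ` ?D = carrier V"
  proof -
    have "subrepresentation complex_ring G V \<rho> (e ` ?D)"
    proof -
      have "\<zero>\<^bsub>V\<^esub> \<in> e ` ?D" unfolding e_zero[symmetric] using cD(1) by (rule imageI)
      moreover have "e x \<oplus>\<^bsub>V\<^esub> e y \<in> e ` ?D" if "x \<in> ?D" "y \<in> ?D" for x y
        unfolding e_add[symmetric] using cD(2)[OF that] by (rule imageI)
      moreover have "a \<odot>\<^bsub>V\<^esub> e x \<in> e ` ?D" if "x \<in> ?D" for a x
        unfolding e_scale[symmetric] using cD(3)[OF that] by (rule imageI)
      moreover have "\<rho> h (e x) \<in> e ` ?D" if h: "h \<in> carrier G" and x: "x \<in> ?D" for h x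
      proof -
        have "\<rho> h (e x) = e (shift h x)" using e_shift[OF h, of x] x D_sub by (simp add: subset_iff)
        then show ?thesis using invariantD(4)[OF D h x] by simp
      qed
      moreover have "e ` ?D \<subseteq> carrier V" using eV by (simp add: image_subset_iff)
      ultimately show ?thesis
        by (simp add: subrepresentation_def subspace_iff[OF V.vectorspace_axioms] image_subset_iff)
    qed
    moreover have "e ` ?D \<noteq> {\<zero>\<^bsub>V\<^esub>}"
    proof -
      have scalars: "1 \<odot>\<^bsub>V\<^esub> x = x" "0 \<odot>\<^bsub>V\<^esub> x = \<zero>\<^bsub>V\<^esub>" if "x \<in> carrier V" for x
        using V.smult_one[OF that] V.smult_l_null[OF that] by simp_all
      have "e (Poly_Mapping.single (\<one>, True) 1) = finsum V (\<lambda>g. if \<one> = g then v else \<zero>\<^bsub>V\<^esub>) (carrier G)"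
        unfolding e_def
        by (rule V.finsum_cong')
          (use v(1) A.id_eq_one[symmetric] \<rho>l(3)[OF _ v(1) v(1)] scalars in \<open>auto simp: lookup_single when_def\<close>)
      also have "\<dots> = v" by (rule V.finsum_singleton[OF one_closed finite_G]) (use v(1) in simp)
      finally have "v = e (Poly_Mapping.single (\<one>, True) 1)" by simp
      moreover have "Poly_Mapping.single (\<one>, True) 1 \<in> ?D" by (simp add: supported_def)
      ultimately show ?thesis using v(2) by blast
    qed
    ultimately show ?thesis using irr by blast
  qed
  let ?N = "{x \<in> ?D. e x = \<zero>\<^bsub>V\<^esub>}"
  have "\<rho> h \<zero>\<^bsub>V\<^esub> = \<zero>\<^bsub>V\<^esub>" if "h \<in> carrier G" for h
    using e_shift[OF that, of 0] csubspaceD(1)[OF invariantD(1)[OF invariant_cell_chains]] by (simp add: shift_linear e_zero)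
  then have N: "invariant ?N"
    using D_sub cD invariantD(4)[OF D] e_shift by (auto simp: invariant_def csubspace_def e_zero e_add e_scale subset_iff)
  obtain p where p: "equivariant cell_chains p" "\<And>x. x \<in> cell_chains \<Longrightarrow> p x \<in> ?N" "\<And>x. x \<in> ?N \<Longrightarrow> p x = x"
    by (rule equivariant_projection_exists[OF N]) (rule that)
  have "models V \<rho> e {x \<in> ?D. p x = 0}"
  proof (rule models_complement_of_kernel[OF D surj e_zero e_add e_scale _ _ p])
    show "\<rho> h \<in> extensional (carrier V)" if "h \<in> carrier G" for h using A.bij_prop0[OF that] by (simp add: Bij_def)
    show "e (shift h x) = \<rho> h (e x)" if "h \<in> carrier G" "x \<in> ?D" for h x using e_shift that D_sub by blast
  qed
  then show thesis by (rule that) auto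
qed

end

section \<open>The multiplicity in the homology\<close>

context generated_origami
begin

lemma homology_model:
  assumes p: "equivariant cell_chains p" "\<And>x. x \<in> cell_chains \<Longrightarrow> p x \<in> face_chains" "\<And>x. x \<in> face_chains \<Longrightarrow> p x = x"
  shows "models U (origami_H10_action G r u) \<Psi> {x \<in> cycles0. p x = 0}"
proof (rule models_complement_of_kernel[OF invariant_cycles0])
  have "cycles0 \<subseteq> cell_chains" by (auto simp: cycles0_def)
  then have N: "{x \<in> cycles0. \<Psi> x = \<zero>\<^bsub>U\<^esub>} = face_chains"
    using \<Psi>_zero_iff face_chains_subset by (auto simp: subset_iff)
  show "p x \<in> {x \<in> cycles0. \<Psi> x = \<zero>\<^bsub>U\<^esub>}" if "x \<in> cell_chains" for x unfolding N by (rule p(2)[OF that])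
  show "p x = x" if "x \<in> {x \<in> cycles0. \<Psi> x = \<zero>\<^bsub>U\<^esub>}" for x using p(3) that unfolding N .
  show "origami_H10_action G r u h \<in> extensional (carrier U)" for h by (simp add: origami_H10_action_def)
qed (simp_all add: carrier_U U_simps action_\<Psi> p(1))

lemma dim_fixed_space:
  assumes m: "models V \<rho> e Y" and c: "c \<in> carrier G"
  shows "vectorspace.dim complex_ring (V\<lparr>carrier := {v \<in> carrier V. \<rho> c v = v}\<rparr>) = cdim (fixed c Y)"
proof -
  note e = chain_isoD[OF modelsD(2)[OF m]]
  note i = invariantD[OF modelsD(1)[OF m]]
  have "{v \<in> carrier V. \<rho> c v = v} = e ` fixed c Y"
    using e(8)[OF i(4)[OF c]] by (auto simp: fixed_def e(3)[symmetric] modelsD(4)[OF m c, symmetric])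
  moreover have "csubspace (fixed c Y)"
    using csubspaceD[OF e(1)] by (simp add: csubspace_def fixed_def shift_linear)
  moreover have "fixed c Y \<subseteq> Y" by (auto simp: fixed_def)
  ultimately have "chain_iso (fixed c Y) (V\<lparr>carrier := {v \<in> carrier V. \<rho> c v = v}\<rparr>) e"
    using chain_iso_subspace[OF modelsD(2)[OF m]] by simp
  then show ?thesis
    by (rule chain_iso_dim[OF _ finite_cells]) (use \<open>fixed c Y \<subseteq> Y\<close> i(3) in blast)
qed

theorem multiplicity_in_homology:
  assumes V: "irreducible_representation complex_ring G V \<rho>"
  shows "has_multiplicity complex_ring G V \<rho> U (origami_H10_action G r u)
    (codimension complex_ring V {v \<in> carrier V. \<rho> (r \<otimes> u \<otimes> inv r \<otimes> inv u) v = v})"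
proof -
  obtain e Y where m: "models V \<rho> e Y" and Y: "Y \<subseteq> supported (carrier G \<times> {True})"
    by (rule irreducible_model_exists[OF V]) (rule that)
  have irr: "irreducible Y" using V models_irreducible[OF m] by simp
  obtain p where p: "equivariant cell_chains p" "\<And>x. x \<in> cell_chains \<Longrightarrow> p x \<in> face_chains"
    "\<And>x. x \<in> face_chains \<Longrightarrow> p x = x"
    by (rule equivariant_projection_exists[OF invariant_face_chains]) (rule that)
  let ?H = "{x \<in> cycles0. p x = 0}"
  have h: "models U (origami_H10_action G r u) \<Psi> ?H" by (rule homology_model[OF p])
  have dimV: "vectorspace.dim complex_ring V = cdim Y"
    by (rule chain_iso_dim[OF modelsD(2)[OF m] finite_cells invariantD(3)[OF modelsD(1)[OF m]]])
  have codim: "codimension complex_ring V {v \<in> carrier V. \<rho> (r \<otimes> u \<otimes> inv r \<otimes> inv u) v = v} = cdim Y - cdim (fixed commutator Y)"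
    using dim_fixed_space[OF m, of commutator] by (simp add: codimension_def dimV)
  have "card {i. i < n \<and> isomorphic_representations complex_ring G V \<rho>
      (U\<lparr>carrier := W i\<rparr>) (restrict_representation (origami_H10_action G r u) (W i))} = cdim Y - cdim (fixed commutator Y)"
    if d: "irreducible_decomposition complex_ring G U (origami_H10_action G r u) n W" for n W
  proof -
    obtain S where "decomposition ?H n S \<and> (\<forall>i<n. W i = \<Psi> ` S i)"
      using iffD1[OF models_decomposition[OF h] d] ..
    then have S: "decomposition ?H n S" "\<And>i. i < n \<Longrightarrow> W i = \<Psi> ` S i" by simp_all
    have "isomorphic_representations complex_ring G V \<rho>
        (U\<lparr>carrier := W i\<rparr>) (restrict_representation (origami_H10_action G r u) (W i)) \<longleftrightarrow> isomorphic Y (S i)"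
      if i: "i < n" for i
    proof -
      have "irreducible (S i)" "S i \<subseteq> ?H" using S(1) i by (simp_all add: decomposition_def)
      then have "models (U\<lparr>carrier := \<Psi> ` S i\<rparr>) (restrict_representation (origami_H10_action G r u) (\<Psi> ` S i)) \<Psi> (S i)"
        by (intro models_subset[OF h]) (simp add: irreducible_def)
      then show ?thesis unfolding S(2)[OF i] by (rule models_isomorphic[OF m])
    qed
    then have "{i. i < n \<and> isomorphic_representations complex_ring G V \<rho>
        (U\<lparr>carrier := W i\<rparr>) (restrict_representation (origami_H10_action G r u) (W i))} = {i. i < n \<and> isomorphic Y (S i)}"
      by (simp cong: conj_cong)
    then show ?thesis using count_summands[OF irr Y p S(1)] by simp
  qed
  moreover have "\<exists>n W. irreducible_decomposition complex_ring G U (origami_H10_action G r u) n W"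
  proof -
    obtain n S where S: "decomposition ?H n S"
      using decomposition_exists[OF modelsD(1)[OF h]] by (elim exE)
    have "irreducible_decomposition complex_ring G U (origami_H10_action G r u) n (\<lambda>i. \<Psi> ` S i)"
      unfolding models_decomposition[OF h] by (rule exI[of _ S]) (simp add: S)
    then show ?thesis by (intro exI)
  qed
  ultimately show ?thesis by (simp add: has_multiplicity_def codim)
qed

end

theorem theorem1p1:
  fixes G :: "('g, 'b) monoid_scheme" (structure)
    and g\<^sub>r g\<^sub>u :: 'g
    and V :: "(complex, 'v, 'c) module_scheme"
    and \<rho> :: "'g \<Rightarrow> 'v \<Rightarrow> 'v"
  assumes "group G" and "finite (carrier G)"
    and "g\<^sub>r \<in> carrier G" and "g\<^sub>u \<in> carrier G"
    and "generate G {g\<^sub>r, g\<^sub>u} = carrier G"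
    and "irreducible_representation complex_ring G V \<rho>"
  shows "has_multiplicity complex_ring G V \<rho>
           (origami_H10 G g\<^sub>r g\<^sub>u) (origami_H10_action G g\<^sub>r g\<^sub>u)
           (codimension complex_ring V
              {v \<in> carrier V. \<rho> (g\<^sub>r \<otimes> g\<^sub>u \<otimes> inv g\<^sub>r \<otimes> inv g\<^sub>u) v = v})"
proof -
  interpret generated_origami G g\<^sub>r g\<^sub>u
    using assms(1-5)
    by (simp add: generated_origami_def generated_origami_axioms_def origami_def origami_axioms_def)
  show ?thesis by (rule multiplicity_in_homology[OF assms(6)])
qed

end
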